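(* Let $\mathscr M$ be a 2-category and let $B$ be an object of $\mathscr M$. Then there is a canonical 2-functor $$L\colon\operatorname{Map}(\mathscr M,B)\to\mathbf{Comon}(B),$$ sending a map $w$ to the comonad $w\cdot\overline w$. If $\mathscr M$ has Tannaka-Krein objects, then there is a canonical pseudofunctor $$R=\operatorname{Rep}(-)\colon\mathbf{Comon}(B)\to\operatorname{Map}(\mathscr M,B),$$ sending a comonad $c$ to its Tannaka-Krein object $v_c\colon\operatorname{Rep}(c)\to B$, such that $L$ is left biadjoint to $R$.
   Context: $\mathbf{Comon}(B)$ is the category of comonoids in the strict monoidal category $\mathscr M(B,B)$ (tensor product = composition), regarded as a 2-category with only identity 2-cells. A map $f\colon A\to B$ in $\mathscr M$ is a 1-cell together with a chosen right adjoint $\overline f$, unit $\eta\colon\mathrm{id}\Rightarrow\overline ff$ and counit $\varepsilon\colon f\overline f\Rightarrow\mathrm{id}$. $\operatorname{Map}(\mathscr M,B)$ has objects the maps $w\colon A\to B$; 1-cells from $w\colon A\to B$ to $w'\colon A'\to B$ are pairs $(a,\alpha)$ with $a\colon A\to A'$ a map and $\alpha\colon w'a\Rightarrow w$ an invertible 2-cell; 2-cells $(a,\alpha)\Rightarrow(b,\beta)$ are 2-cells $\phi\colon a\Rightarrow b$ with $\beta\circ(w'\phi)=\alpha$. $L(w)=w\overline w$ has comultiplication $w\eta\overline w$ and counit $\varepsilon$; $L(a,\alpha)\colon w\overline w\Rightarrow w'\overline{w'}$ is $\alpha^{-1}\overline w\colon w\overline w\Rightarrow w'a\overline w$ followed by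 $w'$ whiskered with the composite $a\overline w\Rightarrow\overline{w'}w'a\overline w\Rightarrow\overline{w'}w\overline w\Rightarrow\overline{w'}$ induced by the unit of $w'\dashv\overline{w'}$, $\alpha$, and the counit of $w\dashv\overline w$. A coaction of a comonad $c\colon B\to B$ is a 1-cell $v\colon A\to B$ with a coassociative counital 2-cell $\rho\colon v\Rightarrow cv$; a morphism $(v,\rho)\to(v',\rho')$ is a 2-cell $\alpha\colon v\Rightarrow v'$ with $\rho'\alpha=(c\alpha)\rho$. A map coaction is one with $v$ a map. A Tannaka-Krein object of $c$ is an object $\operatorname{Rep}(c)$ with a map coaction $(v_c,\rho_c)$, $v_c\colon\operatorname{Rep}(c)\to B$, such that every map coaction $(v,\rho)$ with $v\colon A\to B$ is isomorphic to $(v_cf,\rho_cf)$ for some map $f\colon A\to\operatorname{Rep}(c)$, and for every map $f\colon A\to\operatorname{Rep}(c)$ and every 1-cell $g\colon A\to\operatorname{Rep}(c)$, whiskering with $v_c$ is a bijection from 2-cells $g\Rightarrow f$ to morphisms of coactions $(v_cg,\rho_cg)\to(v_cf,\rho_cf)$. $\mathscr M$ has Tannaka-Krein objects if every comonad in $\mathscr M$ has one. On a comonad morphism $\phi\colon c\to c'$, $\operatorname{Rep}(\phi)=(f,\lambda_\phi)$, where $f\colon\operatorname{Rep}(c)\to\operatorname{Rep}(c')$ is a chosen map and $\lambda_\phi\colon v_{c'}f\cong v_c$ is a chosen isomorphism of $c'$-coactions from $(v_{c'}f,\rho_{c'}f)$ to $(v_c,(\phi v_c)\rho_c)$. *)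

theory Defs
  imports Main
begin

section \<open>Categories, functors and equivalences\<close>

record ('x, 'm) cat =
  CObj :: "'x set"
  CMor :: "'m set"
  CDom :: "'m \<Rightarrow> 'x"
  CCod :: "'m \<Rightarrow> 'x"
  CId :: "'x \<Rightarrow> 'm"
  CComp :: "'m \<Rightarrow> 'm \<Rightarrow> 'm"

locale category =
  fixes C :: "('x, 'm) cat"
  assumes dom_closed: "f \<in> CMor C \<Longrightarrow> CDom C f \<in> CObj C"
    and cod_closed: "f \<in> CMor C \<Longrightarrow> CCod C f \<in> CObj C"
    and id_closed: "x \<in> CObj C \<Longrightarrow> CId C x \<in> CMor C"
    and dom_id: "x \<in> CObj C \<Longrightarrow> CDom C (CId C x) = x"
    and cod_id: "x \<in> CObj C \<Longrightarrow> CCod C (CId C x) = x"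
    and comp_closed: "\<lbrakk>g \<in> CMor C; f \<in> CMor C; CDom C g = CCod C f\<rbrakk> \<Longrightarrow> CComp C g f \<in> CMor C"
    and dom_comp: "\<lbrakk>g \<in> CMor C; f \<in> CMor C; CDom C g = CCod C f\<rbrakk> \<Longrightarrow> CDom C (CComp C g f) = CDom C f"
    and cod_comp: "\<lbrakk>g \<in> CMor C; f \<in> CMor C; CDom C g = CCod C f\<rbrakk> \<Longrightarrow> CCod C (CComp C g f) = CCod C g"
    and comp_assoc: "\<lbrakk>h \<in> CMor C; g \<in> CMor C; f \<in> CMor C; CDom C h = CCod C g; CDom C g = CCod C f\<rbrakk>
          \<Longrightarrow> CComp C (CComp C h g) f = CComp C h (CComp C g f)"
    and comp_id_left: "f \<in> CMor C \<Longrightarrow> CComp C (CId C (CCod C f)) f = f"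
    and comp_id_right: "f \<in> CMor C \<Longrightarrow> CComp C f (CId C (CDom C f)) = f"

record ('x, 'm, 'y, 'n) func =
  onO :: "'x \<Rightarrow> 'y"
  onM :: "'m \<Rightarrow> 'n"

definition id_func :: "('x, 'm, 'x, 'm) func" where
  "id_func = \<lparr>onO = (\<lambda>x. x), onM = (\<lambda>f. f)\<rparr>"

definition comp_func :: "('y, 'n, 'z, 'k) func \<Rightarrow> ('x, 'm, 'y, 'n) func \<Rightarrow> ('x, 'm, 'z, 'k) func" where
  "comp_func G F = \<lparr>onO = (\<lambda>x. onO G (onO F x)), onM = (\<lambda>f. onM G (onM F f))\<rparr>"

locale is_functor =
  C: category C + D: category D
  for C :: "('x, 'm) cat" and D :: "('y, 'n) cat" and F :: "('x, 'm, 'y, 'n) func" +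
  assumes obj: "x \<in> CObj C \<Longrightarrow> onO F x \<in> CObj D"
    and mor: "f \<in> CMor C \<Longrightarrow> onM F f \<in> CMor D"
    and dom: "f \<in> CMor C \<Longrightarrow> CDom D (onM F f) = onO F (CDom C f)"
    and cod: "f \<in> CMor C \<Longrightarrow> CCod D (onM F f) = onO F (CCod C f)"
    and id: "x \<in> CObj C \<Longrightarrow> onM F (CId C x) = CId D (onO F x)"
    and comp: "\<lbrakk>g \<in> CMor C; f \<in> CMor C; CDom C g = CCod C f\<rbrakk>
          \<Longrightarrow> onM F (CComp C g f) = CComp D (onM F g) (onM F f)"

definition cat_iso :: "('x, 'm) cat \<Rightarrow> 'm \<Rightarrow> bool" where
  "cat_iso C f \<longleftrightarrow> f \<in> CMor C \<and>
     (\<exists>g \<in> CMor C. CDom C g = CCod C f \<and> CCod C g = CDom C f \<and>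
        CComp C g f = CId C (CDom C f) \<and> CComp C f g = CId C (CCod C f))"

locale natural_iso =
  F: is_functor C D F + G: is_functor C D G
  for C :: "('x, 'm) cat" and D :: "('y, 'n) cat"
    and F G :: "('x, 'm, 'y, 'n) func" and \<tau> :: "'x \<Rightarrow> 'n" +
  assumes iso: "x \<in> CObj C \<Longrightarrow> cat_iso D (\<tau> x)"
    and dom: "x \<in> CObj C \<Longrightarrow> CDom D (\<tau> x) = onO F x"
    and cod: "x \<in> CObj C \<Longrightarrow> CCod D (\<tau> x) = onO G x"
    and natural: "f \<in> CMor C \<Longrightarrow> CComp D (\<tau> (CCod C f)) (onM F f) = CComp D (onM G f) (\<tau> (CDom C f))"

definition is_equivalence :: "('x, 'm) cat \<Rightarrow> ('y, 'n) cat \<Rightarrow> ('x, 'm, 'y, 'n) func \<Rightarrow> bool" where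
  "is_equivalence C D F \<longleftrightarrow> is_functor C D F \<and>
     (\<exists>G \<sigma> \<tau>. is_functor D C G \<and> natural_iso C C id_func (comp_func G F) \<sigma>
        \<and> natural_iso D D (comp_func F G) id_func \<tau>)"

section \<open>Strict 2-categories\<close>

text \<open>Compositions are written in applicative order: \<open>g \<odot> f\<close> for 1-cells \<open>f : A \<rightarrow> B\<close>,
  \<open>g : B \<rightarrow> C\<close>, and likewise \<open>\<beta> \<star> \<alpha>\<close> for horizontal and \<open>\<beta> \<bullet> \<alpha>\<close> for vertical
  composition of 2-cells. The operations are unconstrained on non-composable arguments.\<close>

record ('o, 'a, 'c) two_cat =
  Ob :: "'o set"
  Arr :: "'a set"
  Cell :: "'c set"
  Src :: "'a \<Rightarrow> 'o"
  Trg :: "'a \<Rightarrow> 'o"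
  Dom :: "'c \<Rightarrow> 'a"
  Cod :: "'c \<Rightarrow> 'a"
  Id1 :: "'o \<Rightarrow> 'a"
  Comp1 :: "'a \<Rightarrow> 'a \<Rightarrow> 'a" (infixl "\<odot>\<index>" 75)
  Id2 :: "'a \<Rightarrow> 'c"
  VComp :: "'c \<Rightarrow> 'c \<Rightarrow> 'c" (infixl "\<bullet>\<index>" 65)
  HComp :: "'c \<Rightarrow> 'c \<Rightarrow> 'c" (infixl "\<star>\<index>" 70)

definition arr_in :: "('o, 'a, 'c) two_cat \<Rightarrow> 'a \<Rightarrow> 'o \<Rightarrow> 'o \<Rightarrow> bool"
    ("\<guillemotleft>_ : _ \<rightarrow>\<index> _\<guillemotright>") where
  "\<guillemotleft>f : A \<rightarrow> B\<guillemotright> \<longleftrightarrow> f \<in> Arr M \<and> Src M f = A \<and> Trg M f = B" for M (structure)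

definition cell_in :: "('o, 'a, 'c) two_cat \<Rightarrow> 'c \<Rightarrow> 'a \<Rightarrow> 'a \<Rightarrow> bool"
    ("\<guillemotleft>_ : _ \<Rightarrow>\<index> _\<guillemotright>") where
  "\<guillemotleft>\<alpha> : f \<Rightarrow> g\<guillemotright> \<longleftrightarrow> \<alpha> \<in> Cell M \<and> Dom M \<alpha> = f \<and> Cod M \<alpha> = g" for M (structure)

abbreviation lwhisker :: "('o, 'a, 'c) two_cat \<Rightarrow> 'a \<Rightarrow> 'c \<Rightarrow> 'c" (infixr "\<rhd>\<index>" 70) where
  "lwhisker M f \<alpha> \<equiv> HComp M (Id2 M f) \<alpha>"

abbreviation rwhisker :: "('o, 'a, 'c) two_cat \<Rightarrow> 'c \<Rightarrow> 'a \<Rightarrow> 'c" (infixl "\<lhd>\<index>" 71) where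
  "rwhisker M \<alpha> f \<equiv> HComp M \<alpha> (Id2 M f)"

definition hom_cat :: "('o, 'a, 'c) two_cat \<Rightarrow> 'o \<Rightarrow> 'o \<Rightarrow> ('a, 'c) cat" where
  "hom_cat M A B =
     \<lparr>CObj = {f. \<guillemotleft>f : A \<rightarrow> B\<guillemotright>},
      CMor = {\<alpha> \<in> Cell M. \<guillemotleft>Dom M \<alpha> : A \<rightarrow> B\<guillemotright>},
      CDom = Dom M, CCod = Cod M, CId = Id2 M, CComp = VComp M\<rparr>" for M (structure)

locale two_category =
  fixes M :: "('o, 'a, 'c) two_cat" (structure)
  assumes src_closed: "f \<in> Arr M \<Longrightarrow> Src M f \<in> Ob M"
    and trg_closed: "f \<in> Arr M \<Longrightarrow> Trg M f \<in> Ob M"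
    and dom_closed: "\<alpha> \<in> Cell M \<Longrightarrow> Dom M \<alpha> \<in> Arr M"
    and hom_category: "\<lbrakk>A \<in> Ob M; B \<in> Ob M\<rbrakk> \<Longrightarrow> category (hom_cat M A B)"
    and id1_in: "A \<in> Ob M \<Longrightarrow> \<guillemotleft>Id1 M A : A \<rightarrow> A\<guillemotright>"
    and comp1_in: "\<lbrakk>\<guillemotleft>f : A \<rightarrow> B\<guillemotright>; \<guillemotleft>g : B \<rightarrow> C\<guillemotright>\<rbrakk> \<Longrightarrow> \<guillemotleft>g \<odot> f : A \<rightarrow> C\<guillemotright>"
    and comp1_assoc: "\<lbrakk>\<guillemotleft>f : A \<rightarrow> B\<guillemotright>; \<guillemotleft>g : B \<rightarrow> C\<guillemotright>; \<guillemotleft>h : C \<rightarrow> D\<guillemotright>\<rbrakk>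
          \<Longrightarrow> (h \<odot> g) \<odot> f = h \<odot> (g \<odot> f)"
    and comp1_id_left: "\<guillemotleft>f : A \<rightarrow> B\<guillemotright> \<Longrightarrow> Id1 M B \<odot> f = f"
    and comp1_id_right: "\<guillemotleft>f : A \<rightarrow> B\<guillemotright> \<Longrightarrow> f \<odot> Id1 M A = f"
    and hcomp_in: "\<lbrakk>\<guillemotleft>f : A \<rightarrow> B\<guillemotright>; \<guillemotleft>g : B \<rightarrow> C\<guillemotright>; \<guillemotleft>\<alpha> : f \<Rightarrow> f'\<guillemotright>; \<guillemotleft>\<beta> : g \<Rightarrow> g'\<guillemotright>\<rbrakk>
          \<Longrightarrow> \<guillemotleft>\<beta> \<star> \<alpha> : g \<odot> f \<Rightarrow> g' \<odot> f'\<guillemotright>"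
    and hcomp_id2: "\<lbrakk>\<guillemotleft>f : A \<rightarrow> B\<guillemotright>; \<guillemotleft>g : B \<rightarrow> C\<guillemotright>\<rbrakk> \<Longrightarrow> Id2 M g \<star> Id2 M f = Id2 M (g \<odot> f)"
    and interchange: "\<lbrakk>\<guillemotleft>f : A \<rightarrow> B\<guillemotright>; \<guillemotleft>g : B \<rightarrow> C\<guillemotright>;
            \<guillemotleft>\<alpha> : f \<Rightarrow> f'\<guillemotright>; \<guillemotleft>\<alpha>' : f' \<Rightarrow> f''\<guillemotright>; \<guillemotleft>\<beta> : g \<Rightarrow> g'\<guillemotright>; \<guillemotleft>\<beta>' : g' \<Rightarrow> g''\<guillemotright>\<rbrakk>
          \<Longrightarrow> (\<beta>' \<bullet> \<beta>) \<star> (\<alpha>' \<bullet> \<alpha>) = (\<beta>' \<star> \<alpha>') \<bullet> (\<beta> \<star> \<alpha>)"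
    and hcomp_assoc: "\<lbrakk>\<guillemotleft>f : A \<rightarrow> B\<guillemotright>; \<guillemotleft>g : B \<rightarrow> C\<guillemotright>; \<guillemotleft>h : C \<rightarrow> D\<guillemotright>;
            \<guillemotleft>\<alpha> : f \<Rightarrow> f'\<guillemotright>; \<guillemotleft>\<beta> : g \<Rightarrow> g'\<guillemotright>; \<guillemotleft>\<gamma> : h \<Rightarrow> h'\<guillemotright>\<rbrakk>
          \<Longrightarrow> (\<gamma> \<star> \<beta>) \<star> \<alpha> = \<gamma> \<star> (\<beta> \<star> \<alpha>)"
    and hcomp_id_left: "\<lbrakk>\<guillemotleft>f : A \<rightarrow> B\<guillemotright>; \<guillemotleft>\<alpha> : f \<Rightarrow> f'\<guillemotright>\<rbrakk> \<Longrightarrow> Id1 M B \<rhd> \<alpha> = \<alpha>"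
    and hcomp_id_right: "\<lbrakk>\<guillemotleft>f : A \<rightarrow> B\<guillemotright>; \<guillemotleft>\<alpha> : f \<Rightarrow> f'\<guillemotright>\<rbrakk> \<Longrightarrow> \<alpha> \<lhd> Id1 M A = \<alpha>"

definition inverse2 :: "('o, 'a, 'c) two_cat \<Rightarrow> 'c \<Rightarrow> 'c \<Rightarrow> bool" where
  "inverse2 M \<alpha> \<beta> \<longleftrightarrow> \<alpha> \<in> Cell M \<and> \<guillemotleft>\<beta> : Cod M \<alpha> \<Rightarrow> Dom M \<alpha>\<guillemotright> \<and>
     \<beta> \<bullet> \<alpha> = Id2 M (Dom M \<alpha>) \<and> \<alpha> \<bullet> \<beta> = Id2 M (Cod M \<alpha>)" for M (structure)

definition invertible2 :: "('o, 'a, 'c) two_cat \<Rightarrow> 'c \<Rightarrow> bool" where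
  "invertible2 M \<alpha> \<longleftrightarrow> (\<exists>\<beta>. inverse2 M \<alpha> \<beta>)"

definition inv2 :: "('o, 'a, 'c) two_cat \<Rightarrow> 'c \<Rightarrow> 'c" where
  "inv2 M \<alpha> = (THE \<beta>. inverse2 M \<alpha> \<beta>)"

section \<open>2-functors, pseudofunctors and biadjunctions\<close>

record ('o, 'a, 'c, 'p, 'b, 'd) two_fun =
  F0 :: "'o \<Rightarrow> 'p"
  F1 :: "'a \<Rightarrow> 'b"
  F2 :: "'c \<Rightarrow> 'd"

record ('o, 'a, 'c, 'p, 'b, 'd) pseudo_fun = "('o, 'a, 'c, 'p, 'b, 'd) two_fun" +
  PUnit :: "'o \<Rightarrow> 'd"
  PComp :: "'a \<Rightarrow> 'a \<Rightarrow> 'd"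

locale pre_two_functor =
  C: two_category C + D: two_category D
  for C :: "('o, 'a, 'c) two_cat" and D :: "('p, 'b, 'd) two_cat"
    and F :: "('o, 'a, 'c, 'p, 'b, 'd, 'z) two_fun_scheme" +
  assumes obj: "A \<in> Ob C \<Longrightarrow> F0 F A \<in> Ob D"
    and arr: "\<guillemotleft>f : A \<rightarrow>\<^bsub>C\<^esub> A'\<guillemotright> \<Longrightarrow> \<guillemotleft>F1 F f : F0 F A \<rightarrow>\<^bsub>D\<^esub> F0 F A'\<guillemotright>"
    and cell: "\<guillemotleft>\<alpha> : f \<Rightarrow>\<^bsub>C\<^esub> g\<guillemotright> \<Longrightarrow> \<guillemotleft>F2 F \<alpha> : F1 F f \<Rightarrow>\<^bsub>D\<^esub> F1 F g\<guillemotright>"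
    and id2: "f \<in> Arr C \<Longrightarrow> F2 F (Id2 C f) = Id2 D (F1 F f)"
    and vcomp: "\<lbrakk>\<guillemotleft>\<alpha> : f \<Rightarrow>\<^bsub>C\<^esub> g\<guillemotright>; \<guillemotleft>\<beta> : g \<Rightarrow>\<^bsub>C\<^esub> h\<guillemotright>\<rbrakk>
          \<Longrightarrow> F2 F (\<beta> \<bullet>\<^bsub>C\<^esub> \<alpha>) = F2 F \<beta> \<bullet>\<^bsub>D\<^esub> F2 F \<alpha>"

locale two_functor = pre_two_functor C D F
  for C :: "('o, 'a, 'c) two_cat" and D :: "('p, 'b, 'd) two_cat"
    and F :: "('o, 'a, 'c, 'p, 'b, 'd) two_fun" +
  assumes id1: "A \<in> Ob C \<Longrightarrow> F1 F (Id1 C A) = Id1 D (F0 F A)"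
    and comp1: "\<lbrakk>\<guillemotleft>f : A \<rightarrow>\<^bsub>C\<^esub> A'\<guillemotright>; \<guillemotleft>g : A' \<rightarrow>\<^bsub>C\<^esub> A''\<guillemotright>\<rbrakk>
          \<Longrightarrow> F1 F (g \<odot>\<^bsub>C\<^esub> f) = F1 F g \<odot>\<^bsub>D\<^esub> F1 F f"
    and hcomp: "\<lbrakk>\<guillemotleft>f : A \<rightarrow>\<^bsub>C\<^esub> A'\<guillemotright>; \<guillemotleft>g : A' \<rightarrow>\<^bsub>C\<^esub> A''\<guillemotright>; \<guillemotleft>\<alpha> : f \<Rightarrow>\<^bsub>C\<^esub> f'\<guillemotright>; \<guillemotleft>\<beta> : g \<Rightarrow>\<^bsub>C\<^esub> g'\<guillemotright>\<rbrakk>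
          \<Longrightarrow> F2 F (\<beta> \<star>\<^bsub>C\<^esub> \<alpha>) = F2 F \<beta> \<star>\<^bsub>D\<^esub> F2 F \<alpha>"

text \<open>The constraints of a pseudofunctor are \<open>PUnit A : 1 \<Rightarrow> F 1\<close> and
  \<open>PComp g f : F g \<odot> F f \<Rightarrow> F (g \<odot> f)\<close>.\<close>

locale pseudofunctor = pre_two_functor C D F
  for C :: "('o, 'a, 'c) two_cat" and D :: "('p, 'b, 'd) two_cat"
    and F :: "('o, 'a, 'c, 'p, 'b, 'd) pseudo_fun" +
  assumes punit_in: "A \<in> Ob C \<Longrightarrow> \<guillemotleft>PUnit F A : Id1 D (F0 F A) \<Rightarrow>\<^bsub>D\<^esub> F1 F (Id1 C A)\<guillemotright>"
    and punit_iso: "A \<in> Ob C \<Longrightarrow> invertible2 D (PUnit F A)"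
    and pcomp_in: "\<lbrakk>\<guillemotleft>f : A \<rightarrow>\<^bsub>C\<^esub> A'\<guillemotright>; \<guillemotleft>g : A' \<rightarrow>\<^bsub>C\<^esub> A''\<guillemotright>\<rbrakk>
          \<Longrightarrow> \<guillemotleft>PComp F g f : F1 F g \<odot>\<^bsub>D\<^esub> F1 F f \<Rightarrow>\<^bsub>D\<^esub> F1 F (g \<odot>\<^bsub>C\<^esub> f)\<guillemotright>"
    and pcomp_iso: "\<lbrakk>\<guillemotleft>f : A \<rightarrow>\<^bsub>C\<^esub> A'\<guillemotright>; \<guillemotleft>g : A' \<rightarrow>\<^bsub>C\<^esub> A''\<guillemotright>\<rbrakk> \<Longrightarrow> invertible2 D (PComp F g f)"
    and pcomp_natural:
      "\<lbrakk>\<guillemotleft>f : A \<rightarrow>\<^bsub>C\<^esub> A'\<guillemotright>; \<guillemotleft>g : A' \<rightarrow>\<^bsub>C\<^esub> A''\<guillemotright>; \<guillemotleft>\<alpha> : f \<Rightarrow>\<^bsub>C\<^esub> f'\<guillemotright>; \<guillemotleft>\<beta> : g \<Rightarrow>\<^bsub>C\<^esub> g'\<guillemotright>\<rbrakk>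
        \<Longrightarrow> PComp F g' f' \<bullet>\<^bsub>D\<^esub> (F2 F \<beta> \<star>\<^bsub>D\<^esub> F2 F \<alpha>) = F2 F (\<beta> \<star>\<^bsub>C\<^esub> \<alpha>) \<bullet>\<^bsub>D\<^esub> PComp F g f"
    and pcomp_assoc:
      "\<lbrakk>\<guillemotleft>f : A \<rightarrow>\<^bsub>C\<^esub> A'\<guillemotright>; \<guillemotleft>g : A' \<rightarrow>\<^bsub>C\<^esub> A''\<guillemotright>; \<guillemotleft>h : A'' \<rightarrow>\<^bsub>C\<^esub> A'''\<guillemotright>\<rbrakk>
        \<Longrightarrow> PComp F (h \<odot>\<^bsub>C\<^esub> g) f \<bullet>\<^bsub>D\<^esub> (PComp F h g \<lhd>\<^bsub>D\<^esub> F1 F f)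
          = PComp F h (g \<odot>\<^bsub>C\<^esub> f) \<bullet>\<^bsub>D\<^esub> (F1 F h \<rhd>\<^bsub>D\<^esub> PComp F g f)"
    and punit_left: "\<guillemotleft>f : A \<rightarrow>\<^bsub>C\<^esub> A'\<guillemotright>
        \<Longrightarrow> PComp F (Id1 C A') f \<bullet>\<^bsub>D\<^esub> (PUnit F A' \<lhd>\<^bsub>D\<^esub> F1 F f) = Id2 D (F1 F f)"
    and punit_right: "\<guillemotleft>f : A \<rightarrow>\<^bsub>C\<^esub> A'\<guillemotright>
        \<Longrightarrow> PComp F f (Id1 C A) \<bullet>\<^bsub>D\<^esub> (F1 F f \<rhd>\<^bsub>D\<^esub> PUnit F A) = Id2 D (F1 F f)"

definition as_pseudo ::
  "('p, 'b, 'd) two_cat \<Rightarrow> ('o, 'a, 'c, 'p, 'b, 'd) two_fun \<Rightarrow> ('o, 'a, 'c, 'p, 'b, 'd) pseudo_fun" where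
  "as_pseudo D F =
     \<lparr>F0 = F0 F, F1 = F1 F, F2 = F2 F,
      PUnit = (\<lambda>A. Id2 D (Id1 D (F0 F A))),
      PComp = (\<lambda>g f. Id2 D (F1 F g \<odot>\<^bsub>D\<^esub> F1 F f))\<rparr>"

text \<open>A biadjunction, given by equivalences of categories \<open>\<Phi> w c : D(L w, c) \<rightarrow> C(w, R c)\<close>
  that are pseudonatural in the pair \<open>(w, c)\<close>: the structure cell at \<open>h : w' \<rightarrow> w\<close> and
  \<open>k : c \<rightarrow> c'\<close> is the natural isomorphism with components
  \<open>\<nu> h k g : R k \<odot> \<Phi> g \<odot> h \<Rightarrow> \<Phi> (k \<odot> g \<odot> L h)\<close> for \<open>g : L w \<rightarrow> c\<close>. The last two assumptions
  are its compatibility with identities and with composition.\<close>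

locale hom_biadjunction =
  L: pseudofunctor C D L + R: pseudofunctor D C R
  for C :: "('o, 'a, 'c) two_cat" and D :: "('p, 'b, 'd) two_cat"
    and L :: "('o, 'a, 'c, 'p, 'b, 'd) pseudo_fun"
    and R :: "('p, 'b, 'd, 'o, 'a, 'c) pseudo_fun"
    and \<Phi> :: "'o \<Rightarrow> 'p \<Rightarrow> ('b, 'd, 'a, 'c) func"
    and \<nu> :: "'a \<Rightarrow> 'b \<Rightarrow> 'b \<Rightarrow> 'c" +
  assumes equivalence: "\<lbrakk>w \<in> Ob C; c \<in> Ob D\<rbrakk>
      \<Longrightarrow> is_equivalence (hom_cat D (F0 L w) c) (hom_cat C w (F0 R c)) (\<Phi> w c)"
    and nu_in: "\<lbrakk>\<guillemotleft>h : w' \<rightarrow>\<^bsub>C\<^esub> w\<guillemotright>; \<guillemotleft>k : c \<rightarrow>\<^bsub>D\<^esub> c'\<guillemotright>; \<guillemotleft>g : F0 L w \<rightarrow>\<^bsub>D\<^esub> c\<guillemotright>\<rbrakk>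
      \<Longrightarrow> \<guillemotleft>\<nu> h k g : F1 R k \<odot>\<^bsub>C\<^esub> onO (\<Phi> w c) g \<odot>\<^bsub>C\<^esub> h \<Rightarrow>\<^bsub>C\<^esub> onO (\<Phi> w' c') (k \<odot>\<^bsub>D\<^esub> g \<odot>\<^bsub>D\<^esub> F1 L h)\<guillemotright>"
    and nu_iso: "\<lbrakk>\<guillemotleft>h : w' \<rightarrow>\<^bsub>C\<^esub> w\<guillemotright>; \<guillemotleft>k : c \<rightarrow>\<^bsub>D\<^esub> c'\<guillemotright>; \<guillemotleft>g : F0 L w \<rightarrow>\<^bsub>D\<^esub> c\<guillemotright>\<rbrakk>
      \<Longrightarrow> invertible2 C (\<nu> h k g)"
    and nu_natural: "\<lbrakk>\<guillemotleft>h : w' \<rightarrow>\<^bsub>C\<^esub> w\<guillemotright>; \<guillemotleft>k : c \<rightarrow>\<^bsub>D\<^esub> c'\<guillemotright>; \<guillemotleft>g : F0 L w \<rightarrow>\<^bsub>D\<^esub> c\<guillemotright>;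
        \<guillemotleft>\<chi> : h \<Rightarrow>\<^bsub>C\<^esub> h2\<guillemotright>; \<guillemotleft>\<kappa> : k \<Rightarrow>\<^bsub>D\<^esub> k2\<guillemotright>; \<guillemotleft>\<theta> : g \<Rightarrow>\<^bsub>D\<^esub> g2\<guillemotright>\<rbrakk>
      \<Longrightarrow> \<nu> h2 k2 g2 \<bullet>\<^bsub>C\<^esub> (F2 R \<kappa> \<star>\<^bsub>C\<^esub> onM (\<Phi> w c) \<theta> \<star>\<^bsub>C\<^esub> \<chi>)
        = onM (\<Phi> w' c') (\<kappa> \<star>\<^bsub>D\<^esub> \<theta> \<star>\<^bsub>D\<^esub> F2 L \<chi>) \<bullet>\<^bsub>C\<^esub> \<nu> h k g"
    and nu_id: "\<lbrakk>w \<in> Ob C; c \<in> Ob D; \<guillemotleft>g : F0 L w \<rightarrow>\<^bsub>D\<^esub> c\<guillemotright>\<rbrakk>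
      \<Longrightarrow> \<nu> (Id1 C w) (Id1 D c) g \<bullet>\<^bsub>C\<^esub> (PUnit R c \<lhd>\<^bsub>C\<^esub> onO (\<Phi> w c) g)
        = onM (\<Phi> w c) (g \<rhd>\<^bsub>D\<^esub> PUnit L w)"
    and nu_comp: "\<lbrakk>\<guillemotleft>h : w' \<rightarrow>\<^bsub>C\<^esub> w\<guillemotright>; \<guillemotleft>h' : w'' \<rightarrow>\<^bsub>C\<^esub> w'\<guillemotright>; \<guillemotleft>k : c \<rightarrow>\<^bsub>D\<^esub> c'\<guillemotright>; \<guillemotleft>k' : c' \<rightarrow>\<^bsub>D\<^esub> c''\<guillemotright>;
        \<guillemotleft>g : F0 L w \<rightarrow>\<^bsub>D\<^esub> c\<guillemotright>\<rbrakk>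
      \<Longrightarrow> \<nu> (h \<odot>\<^bsub>C\<^esub> h') (k' \<odot>\<^bsub>D\<^esub> k) g \<bullet>\<^bsub>C\<^esub> (PComp R k' k \<lhd>\<^bsub>C\<^esub> (onO (\<Phi> w c) g \<odot>\<^bsub>C\<^esub> h \<odot>\<^bsub>C\<^esub> h'))
        = onM (\<Phi> w'' c'') ((k' \<odot>\<^bsub>D\<^esub> k \<odot>\<^bsub>D\<^esub> g) \<rhd>\<^bsub>D\<^esub> PComp L h h')
            \<bullet>\<^bsub>C\<^esub> \<nu> h' k' (k \<odot>\<^bsub>D\<^esub> g \<odot>\<^bsub>D\<^esub> F1 L h)
            \<bullet>\<^bsub>C\<^esub> (F1 R k' \<rhd>\<^bsub>C\<^esub> (\<nu> h k g \<lhd>\<^bsub>C\<^esub> h'))"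

definition left_biadjoint ::
  "('o, 'a, 'c) two_cat \<Rightarrow> ('p, 'b, 'd) two_cat \<Rightarrow> ('o, 'a, 'c, 'p, 'b, 'd) pseudo_fun
     \<Rightarrow> ('p, 'b, 'd, 'o, 'a, 'c) pseudo_fun \<Rightarrow> bool" where
  "left_biadjoint C D L R \<longleftrightarrow> (\<exists>\<Phi> \<nu>. hom_biadjunction C D L R \<Phi> \<nu>)"

section \<open>Maps, and the 2-category of maps into an object\<close>

datatype ('a, 'c) lmap = LMap (arr: 'a) (radj: 'a) (unit: 'c) (counit: 'c)

definition is_map :: "('o, 'a, 'c) two_cat \<Rightarrow> ('a, 'c) lmap \<Rightarrow> 'o \<Rightarrow> 'o \<Rightarrow> bool" where
  "is_map M w A B \<longleftrightarrow>
     \<guillemotleft>arr w : A \<rightarrow> B\<guillemotright> \<and> \<guillemotleft>radj w : B \<rightarrow> A\<guillemotright> \<and>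
     \<guillemotleft>unit w : Id1 M A \<Rightarrow> radj w \<odot> arr w\<guillemotright> \<and>
     \<guillemotleft>counit w : arr w \<odot> radj w \<Rightarrow> Id1 M B\<guillemotright> \<and>
     (counit w \<lhd> arr w) \<bullet> (arr w \<rhd> unit w) = Id2 M (arr w) \<and>
     (radj w \<rhd> counit w) \<bullet> (unit w \<lhd> radj w) = Id2 M (radj w)" for M (structure)

definition id_map :: "('o, 'a, 'c) two_cat \<Rightarrow> 'o \<Rightarrow> ('a, 'c) lmap" where
  "id_map M A = LMap (Id1 M A) (Id1 M A) (Id2 M (Id1 M A)) (Id2 M (Id1 M A))"

definition comp_map :: "('o, 'a, 'c) two_cat \<Rightarrow> ('a, 'c) lmap \<Rightarrow> ('a, 'c) lmap \<Rightarrow> ('a, 'c) lmap" where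
  "comp_map M b a =
     LMap (arr b \<odot> arr a) (radj a \<odot> radj b)
       ((radj a \<rhd> (unit b \<lhd> arr a)) \<bullet> unit a)
       (counit b \<bullet> (arr b \<rhd> (counit a \<lhd> radj b)))" for M (structure)

text \<open>\<open>MArr w a \<alpha> w'\<close> is the 1-cell \<open>(a, \<alpha>) : w \<rightarrow> w'\<close>, and \<open>MCell p \<phi> q\<close> is the 2-cell
  \<open>\<phi> : p \<Rightarrow> q\<close>; both carry their source and target explicitly.\<close>

datatype ('a, 'c) marr =
  MArr (msrc: "('a, 'c) lmap") (mmap: "('a, 'c) lmap") (miso: 'c) (mtrg: "('a, 'c) lmap")

datatype ('a, 'c) mcell = MCell (mdom: "('a, 'c) marr") (mcell: 'c) (mcod: "('a, 'c) marr")

definition Map_arrs :: "('o, 'a, 'c) two_cat \<Rightarrow> 'o \<Rightarrow> ('a, 'c) marr set" where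
  "Map_arrs M B = {MArr w a \<alpha> w' | w a \<alpha> w'.
     \<exists>A A'. is_map M w A B \<and> is_map M w' A' B \<and> is_map M a A A' \<and>
       \<guillemotleft>\<alpha> : arr w' \<odot> arr a \<Rightarrow> arr w\<guillemotright> \<and> invertible2 M \<alpha>}" for M (structure)

definition Map_cells :: "('o, 'a, 'c) two_cat \<Rightarrow> 'o \<Rightarrow> ('a, 'c) mcell set" where
  "Map_cells M B = {MCell p \<phi> q | p \<phi> q.
     p \<in> Map_arrs M B \<and> q \<in> Map_arrs M B \<and> msrc p = msrc q \<and> mtrg p = mtrg q \<and>
     \<guillemotleft>\<phi> : arr (mmap p) \<Rightarrow> arr (mmap q)\<guillemotright> \<and>
     miso q \<bullet> (arr (mtrg p) \<rhd> \<phi>) = miso p}" for M (structure)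

definition Map_id1 :: "('o, 'a, 'c) two_cat \<Rightarrow> ('a, 'c) lmap \<Rightarrow> ('a, 'c) marr" where
  "Map_id1 M w = MArr w (id_map M (Src M (arr w))) (Id2 M (arr w)) w"

definition Map_comp1 :: "('o, 'a, 'c) two_cat \<Rightarrow> ('a, 'c) marr \<Rightarrow> ('a, 'c) marr \<Rightarrow> ('a, 'c) marr" where
  "Map_comp1 M q p =
     MArr (msrc p) (comp_map M (mmap q) (mmap p)) (miso p \<bullet> (miso q \<lhd> arr (mmap p))) (mtrg q)"
  for M (structure)

definition Map_cat ::
  "('o, 'a, 'c) two_cat \<Rightarrow> 'o \<Rightarrow> (('a, 'c) lmap, ('a, 'c) marr, ('a, 'c) mcell) two_cat" where
  "Map_cat M B =
     \<lparr>Ob = {w. \<exists>A. is_map M w A B},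
      Arr = Map_arrs M B,
      Cell = Map_cells M B,
      Src = msrc, Trg = mtrg, Dom = mdom, Cod = mcod,
      Id1 = Map_id1 M,
      Comp1 = Map_comp1 M,
      Id2 = (\<lambda>p. MCell p (Id2 M (arr (mmap p))) p),
      VComp = (\<lambda>\<psi> \<phi>. MCell (mdom \<phi>) (mcell \<psi> \<bullet> mcell \<phi>) (mcod \<psi>)),
      HComp = (\<lambda>\<psi> \<phi>. MCell (Map_comp1 M (mdom \<psi>) (mdom \<phi>)) (mcell \<psi> \<star> mcell \<phi>)
                        (Map_comp1 M (mcod \<psi>) (mcod \<phi>)))\<rparr>" for M (structure)

section \<open>Comonads, and the locally discrete 2-category of comonoids in \<open>M(B,B)\<close>\<close>

datatype ('a, 'c) comonad = Comonad (cfun: 'a) (comult: 'c) (cunit: 'c)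

definition is_comonad :: "('o, 'a, 'c) two_cat \<Rightarrow> 'o \<Rightarrow> ('a, 'c) comonad \<Rightarrow> bool" where
  "is_comonad M B c \<longleftrightarrow>
     \<guillemotleft>cfun c : B \<rightarrow> B\<guillemotright> \<and> \<guillemotleft>comult c : cfun c \<Rightarrow> cfun c \<odot> cfun c\<guillemotright> \<and> \<guillemotleft>cunit c : cfun c \<Rightarrow> Id1 M B\<guillemotright> \<and>
     (comult c \<lhd> cfun c) \<bullet> comult c = (cfun c \<rhd> comult c) \<bullet> comult c \<and>
     (cunit c \<lhd> cfun c) \<bullet> comult c = Id2 M (cfun c) \<and>
     (cfun c \<rhd> cunit c) \<bullet> comult c = Id2 M (cfun c)" for M (structure)

datatype ('a, 'c) comonad_mor =
  ComonadMor (cdom: "('a, 'c) comonad") (ccell: 'c) (ccod: "('a, 'c) comonad")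

definition Comon_arrs :: "('o, 'a, 'c) two_cat \<Rightarrow> 'o \<Rightarrow> ('a, 'c) comonad_mor set" where
  "Comon_arrs M B = {ComonadMor c \<phi> c' | c \<phi> c'.
     is_comonad M B c \<and> is_comonad M B c' \<and> \<guillemotleft>\<phi> : cfun c \<Rightarrow> cfun c'\<guillemotright> \<and>
     comult c' \<bullet> \<phi> = (\<phi> \<star> \<phi>) \<bullet> comult c \<and> cunit c' \<bullet> \<phi> = cunit c}" for M (structure)

definition Comon_comp :: "('o, 'a, 'c) two_cat
    \<Rightarrow> ('a, 'c) comonad_mor \<Rightarrow> ('a, 'c) comonad_mor \<Rightarrow> ('a, 'c) comonad_mor" where
  "Comon_comp M \<psi> \<phi> = ComonadMor (cdom \<phi>) (ccell \<psi> \<bullet> ccell \<phi>) (ccod \<psi>)" for M (structure)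

text \<open>Every 2-cell is an identity, and is represented by the 1-cell of which it is the identity.\<close>

definition Comon_cat ::
  "('o, 'a, 'c) two_cat \<Rightarrow> 'o \<Rightarrow> (('a, 'c) comonad, ('a, 'c) comonad_mor, ('a, 'c) comonad_mor) two_cat"
where
  "Comon_cat M B =
     \<lparr>Ob = {c. is_comonad M B c},
      Arr = Comon_arrs M B,
      Cell = Comon_arrs M B,
      Src = cdom, Trg = ccod, Dom = (\<lambda>\<phi>. \<phi>), Cod = (\<lambda>\<phi>. \<phi>),
      Id1 = (\<lambda>c. ComonadMor c (Id2 M (cfun c)) c),
      Comp1 = Comon_comp M,
      Id2 = (\<lambda>\<phi>. \<phi>),
      VComp = (\<lambda>\<psi> \<phi>. \<phi>),
      HComp = Comon_comp M\<rparr>"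

section \<open>The 2-functor \<open>L\<close>\<close>

definition L_obj :: "('o, 'a, 'c) two_cat \<Rightarrow> ('a, 'c) lmap \<Rightarrow> ('a, 'c) comonad" where
  "L_obj M w = Comonad (arr w \<odot> radj w) (arr w \<rhd> (unit w \<lhd> radj w)) (counit w)" for M (structure)

definition L_arr :: "('o, 'a, 'c) two_cat \<Rightarrow> ('a, 'c) marr \<Rightarrow> ('a, 'c) comonad_mor" where
  "L_arr M p =
     (let w = msrc p; w' = mtrg p; a = arr (mmap p); \<alpha> = miso p;
          mate = (radj w' \<rhd> counit w) \<bullet> (radj w' \<rhd> (\<alpha> \<lhd> radj w)) \<bullet> (unit w' \<lhd> (a \<odot> radj w))
      in ComonadMor (L_obj M w) ((arr w' \<rhd> mate) \<bullet> (inv2 M \<alpha> \<lhd> radj w)) (L_obj M w'))"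
  for M (structure)

definition L_fun :: "('o, 'a, 'c) two_cat
    \<Rightarrow> (('a, 'c) lmap, ('a, 'c) marr, ('a, 'c) mcell,
        ('a, 'c) comonad, ('a, 'c) comonad_mor, ('a, 'c) comonad_mor) two_fun" where
  "L_fun M = \<lparr>F0 = L_obj M, F1 = L_arr M, F2 = (\<lambda>\<phi>. L_arr M (mdom \<phi>))\<rparr>"

section \<open>Coactions and Tannaka-Krein objects\<close>

definition is_coaction ::
  "('o, 'a, 'c) two_cat \<Rightarrow> 'o \<Rightarrow> ('a, 'c) comonad \<Rightarrow> 'o \<Rightarrow> 'a \<Rightarrow> 'c \<Rightarrow> bool" where
  "is_coaction M B c A v \<rho> \<longleftrightarrow>
     \<guillemotleft>v : A \<rightarrow> B\<guillemotright> \<and> \<guillemotleft>\<rho> : v \<Rightarrow> cfun c \<odot> v\<guillemotright> \<and>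
     (comult c \<lhd> v) \<bullet> \<rho> = (cfun c \<rhd> \<rho>) \<bullet> \<rho> \<and>
     (cunit c \<lhd> v) \<bullet> \<rho> = Id2 M v" for M (structure)

definition coaction_mor ::
  "('o, 'a, 'c) two_cat \<Rightarrow> ('a, 'c) comonad \<Rightarrow> 'a \<Rightarrow> 'c \<Rightarrow> 'a \<Rightarrow> 'c \<Rightarrow> 'c \<Rightarrow> bool" where
  "coaction_mor M c v \<rho> v' \<rho>' \<alpha> \<longleftrightarrow>
     \<guillemotleft>\<alpha> : v \<Rightarrow> v'\<guillemotright> \<and> \<rho>' \<bullet> \<alpha> = (cfun c \<rhd> \<alpha>) \<bullet> \<rho>" for M (structure)

definition coaction_iso ::
  "('o, 'a, 'c) two_cat \<Rightarrow> ('a, 'c) comonad \<Rightarrow> 'a \<Rightarrow> 'c \<Rightarrow> 'a \<Rightarrow> 'c \<Rightarrow> 'c \<Rightarrow> bool" where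
  "coaction_iso M c v \<rho> v' \<rho>' \<alpha> \<longleftrightarrow> coaction_mor M c v \<rho> v' \<rho>' \<alpha> \<and>
     (\<exists>\<beta>. coaction_mor M c v' \<rho>' v \<rho> \<beta> \<and> inverse2 M \<alpha> \<beta>)"

text \<open>\<open>is_TK_object M B c E v \<rho>\<close>: the object \<open>E\<close> with the map coaction \<open>(v, \<rho>)\<close>, \<open>v : E \<rightarrow> B\<close>,
  is a Tannaka-Krein object of the comonad \<open>c\<close> on \<open>B\<close>.\<close>

definition is_TK_object ::
  "('o, 'a, 'c) two_cat \<Rightarrow> 'o \<Rightarrow> ('a, 'c) comonad \<Rightarrow> 'o \<Rightarrow> ('a, 'c) lmap \<Rightarrow> 'c \<Rightarrow> bool" where
  "is_TK_object M B c E v \<rho> \<longleftrightarrow>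
     is_map M v E B \<and> is_coaction M B c E (arr v) \<rho> \<and>
     (\<forall>A u \<sigma>. is_map M u A B \<and> is_coaction M B c A (arr u) \<sigma> \<longrightarrow>
        (\<exists>f \<alpha>. is_map M f A E \<and> coaction_iso M c (arr u) \<sigma> (arr v \<odot> arr f) (\<rho> \<lhd> arr f) \<alpha>)) \<and>
     (\<forall>A f g. is_map M f A E \<and> \<guillemotleft>g : A \<rightarrow> E\<guillemotright> \<longrightarrow>
        bij_betw (\<lambda>\<theta>. arr v \<rhd> \<theta>)
          {\<theta>. \<guillemotleft>\<theta> : g \<Rightarrow> arr f\<guillemotright>}
          {\<alpha>. coaction_mor M c (arr v \<odot> g) (\<rho> \<lhd> g) (arr v \<odot> arr f) (\<rho> \<lhd> arr f) \<alpha>})" for M (structure)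

definition has_TK_objects :: "('o, 'a, 'c) two_cat \<Rightarrow> bool" where
  "has_TK_objects M \<longleftrightarrow> (\<forall>B c. B \<in> Ob M \<and> is_comonad M B c \<longrightarrow> (\<exists>E v \<rho>. is_TK_object M B c E v \<rho>))"

section \<open>The pseudofunctor \<open>Rep\<close>\<close>

text \<open>The choices on which \<open>Rep\<close> depends: for each comonad \<open>c\<close> on \<open>B\<close> a Tannaka-Krein object
  \<open>(rep_v c, rep_rho c)\<close>, and for each comonad morphism \<open>\<phi>\<close> the pair
  \<open>(f, l) = (rep_f \<phi>, rep_lam \<phi>)\<close>.\<close>

record ('a, 'c) rep_choice =
  rep_v :: "('a, 'c) comonad \<Rightarrow> ('a, 'c) lmap"
  rep_rho :: "('a, 'c) comonad \<Rightarrow> 'c"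
  rep_f :: "('a, 'c) comonad_mor \<Rightarrow> ('a, 'c) lmap"
  rep_lam :: "('a, 'c) comonad_mor \<Rightarrow> 'c"

definition is_rep_choice :: "('o, 'a, 'c) two_cat \<Rightarrow> 'o \<Rightarrow> ('a, 'c) rep_choice \<Rightarrow> bool" where
  "is_rep_choice M B T \<longleftrightarrow>
     (\<forall>c. is_comonad M B c \<longrightarrow> is_TK_object M B c (Src M (arr (rep_v T c))) (rep_v T c) (rep_rho T c)) \<and>
     (\<forall>c \<phi> c'. ComonadMor c \<phi> c' \<in> Comon_arrs M B \<longrightarrow>
        (let v = rep_v T c; v' = rep_v T c';
             f = rep_f T (ComonadMor c \<phi> c'); l = rep_lam T (ComonadMor c \<phi> c')
         in is_map M f (Src M (arr v)) (Src M (arr v')) \<and>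
            coaction_iso M c' (arr v' \<odot> arr f) (rep_rho T c' \<lhd> arr f)
              (arr v) ((\<phi> \<lhd> arr v) \<bullet> rep_rho T c) l))" for M (structure)

definition Rep_arr :: "('a, 'c) rep_choice \<Rightarrow> ('a, 'c) comonad_mor \<Rightarrow> ('a, 'c) marr" where
  "Rep_arr T \<phi> = MArr (rep_v T (cdom \<phi>)) (rep_f T \<phi>) (rep_lam T \<phi>) (rep_v T (ccod \<phi>))"

text \<open>Parallel 2-cells into a map with target \<open>Rep(c)\<close> agree as soon as they agree after whiskering
  with \<open>v\<^sub>c\<close>, so that a 2-cell of \<open>Map_cat M B\<close> between 1-cells with target \<open>v\<^sub>c\<close> is unique if it
  exists. This determines the constraints of \<open>Rep\<close>.\<close>

definition Rep_fun :: "('o, 'a, 'c) two_cat \<Rightarrow> 'o \<Rightarrow> ('a, 'c) rep_choice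
    \<Rightarrow> (('a, 'c) comonad, ('a, 'c) comonad_mor, ('a, 'c) comonad_mor,
        ('a, 'c) lmap, ('a, 'c) marr, ('a, 'c) mcell) pseudo_fun" where
  "Rep_fun M B T =
     \<lparr>F0 = rep_v T,
      F1 = Rep_arr T,
      F2 = (\<lambda>\<phi>. Id2 (Map_cat M B) (Rep_arr T \<phi>)),
      PUnit = (\<lambda>c. THE \<theta>. \<guillemotleft>\<theta> : Id1 (Map_cat M B) (rep_v T c)
                 \<Rightarrow>\<^bsub>Map_cat M B\<^esub> Rep_arr T (Id1 (Comon_cat M B) c)\<guillemotright>),
      PComp = (\<lambda>\<psi> \<phi>. THE \<theta>. \<guillemotleft>\<theta> : Rep_arr T \<psi> \<odot>\<^bsub>Map_cat M B\<^esub> Rep_arr T \<phi>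
                 \<Rightarrow>\<^bsub>Map_cat M B\<^esub> Rep_arr T (\<psi> \<odot>\<^bsub>Comon_cat M B\<^esub> \<phi>)\<guillemotright>)\<rparr>"

end

(*
  A comonad morphism psi : L(w) -> c is the same thing as a coaction of c on w, namely
  (psi w)(w eta), with inverse sigma |-> (c eps)(sigma wbar). An invertible 2-cell
  alpha : w' a => w carries a coaction rho of c on w' to a unique coaction on w for which alpha is
  a morphism from rho a; call it the transport of rho along (a, alpha). In these terms L(a, alpha)
  is the morphism that corresponds to the transport of the canonical coaction of L(w') on w'.

  The universal property of v_c says that each coaction of c on a map w is a transport of rho_c
  along some 1-cell w -> v_c, and that between two 1-cells w -> v_c there is a 2-cell, then unique
  and invertible, exactly when they transport rho_c to the same coaction. So every constraint
  2-cell exists because two transports agree, and all naturality and coherence equations hold by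
  uniqueness.
*)

theory Submission
  imports Defs
begin

text \<open>The coactions of \<open>c\<close> on a map \<open>w\<close> form a set that depends
  contravariantly on \<open>w\<close>, by transport, and covariantly on \<open>c\<close>, by
  composing with a comonad morphism. The two actions commute, and 2-cells between maps act
  trivially. \<open>L(w)\<close> represents this set in the variable \<open>c\<close> on the nose:
  each coaction is exactly one comonad morphism, so the strict functoriality of \<open>L\<close> is
  inherited from that of transport, and mates of composites need not be computed. \<open>v_c\<close>
  represents it in the variable \<open>w\<close> only up to equivalence: the 1-cell that realizes a
  coaction must be chosen and is unique up to a unique invertible 2-cell. This asymmetry is why
  \<open>L\<close> is a 2-functor and \<open>Rep\<close> only a pseudofunctor. Accordingly two kinds
  of equations occur. Those between comonad morphisms are strict, as Comon(B) has no 2-cells but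
  identities, and are tested on coactions. Those between 2-cells into some \<open>v_c\<close> need
  only matching boundaries; there the work is in the typing, where strict associativity and unit
  laws make the boundaries literally equal.\<close>

lemma hom_cat_sel:
  "CObj (hom_cat N A B) = {f. f \<in> Arr N \<and> Src N f = A \<and> Trg N f = B}"
  "CMor (hom_cat N A B) = {x \<in> Cell N. Dom N x \<in> Arr N \<and> Src N (Dom N x) = A \<and> Trg N (Dom N x) = B}"
  "CDom (hom_cat N A B) = Dom N" "CCod (hom_cat N A B) = Cod N" "CId (hom_cat N A B) = Id2 N"
  "CComp (hom_cat N A B) = VComp N"
  by (auto simp: hom_cat_def arr_in_def)

lemma as_pseudo_sel:
  "F0 (as_pseudo D F) = F0 F" "F1 (as_pseudo D F) = F1 F" "F2 (as_pseudo D F) = F2 F"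
  "PUnit (as_pseudo D F) A = Id2 D (Id1 D (F0 F A))"
  "PComp (as_pseudo D F) g f = Id2 D (Comp1 D (F1 F g) (F1 F f))"
  by (simp_all add: as_pseudo_def)

lemma is_functor_id: "category C \<Longrightarrow> is_functor C C id_func"
  by (simp add: is_functor_def is_functor_axioms_def id_func_def)

lemma is_functor_comp: "is_functor D E G \<Longrightarrow> is_functor C D F \<Longrightarrow> is_functor C E (comp_func G F)"
  by (simp add: is_functor_def is_functor_axioms_def comp_func_def)

context two_category
begin

subsection \<open>Whiskering and the interchange law\<close>

text \<open>The laws of vertical composition are available only through the hom-categories, so a
  2-cell is placed in the hom-category given by the ends of its domain. The rules that follow
  restate the laws with side conditions on \<open>Src\<close>, \<open>Trg\<close>,
  \<open>Dom\<close> and \<open>Cod\<close>, which rewriting can discharge.\<close>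

lemma hom_cat_of:
  assumes "\<alpha> \<in> Cell M"
  shows "category (hom_cat M (Src M (Dom M \<alpha>)) (Trg M (Dom M \<alpha>)))"
  using assms by (simp add: hom_category src_closed trg_closed dom_closed)

lemma cod_arr [simp]:
  assumes "\<alpha> \<in> Cell M"
  shows "Cod M \<alpha> \<in> Arr M" "Src M (Cod M \<alpha>) = Src M (Dom M \<alpha>)" "Trg M (Cod M \<alpha>) = Trg M (Dom M \<alpha>)"
  using category.cod_closed[OF hom_cat_of[OF assms], of \<alpha>] assms
  by (auto simp: hom_cat_def arr_in_def dom_closed)

lemma id2_cell [simp]:
  assumes "f \<in> Arr M"
  shows "Id2 M f \<in> Cell M" "Dom M (Id2 M f) = f" "Cod M (Id2 M f) = f"
proof -
  interpret H: category "hom_cat M (Src M f) (Trg M f)"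
    using assms by (simp add: hom_category src_closed trg_closed)
  show "Id2 M f \<in> Cell M" "Dom M (Id2 M f) = f" "Cod M (Id2 M f) = f"
    using H.id_closed[of f] H.dom_id[of f] H.cod_id[of f] assms by (auto simp: hom_cat_def arr_in_def)
qed

lemma id1_arr [simp]:
  assumes "A \<in> Ob M"
  shows "Id1 M A \<in> Arr M" "Src M (Id1 M A) = A" "Trg M (Id1 M A) = A"
  using id1_in[OF assms] by (auto simp: arr_in_def)

lemma comp1_arr [simp]:
  assumes "f \<in> Arr M" "g \<in> Arr M" "Src M g = Trg M f"
  shows "g \<odot> f \<in> Arr M" "Src M (g \<odot> f) = Src M f" "Trg M (g \<odot> f) = Trg M g"
  using comp1_in[of f "Src M f" "Trg M f" g "Trg M g"] assms by (auto simp: arr_in_def)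

lemma comp1_assoc' [simp]:
  assumes "f \<in> Arr M" "g \<in> Arr M" "h \<in> Arr M" "Src M g = Trg M f" "Src M h = Trg M g"
  shows "(h \<odot> g) \<odot> f = h \<odot> (g \<odot> f)"
  using comp1_assoc[of f "Src M f" "Trg M f" g "Trg M g" h "Trg M h"] assms by (auto simp: arr_in_def)

lemma comp1_id [simp]:
  assumes "f \<in> Arr M"
  shows "Trg M f = A \<Longrightarrow> Id1 M A \<odot> f = f" "Src M f = A \<Longrightarrow> f \<odot> Id1 M A = f"
  using assms comp1_id_left[of f "Src M f" "Trg M f"] comp1_id_right[of f "Src M f" "Trg M f"]
  by (auto simp: arr_in_def)

lemma vcomp_cell [simp]:
  assumes "\<alpha> \<in> Cell M" "\<beta> \<in> Cell M" "Dom M \<beta> = Cod M \<alpha>"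
  shows "\<beta> \<bullet> \<alpha> \<in> Cell M" "Dom M (\<beta> \<bullet> \<alpha>) = Dom M \<alpha>" "Cod M (\<beta> \<bullet> \<alpha>) = Cod M \<beta>"
proof -
  interpret H: category "hom_cat M (Src M (Dom M \<alpha>)) (Trg M (Dom M \<alpha>))"
    using assms hom_cat_of by simp
  show "\<beta> \<bullet> \<alpha> \<in> Cell M" "Dom M (\<beta> \<bullet> \<alpha>) = Dom M \<alpha>" "Cod M (\<beta> \<bullet> \<alpha>) = Cod M \<beta>"
    using H.comp_closed[of \<beta> \<alpha>] H.dom_comp[of \<beta> \<alpha>] H.cod_comp[of \<beta> \<alpha>] assms
    by (auto simp: hom_cat_def arr_in_def dom_closed)
qed

lemma dom_arr [simp]: "\<alpha> \<in> Cell M \<Longrightarrow> Dom M \<alpha> \<in> Arr M"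
  by (rule dom_closed)

lemma vcomp_assoc [simp]:
  assumes "\<alpha> \<in> Cell M" "\<beta> \<in> Cell M" "\<gamma> \<in> Cell M" "Dom M \<beta> = Cod M \<alpha>" "Dom M \<gamma> = Cod M \<beta>"
  shows "(\<gamma> \<bullet> \<beta>) \<bullet> \<alpha> = \<gamma> \<bullet> (\<beta> \<bullet> \<alpha>)"
  using category.comp_assoc[OF hom_cat_of, of \<alpha> \<gamma> \<beta> \<alpha>] assms
  by (auto simp: hom_cat_def arr_in_def)

lemma vcomp_id [simp]:
  assumes "\<alpha> \<in> Cell M"
  shows "f = Cod M \<alpha> \<Longrightarrow> Id2 M f \<bullet> \<alpha> = \<alpha>" "f = Dom M \<alpha> \<Longrightarrow> \<alpha> \<bullet> Id2 M f = \<alpha>"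
  using category.comp_id_left[OF hom_cat_of, of \<alpha> \<alpha>] category.comp_id_right[OF hom_cat_of, of \<alpha> \<alpha>] assms
  by (auto simp: hom_cat_def arr_in_def)

lemma hcomp_cell [simp]:
  assumes "\<alpha> \<in> Cell M" "\<beta> \<in> Cell M" "Src M (Dom M \<beta>) = Trg M (Dom M \<alpha>)"
  shows "\<beta> \<star> \<alpha> \<in> Cell M" "Dom M (\<beta> \<star> \<alpha>) = Dom M \<beta> \<odot> Dom M \<alpha>"
    "Cod M (\<beta> \<star> \<alpha>) = Cod M \<beta> \<odot> Cod M \<alpha>"
  using hcomp_in[of "Dom M \<alpha>" "Src M (Dom M \<alpha>)" "Trg M (Dom M \<alpha>)" "Dom M \<beta>" "Trg M (Dom M \<beta>)" \<alpha> "Cod M \<alpha>" \<beta> "Cod M \<beta>"] assms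
  by (auto simp: arr_in_def cell_in_def)

lemma hcomp_id2' [simp]:
  assumes "f \<in> Arr M" "g \<in> Arr M" "Src M g = Trg M f"
  shows "Id2 M g \<star> Id2 M f = Id2 M (g \<odot> f)"
  using hcomp_id2[of f "Src M f" "Trg M f" g "Trg M g"] assms by (auto simp: arr_in_def)

lemma hcomp_assoc' [simp]:
  assumes "\<alpha> \<in> Cell M" "\<beta> \<in> Cell M" "\<gamma> \<in> Cell M"
    "Src M (Dom M \<beta>) = Trg M (Dom M \<alpha>)" "Src M (Dom M \<gamma>) = Trg M (Dom M \<beta>)"
  shows "(\<gamma> \<star> \<beta>) \<star> \<alpha> = \<gamma> \<star> (\<beta> \<star> \<alpha>)"
  using hcomp_assoc[of "Dom M \<alpha>" "Src M (Dom M \<alpha>)" "Trg M (Dom M \<alpha>)" "Dom M \<beta>" "Trg M (Dom M \<beta>)"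
      "Dom M \<gamma>" "Trg M (Dom M \<gamma>)" \<alpha> "Cod M \<alpha>" \<beta> "Cod M \<beta>" \<gamma> "Cod M \<gamma>"] assms
  by (auto simp: arr_in_def cell_in_def)

text \<open>The rule \<open>hcomp_assoc'\<close> brackets to the right, which leaves nested left
  whiskerings unmerged. With this rule every whiskered cell reaches the form
  \<open>f \<rhd> (\<alpha> \<lhd> g)\<close>.\<close>

lemma lwhisker_lwhisker [simp]:
  assumes "\<alpha> \<in> Cell M" "f \<in> Arr M" "g \<in> Arr M" "Src M f = Trg M (Dom M \<alpha>)" "Src M g = Trg M f"
  shows "g \<rhd> (f \<rhd> \<alpha>) = (g \<odot> f) \<rhd> \<alpha>"
  using hcomp_assoc'[of \<alpha> "Id2 M f" "Id2 M g"] assms by simp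

lemma whisker_id1 [simp]:
  assumes "\<alpha> \<in> Cell M"
  shows "Trg M (Dom M \<alpha>) = A \<Longrightarrow> Id1 M A \<rhd> \<alpha> = \<alpha>" "Src M (Dom M \<alpha>) = A \<Longrightarrow> \<alpha> \<lhd> Id1 M A = \<alpha>"
  using hcomp_id_left[of "Dom M \<alpha>" "Src M (Dom M \<alpha>)" "Trg M (Dom M \<alpha>)" \<alpha> "Cod M \<alpha>"]
    hcomp_id_right[of "Dom M \<alpha>" "Src M (Dom M \<alpha>)" "Trg M (Dom M \<alpha>)" \<alpha> "Cod M \<alpha>"] assms
  by (auto simp: arr_in_def cell_in_def)

lemma interchange':
  assumes "\<alpha> \<in> Cell M" "\<alpha>' \<in> Cell M" "\<beta> \<in> Cell M" "\<beta>' \<in> Cell M"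
    "Dom M \<alpha>' = Cod M \<alpha>" "Dom M \<beta>' = Cod M \<beta>" "Src M (Dom M \<beta>) = Trg M (Dom M \<alpha>)"
  shows "(\<beta>' \<bullet> \<beta>) \<star> (\<alpha>' \<bullet> \<alpha>) = (\<beta>' \<star> \<alpha>') \<bullet> (\<beta> \<star> \<alpha>)"
  using interchange[of "Dom M \<alpha>" "Src M (Dom M \<alpha>)" "Trg M (Dom M \<alpha>)" "Dom M \<beta>" "Trg M (Dom M \<beta>)"
      \<alpha> "Cod M \<alpha>" \<alpha>' "Cod M \<alpha>'" \<beta> "Cod M \<beta>" \<beta>' "Cod M \<beta>'"] assms
  by (auto simp: arr_in_def cell_in_def)

lemma lwhisker_vcomp [simp]:
  assumes "\<alpha> \<in> Cell M" "\<beta> \<in> Cell M" "f \<in> Arr M" "Dom M \<beta> = Cod M \<alpha>" "Src M f = Trg M (Dom M \<alpha>)"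
  shows "f \<rhd> (\<beta> \<bullet> \<alpha>) = (f \<rhd> \<beta>) \<bullet> (f \<rhd> \<alpha>)"
  using interchange'[of \<alpha> \<beta> "Id2 M f" "Id2 M f"] assms by simp

lemma rwhisker_vcomp [simp]:
  assumes "\<alpha> \<in> Cell M" "\<beta> \<in> Cell M" "f \<in> Arr M" "Dom M \<beta> = Cod M \<alpha>" "Src M (Dom M \<alpha>) = Trg M f"
  shows "(\<beta> \<bullet> \<alpha>) \<lhd> f = (\<beta> \<lhd> f) \<bullet> (\<alpha> \<lhd> f)"
  using interchange'[of "Id2 M f" "Id2 M f" \<alpha> \<beta>] assms by simp

lemma hcomp_right_first:
  assumes "\<alpha> \<in> Cell M" "\<beta> \<in> Cell M" "Src M (Dom M \<beta>) = Trg M (Dom M \<alpha>)"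
  shows "\<beta> \<star> \<alpha> = (\<beta> \<lhd> Cod M \<alpha>) \<bullet> (Dom M \<beta> \<rhd> \<alpha>)"
  using interchange'[of \<alpha> "Id2 M (Cod M \<alpha>)" "Id2 M (Dom M \<beta>)" \<beta>] assms by simp

lemma hcomp_left_first:
  assumes "\<alpha> \<in> Cell M" "\<beta> \<in> Cell M" "Src M (Dom M \<beta>) = Trg M (Dom M \<alpha>)"
  shows "\<beta> \<star> \<alpha> = (Cod M \<beta> \<rhd> \<alpha>) \<bullet> (\<beta> \<lhd> Dom M \<alpha>)"
  using interchange'[of "Id2 M (Dom M \<alpha>)" \<alpha> \<beta> "Id2 M (Cod M \<beta>)"] assms by simp

text \<open>Both sides are the horizontal composite \<open>\<beta> \<star> \<alpha>\<close>. The
  naturality squares used below are instances of this equation.\<close>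

lemma exchange:
  assumes "\<alpha> \<in> Cell M" "\<beta> \<in> Cell M" "Src M (Dom M \<beta>) = Trg M (Dom M \<alpha>)"
  shows "(\<beta> \<lhd> Cod M \<alpha>) \<bullet> (Dom M \<beta> \<rhd> \<alpha>) = (Cod M \<beta> \<rhd> \<alpha>) \<bullet> (\<beta> \<lhd> Dom M \<alpha>)"
  using hcomp_right_first hcomp_left_first assms by metis

text \<open>Vertical composites are kept bracketed to the right, where
  \<open>\<gamma> \<bullet> \<beta>\<close> is no subterm of a longer chain. This variant applies an
  equation for two factors at the head of such a chain.\<close>

lemma vcomp_reduce:
  assumes "\<gamma> \<bullet> \<beta> = \<delta>" "\<alpha> \<in> Cell M" "\<beta> \<in> Cell M" "\<gamma> \<in> Cell M" "Dom M \<beta> = Cod M \<alpha>" "Dom M \<gamma> = Cod M \<beta>"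
  shows "\<gamma> \<bullet> (\<beta> \<bullet> \<alpha>) = \<delta> \<bullet> \<alpha>"
  using vcomp_assoc[of \<alpha> \<beta> \<gamma>] assms by simp

lemmas typing = cell_in_def arr_in_def

subsection \<open>Coactions of comonads\<close>

lemma coaction_whisker:
  assumes "is_coaction M B c A v \<rho>" "\<guillemotleft>a : A' \<rightarrow> A\<guillemotright>" "is_comonad M B c"
  shows "is_coaction M B c A' (v \<odot> a) (\<rho> \<lhd> a)"
proof -
  have t [simp]: "v \<in> Arr M" "Trg M v = B" "Src M v = A" "\<rho> \<in> Cell M" "Dom M \<rho> = v" "Cod M \<rho> = cfun c \<odot> v"
    "a \<in> Arr M" "Src M a = A'" "Trg M a = A" "cfun c \<in> Arr M" "Src M (cfun c) = B" "Trg M (cfun c) = B"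
    "comult c \<in> Cell M" "Dom M (comult c) = cfun c" "Cod M (comult c) = cfun c \<odot> cfun c"
    "cunit c \<in> Cell M" "Dom M (cunit c) = cfun c" "Cod M (cunit c) = Id1 M B" "B \<in> Ob M"
    using assms by (auto simp: is_coaction_def is_comonad_def typing src_closed)
  have "((comult c \<lhd> v) \<bullet> \<rho>) \<lhd> a = ((cfun c \<rhd> \<rho>) \<bullet> \<rho>) \<lhd> a" "((cunit c \<lhd> v) \<bullet> \<rho>) \<lhd> a = Id2 M v \<lhd> a"
    using assms by (simp_all add: is_coaction_def)
  then show ?thesis
    by (simp add: is_coaction_def typing)
qed

text \<open>The new coaction is the conjugate of \<open>\<rho>\<close> by \<open>\<alpha>\<close>.
  The exchange law carries \<open>comult c\<close> and \<open>cunit c\<close> past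
  \<open>\<alpha>\<close>, and in the coassociativity law the inner pair
  \<open>\<beta> \<bullet> \<alpha>\<close> cancels under \<open>cfun c\<close>.\<close>

lemma coaction_transport:
  assumes "is_coaction M B c A v \<rho>" "is_comonad M B c" "\<guillemotleft>\<alpha> : v \<Rightarrow> w\<guillemotright>" "inverse2 M \<alpha> \<beta>"
  shows "is_coaction M B c A w ((cfun c \<rhd> \<alpha>) \<bullet> (\<rho> \<bullet> \<beta>))"
    "coaction_mor M c v \<rho> w ((cfun c \<rhd> \<alpha>) \<bullet> (\<rho> \<bullet> \<beta>)) \<alpha>"
proof -
  have t [simp]: "v \<in> Arr M" "Trg M v = B" "Src M v = A" "\<rho> \<in> Cell M" "Dom M \<rho> = v" "Cod M \<rho> = cfun c \<odot> v"
    "cfun c \<in> Arr M" "Src M (cfun c) = B" "Trg M (cfun c) = B"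
    "comult c \<in> Cell M" "Dom M (comult c) = cfun c" "Cod M (comult c) = cfun c \<odot> cfun c"
    "cunit c \<in> Cell M" "Dom M (cunit c) = cfun c" "Cod M (cunit c) = Id1 M B" "B \<in> Ob M"
    "\<alpha> \<in> Cell M" "Dom M \<alpha> = v" "Cod M \<alpha> = w" "\<beta> \<in> Cell M" "Dom M \<beta> = w" "Cod M \<beta> = v"
    using assms by (auto simp: is_coaction_def is_comonad_def typing inverse2_def src_closed)
  have w [simp]: "w \<in> Arr M" "Trg M w = B" "Src M w = A"
    using cod_arr[of \<alpha>] by simp_all
  have i [simp]: "\<beta> \<bullet> \<alpha> = Id2 M v" "\<alpha> \<bullet> \<beta> = Id2 M w"
    using assms by (auto simp: inverse2_def)
  note red = vcomp_reduce[OF i(1)]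
  show "coaction_mor M c v \<rho> w ((cfun c \<rhd> \<alpha>) \<bullet> (\<rho> \<bullet> \<beta>)) \<alpha>"
    by (simp add: coaction_mor_def typing)
  have eq: "(comult c \<lhd> v) \<bullet> \<rho> = (cfun c \<rhd> \<rho>) \<bullet> \<rho>" "(cunit c \<lhd> v) \<bullet> \<rho> = Id2 M v"
    using assms by (auto simp: is_coaction_def)
  have cc: "(cfun c \<rhd> \<beta>) \<bullet> (cfun c \<rhd> \<alpha>) = Id2 M (cfun c \<odot> v)"
    using lwhisker_vcomp[of \<alpha> \<beta> "cfun c"] by simp
  have e1: "(comult c \<lhd> w) \<bullet> (cfun c \<rhd> \<alpha>) = ((cfun c \<odot> cfun c) \<rhd> \<alpha>) \<bullet> (comult c \<lhd> v)"
    and e2: "(cunit c \<lhd> w) \<bullet> (cfun c \<rhd> \<alpha>) = \<alpha> \<bullet> (cunit c \<lhd> v)"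
    using exchange[of \<alpha> "comult c"] exchange[of \<alpha> "cunit c"] by simp_all
  show "is_coaction M B c A w ((cfun c \<rhd> \<alpha>) \<bullet> (\<rho> \<bullet> \<beta>))"
    by (simp add: is_coaction_def typing vcomp_reduce[OF e1] vcomp_reduce[OF e2] vcomp_reduce[OF eq(1)]
        vcomp_reduce[OF eq(2)] vcomp_reduce[OF cc] red)
qed

lemma coaction_mor_comp:
  assumes "coaction_mor M c u \<tau> v \<rho> \<alpha>" "coaction_mor M c v \<rho> w \<sigma> \<beta>"
    "is_coaction M B c A u \<tau>" "is_coaction M B c A v \<rho>" "is_coaction M B c A w \<sigma>" "is_comonad M B c"
  shows "coaction_mor M c u \<tau> w \<sigma> (\<beta> \<bullet> \<alpha>)"
proof -
  have t [simp]: "u \<in> Arr M" "Trg M u = B" "Src M u = A" "v \<in> Arr M" "Trg M v = B" "Src M v = A"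
    "w \<in> Arr M" "Trg M w = B" "Src M w = A"
    "\<rho> \<in> Cell M" "Dom M \<rho> = v" "Cod M \<rho> = cfun c \<odot> v"
    "\<tau> \<in> Cell M" "Dom M \<tau> = u" "Cod M \<tau> = cfun c \<odot> u"
    "\<sigma> \<in> Cell M" "Dom M \<sigma> = w" "Cod M \<sigma> = cfun c \<odot> w"
    "cfun c \<in> Arr M" "Src M (cfun c) = B" "Trg M (cfun c) = B"
    "\<alpha> \<in> Cell M" "Dom M \<alpha> = u" "Cod M \<alpha> = v" "\<beta> \<in> Cell M" "Dom M \<beta> = v" "Cod M \<beta> = w"
    using assms by (auto simp: is_coaction_def is_comonad_def typing coaction_mor_def)
  have e: "\<rho> \<bullet> \<alpha> = (cfun c \<rhd> \<alpha>) \<bullet> \<tau>" "\<sigma> \<bullet> \<beta> = (cfun c \<rhd> \<beta>) \<bullet> \<rho>"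
    using assms by (auto simp: coaction_mor_def)
  show ?thesis
    by (simp add: coaction_mor_def typing vcomp_reduce[OF e(2)] e)
qed

lemma coaction_mor_whisker:
  assumes "coaction_mor M c u \<tau> v \<rho> \<alpha>" "\<guillemotleft>a : A' \<rightarrow> A\<guillemotright>"
    "is_coaction M B c A u \<tau>" "is_coaction M B c A v \<rho>" "is_comonad M B c"
  shows "coaction_mor M c (u \<odot> a) (\<tau> \<lhd> a) (v \<odot> a) (\<rho> \<lhd> a) (\<alpha> \<lhd> a)"
proof -
  have t [simp]: "u \<in> Arr M" "Trg M u = B" "Src M u = A" "v \<in> Arr M" "Trg M v = B" "Src M v = A"
    "\<rho> \<in> Cell M" "Dom M \<rho> = v" "Cod M \<rho> = cfun c \<odot> v"
    "\<tau> \<in> Cell M" "Dom M \<tau> = u" "Cod M \<tau> = cfun c \<odot> u"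
    "cfun c \<in> Arr M" "Src M (cfun c) = B" "Trg M (cfun c) = B"
    "a \<in> Arr M" "Src M a = A'" "Trg M a = A"
    "\<alpha> \<in> Cell M" "Dom M \<alpha> = u" "Cod M \<alpha> = v"
    using assms by (auto simp: is_coaction_def is_comonad_def typing coaction_mor_def)
  have "(\<rho> \<bullet> \<alpha>) \<lhd> a = ((cfun c \<rhd> \<alpha>) \<bullet> \<tau>) \<lhd> a"
    using assms by (auto simp: coaction_mor_def)
  then show ?thesis
    by (simp add: coaction_mor_def typing)
qed

text \<open>Compose the square of \<open>\<alpha>\<close> with \<open>\<beta>\<close> on one side
  and with \<open>cfun c \<rhd> \<beta>\<close> on the other. This makes the second half of
  \<open>coaction_iso\<close> automatic for an invertible coaction morphism.\<close>

lemma coaction_mor_inverse: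
  assumes "coaction_mor M c u \<tau> v \<rho> \<alpha>" "inverse2 M \<alpha> \<beta>"
    "is_coaction M B c A u \<tau>" "is_coaction M B c A v \<rho>" "is_comonad M B c"
  shows "coaction_mor M c v \<rho> u \<tau> \<beta>"
proof -
  have t [simp]: "u \<in> Arr M" "Trg M u = B" "Src M u = A" "v \<in> Arr M" "Trg M v = B" "Src M v = A"
    "\<rho> \<in> Cell M" "Dom M \<rho> = v" "Cod M \<rho> = cfun c \<odot> v"
    "\<tau> \<in> Cell M" "Dom M \<tau> = u" "Cod M \<tau> = cfun c \<odot> u"
    "cfun c \<in> Arr M" "Src M (cfun c) = B" "Trg M (cfun c) = B"
    "\<alpha> \<in> Cell M" "Dom M \<alpha> = u" "Cod M \<alpha> = v" "\<beta> \<in> Cell M" "Dom M \<beta> = v" "Cod M \<beta> = u"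
    and i: "\<alpha> \<bullet> \<beta> = Id2 M v" "\<beta> \<bullet> \<alpha> = Id2 M u"
    and e: "\<rho> \<bullet> \<alpha> = (cfun c \<rhd> \<alpha>) \<bullet> \<tau>"
    using assms by (auto simp: is_coaction_def is_comonad_def typing coaction_mor_def inverse2_def)
  have ci: "(cfun c \<rhd> \<beta>) \<bullet> (cfun c \<rhd> \<alpha>) = Id2 M (cfun c \<odot> u)"
    using lwhisker_vcomp[of \<alpha> \<beta> "cfun c"] i by simp
  have "\<tau> \<bullet> \<beta> = (cfun c \<rhd> \<beta>) \<bullet> ((cfun c \<rhd> \<alpha>) \<bullet> \<tau>) \<bullet> \<beta>"
    by (simp add: vcomp_reduce[OF ci])
  also have "\<dots> = (cfun c \<rhd> \<beta>) \<bullet> \<rho>"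
    by (simp flip: e add: i)
  finally show ?thesis
    by (simp add: coaction_mor_def typing)
qed

section \<open>Change of comonad along a comonad morphism\<close>

definition push :: "'a \<Rightarrow> 'c \<Rightarrow> 'c \<Rightarrow> 'c" where
  "push w k \<sigma> = (k \<lhd> w) \<bullet> \<sigma>"

lemma comonad_morD:
  assumes "ComonadMor c k c' \<in> Comon_arrs M B"
  shows "is_comonad M B c" "is_comonad M B c'" "k \<in> Cell M" "Dom M k = cfun c" "Cod M k = cfun c'"
    "comult c' \<bullet> k = (k \<star> k) \<bullet> comult c" "cunit c' \<bullet> k = cunit c"
  using assms by (auto simp: Comon_arrs_def typing)

text \<open>The morphism law of \<open>k\<close> replaces \<open>comult c' \<bullet> k\<close> by
  \<open>comult c\<close> followed by \<open>k \<star> k\<close>. Splitting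
  \<open>k \<star> k\<close> into two whiskerings lets one factor slide past \<open>\<rho>\<close>,
  which leaves the pushed coaction applied twice.\<close>

lemma push_coaction:
  assumes "is_coaction M B c A v \<rho>" "ComonadMor c k c' \<in> Comon_arrs M B"
  shows "is_coaction M B c' A v (push v k \<rho>)"
proof -
  note m [simp] = comonad_morD[OF assms(2)]
  have t [simp]: "v \<in> Arr M" "Trg M v = B" "Src M v = A" "\<rho> \<in> Cell M" "Dom M \<rho> = v" "Cod M \<rho> = cfun c \<odot> v"
    "cfun c \<in> Arr M" "Src M (cfun c) = B" "Trg M (cfun c) = B"
    "comult c \<in> Cell M" "Dom M (comult c) = cfun c" "Cod M (comult c) = cfun c \<odot> cfun c"
    "cunit c \<in> Cell M" "Dom M (cunit c) = cfun c" "Cod M (cunit c) = Id1 M B" "B \<in> Ob M"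
    "cfun c' \<in> Arr M" "Src M (cfun c') = B" "Trg M (cfun c') = B"
    "comult c' \<in> Cell M" "Dom M (comult c') = cfun c'" "Cod M (comult c') = cfun c' \<odot> cfun c'"
    "cunit c' \<in> Cell M" "Dom M (cunit c') = cfun c'" "Cod M (cunit c') = Id1 M B"
    using assms(1) m(1,2) by (auto simp: is_coaction_def is_comonad_def typing src_closed)
  have eq: "(comult c \<lhd> v) \<bullet> \<rho> = (cfun c \<rhd> \<rho>) \<bullet> \<rho>" "(cunit c \<lhd> v) \<bullet> \<rho> = Id2 M v"
    using assms by (auto simp: is_coaction_def)
  have "(comult c' \<bullet> k) \<lhd> v = ((k \<star> k) \<bullet> comult c) \<lhd> v" "(cunit c' \<bullet> k) \<lhd> v = cunit c \<lhd> v"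
    by (simp_all only: m)
  then have e: "(comult c' \<lhd> v) \<bullet> (k \<lhd> v) = (cfun c' \<rhd> (k \<lhd> v)) \<bullet> ((k \<lhd> (cfun c \<odot> v)) \<bullet> (comult c \<lhd> v))"
    "(cunit c' \<lhd> v) \<bullet> (k \<lhd> v) = cunit c \<lhd> v"
    using hcomp_left_first[of k k] by (simp_all del: m(6,7))
  have x: "(k \<lhd> (cfun c \<odot> v)) \<bullet> (cfun c \<rhd> \<rho>) = (cfun c' \<rhd> \<rho>) \<bullet> (k \<lhd> v)"
    using exchange[of \<rho> k] by simp
  show ?thesis
    by (simp add: push_def is_coaction_def typing vcomp_reduce[OF e(1)] vcomp_reduce[OF e(2)] vcomp_reduce[OF x] eq)
qed

lemma push_mor:
  assumes "coaction_mor M c u \<tau> v \<rho> \<alpha>" "is_coaction M B c A u \<tau>" "is_coaction M B c A v \<rho>"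
    "ComonadMor c k c' \<in> Comon_arrs M B"
  shows "coaction_mor M c' u (push u k \<tau>) v (push v k \<rho>) \<alpha>"
proof -
  note m [simp] = comonad_morD[OF assms(4)]
  have t [simp]: "u \<in> Arr M" "Trg M u = B" "Src M u = A" "v \<in> Arr M" "Trg M v = B" "Src M v = A"
    "\<rho> \<in> Cell M" "Dom M \<rho> = v" "Cod M \<rho> = cfun c \<odot> v"
    "\<tau> \<in> Cell M" "Dom M \<tau> = u" "Cod M \<tau> = cfun c \<odot> u"
    "cfun c \<in> Arr M" "Src M (cfun c) = B" "Trg M (cfun c) = B"
    "cfun c' \<in> Arr M" "Src M (cfun c') = B" "Trg M (cfun c') = B"
    "\<alpha> \<in> Cell M" "Dom M \<alpha> = u" "Cod M \<alpha> = v"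
    and e: "\<rho> \<bullet> \<alpha> = (cfun c \<rhd> \<alpha>) \<bullet> \<tau>"
    using assms m(1,2) by (auto simp: is_coaction_def is_comonad_def typing coaction_mor_def)
  have x: "(k \<lhd> v) \<bullet> (cfun c \<rhd> \<alpha>) = (cfun c' \<rhd> \<alpha>) \<bullet> (k \<lhd> u)"
    using exchange[of \<alpha> k] by simp
  show ?thesis
    by (simp add: coaction_mor_def push_def typing e vcomp_reduce[OF x])
qed

lemma push_whisker:
  assumes "is_coaction M B c A v \<rho>" "ComonadMor c k c' \<in> Comon_arrs M B" "\<guillemotleft>a : A' \<rightarrow> A\<guillemotright>"
  shows "push v k \<rho> \<lhd> a = push (v \<odot> a) k (\<rho> \<lhd> a)"
proof -
  note m [simp] = comonad_morD[OF assms(2)]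
  have t [simp]: "v \<in> Arr M" "Trg M v = B" "Src M v = A" "\<rho> \<in> Cell M" "Dom M \<rho> = v" "Cod M \<rho> = cfun c \<odot> v"
    "cfun c \<in> Arr M" "Src M (cfun c) = B" "Trg M (cfun c) = B"
    "a \<in> Arr M" "Src M a = A'" "Trg M a = A"
    using assms m(1,2) by (auto simp: is_coaction_def is_comonad_def typing)
  show ?thesis by (simp add: push_def)
qed

lemma push_comp:
  assumes "is_coaction M B c A v \<rho>" "ComonadMor c k c' \<in> Comon_arrs M B" "ComonadMor c' k' c'' \<in> Comon_arrs M B"
  shows "push v (k' \<bullet> k) \<rho> = push v k' (push v k \<rho>)"
proof -
  note m [simp] = comonad_morD[OF assms(2)]
  note m' [simp] = comonad_morD[OF assms(3)]
  have t [simp]: "v \<in> Arr M" "Trg M v = B" "Src M v = A" "\<rho> \<in> Cell M" "Dom M \<rho> = v" "Cod M \<rho> = cfun c \<odot> v"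
    "cfun c \<in> Arr M" "Src M (cfun c) = B" "Trg M (cfun c) = B"
    "cfun c' \<in> Arr M" "Src M (cfun c') = B" "Trg M (cfun c') = B"
    using assms m(1,2) by (auto simp: is_coaction_def is_comonad_def typing)
  show ?thesis by (simp add: push_def)
qed

lemma push_id:
  assumes "is_coaction M B c A v \<rho>" "is_comonad M B c"
  shows "push v (Id2 M (cfun c)) \<rho> = \<rho>"
  using assms by (auto simp: push_def is_coaction_def is_comonad_def typing)

section \<open>Maps and the comonad \<open>L(w)\<close>\<close>

lemma mapD:
  assumes "is_map M w A B"
  shows "arr w \<in> Arr M" "Src M (arr w) = A" "Trg M (arr w) = B"
    "radj w \<in> Arr M" "Src M (radj w) = B" "Trg M (radj w) = A"
    "unit w \<in> Cell M" "Dom M (unit w) = Id1 M A" "Cod M (unit w) = radj w \<odot> arr w"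
    "counit w \<in> Cell M" "Dom M (counit w) = arr w \<odot> radj w" "Cod M (counit w) = Id1 M B"
    "A \<in> Ob M" "B \<in> Ob M"
    "(counit w \<lhd> arr w) \<bullet> (arr w \<rhd> unit w) = Id2 M (arr w)"
    "(radj w \<rhd> counit w) \<bullet> (unit w \<lhd> radj w) = Id2 M (radj w)"
  using assms src_closed trg_closed by (auto simp: is_map_def typing)

lemma L_obj_sel [simp]:
  "cfun (L_obj M w) = arr w \<odot> radj w" "comult (L_obj M w) = arr w \<rhd> (unit w \<lhd> radj w)"
  "cunit (L_obj M w) = counit w"
  by (simp_all add: L_obj_def)

text \<open>The comultiplication inserts a unit between \<open>arr w\<close> and
  \<open>radj w\<close>. Inserting two units gives the same result in either order by exchange,
  which is coassociativity; the counit laws are the two triangle identities, each whiskered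
  once.\<close>

lemma L_obj_comonad:
  assumes "is_map M w A B"
  shows "is_comonad M B (L_obj M w)"
proof -
  note t [simp] = mapD[OF assms]
  have x: "(unit w \<lhd> (radj w \<odot> arr w)) \<bullet> unit w = ((radj w \<odot> arr w) \<rhd> unit w) \<bullet> unit w"
    using exchange[of "unit w" "unit w"] by simp
  have "arr w \<rhd> (((unit w \<lhd> (radj w \<odot> arr w)) \<bullet> unit w) \<lhd> radj w)
    = arr w \<rhd> ((((radj w \<odot> arr w) \<rhd> unit w) \<bullet> unit w) \<lhd> radj w)"
    "((counit w \<lhd> arr w) \<bullet> (arr w \<rhd> unit w)) \<lhd> radj w = Id2 M (arr w) \<lhd> radj w"
    "arr w \<rhd> ((radj w \<rhd> counit w) \<bullet> (unit w \<lhd> radj w)) = arr w \<rhd> Id2 M (radj w)"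
    by (simp_all only: x t)
  then show ?thesis by (simp add: is_comonad_def typing del: t(15,16))
qed

text \<open>This is the coaction that corresponds to the identity of \<open>L(w)\<close>, and it is
  universal: every coaction on \<open>w\<close> is its image under \<open>push\<close> along a
  unique comonad morphism out of \<open>L(w)\<close>. Coassociativity is again the exchange of two
  units, and the counit law is a triangle identity.\<close>

lemma canonical_coaction:
  assumes "is_map M w A B"
  shows "is_coaction M B (L_obj M w) A (arr w) (arr w \<rhd> unit w)"
proof -
  note t [simp] = mapD[OF assms]
  have x: "(unit w \<lhd> (radj w \<odot> arr w)) \<bullet> unit w = ((radj w \<odot> arr w) \<rhd> unit w) \<bullet> unit w"
    using exchange[of "unit w" "unit w"] by simp
  have "arr w \<rhd> ((unit w \<lhd> (radj w \<odot> arr w)) \<bullet> unit w)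
    = arr w \<rhd> (((radj w \<odot> arr w) \<rhd> unit w) \<bullet> unit w)"
    by (simp_all only: x)
  then show ?thesis by (simp add: is_coaction_def typing)
qed

section \<open>Comonad morphisms out of \<open>L(w)\<close> correspond to coactions on
  \<open>w\<close>\<close>

definition coaction_of_mor :: "('a, 'c) lmap \<Rightarrow> 'c \<Rightarrow> 'c" where
  "coaction_of_mor w \<psi> = push (arr w) \<psi> (arr w \<rhd> unit w)"

definition mor_of_coaction :: "('a, 'c) comonad \<Rightarrow> ('a, 'c) lmap \<Rightarrow> 'c \<Rightarrow> 'c" where
  "mor_of_coaction c w \<sigma> = (cfun c \<rhd> counit w) \<bullet> (\<sigma> \<lhd> radj w)"

lemma coaction_of_mor_coaction:
  assumes "is_map M w A B" "ComonadMor (L_obj M w) \<psi> c \<in> Comon_arrs M B"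
  shows "is_coaction M B c A (arr w) (coaction_of_mor w \<psi>)"
  unfolding coaction_of_mor_def
  using push_coaction canonical_coaction assms by blast

text \<open>Precomposition with an adjunction matches 2-cells
  \<open>x \<odot> radj w \<Rightarrow> y\<close> with 2-cells
  \<open>x \<Rightarrow> y \<odot> arr w\<close>; this is one half of that bijection for
  \<open>x = arr w\<close> and \<open>y = cfun c\<close>. It comes from the triangle identity of
  \<open>radj w\<close>, once the counit has slid past \<open>\<psi>\<close>.\<close>

lemma mor_of_coaction_of_mor:
  assumes "is_map M w A B" "\<guillemotleft>\<psi> : arr w \<odot> radj w \<Rightarrow> cfun c\<guillemotright>" "is_comonad M B c"
  shows "mor_of_coaction c w (coaction_of_mor w \<psi>) = \<psi>"
proof -
  note t [simp] = mapD[OF assms(1)]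
  have [simp]: "\<psi> \<in> Cell M" "Dom M \<psi> = arr w \<odot> radj w" "Cod M \<psi> = cfun c"
    "cfun c \<in> Arr M" "Src M (cfun c) = B" "Trg M (cfun c) = B"
    using assms by (auto simp: typing is_comonad_def)
  have x: "(cfun c \<rhd> counit w) \<bullet> (\<psi> \<lhd> (arr w \<odot> radj w)) = \<psi> \<bullet> ((arr w \<odot> radj w) \<rhd> counit w)"
    using exchange[of "counit w" \<psi>] by simp
  have y: "((arr w \<odot> radj w) \<rhd> counit w) \<bullet> (arr w \<rhd> (unit w \<lhd> radj w)) = Id2 M (arr w \<odot> radj w)"
    using lwhisker_vcomp[of "unit w \<lhd> radj w" "radj w \<rhd> counit w" "arr w"] by simp
  show ?thesis
    by (simp add: mor_of_coaction_def coaction_of_mor_def push_def vcomp_reduce[OF x] y)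
qed

text \<open>The other half of the bijection: the unit slides past \<open>\<sigma>\<close>, and the
  triangle identity of \<open>arr w\<close> finishes.\<close>

lemma coaction_of_mor_of_coaction:
  assumes "is_map M w A B" "\<guillemotleft>\<sigma> : arr w \<Rightarrow> cfun c \<odot> arr w\<guillemotright>" "is_comonad M B c"
  shows "coaction_of_mor w (mor_of_coaction c w \<sigma>) = \<sigma>"
proof -
  note t [simp] = mapD[OF assms(1)]
  have [simp]: "\<sigma> \<in> Cell M" "Dom M \<sigma> = arr w" "Cod M \<sigma> = cfun c \<odot> arr w"
    "cfun c \<in> Arr M" "Src M (cfun c) = B" "Trg M (cfun c) = B"
    using assms by (auto simp: typing is_comonad_def)
  have x: "(\<sigma> \<lhd> (radj w \<odot> arr w)) \<bullet> (arr w \<rhd> unit w) = ((cfun c \<odot> arr w) \<rhd> unit w) \<bullet> \<sigma>"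
    using exchange[of "unit w" \<sigma>] by simp
  have y: "(cfun c \<rhd> (counit w \<lhd> arr w)) \<bullet> ((cfun c \<odot> arr w) \<rhd> unit w) = Id2 M (cfun c \<odot> arr w)"
    using lwhisker_vcomp[of "arr w \<rhd> unit w" "counit w \<lhd> arr w" "cfun c"] by simp
  show ?thesis
    by (simp add: mor_of_coaction_def coaction_of_mor_def push_def x vcomp_reduce[OF y])
qed

text \<open>Both sides of the comultiplication law reduce to \<open>\<sigma>\<close> applied twice,
  followed by one counit. On the left this is coassociativity of \<open>\<sigma>\<close>. On the
  right the morphism occurs twice, and the counit in the copy applied first cancels against the unit
  inside \<open>comult (L_obj M w)\<close>.\<close>

lemma mor_of_coaction_mor:
  assumes "is_map M w A B" "is_coaction M B c A (arr w) \<sigma>" "is_comonad M B c"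
  shows "ComonadMor (L_obj M w) (mor_of_coaction c w \<sigma>) c \<in> Comon_arrs M B"
proof -
  note t [simp] = mapD[OF assms(1)]
  have [simp]: "\<sigma> \<in> Cell M" "Dom M \<sigma> = arr w" "Cod M \<sigma> = cfun c \<odot> arr w"
    "cfun c \<in> Arr M" "Src M (cfun c) = B" "Trg M (cfun c) = B"
    "comult c \<in> Cell M" "Dom M (comult c) = cfun c" "Cod M (comult c) = cfun c \<odot> cfun c"
    "cunit c \<in> Cell M" "Dom M (cunit c) = cfun c" "Cod M (cunit c) = Id1 M B"
    and eq: "(comult c \<lhd> arr w) \<bullet> \<sigma> = (cfun c \<rhd> \<sigma>) \<bullet> \<sigma>" "(cunit c \<lhd> arr w) \<bullet> \<sigma> = Id2 M (arr w)"
    using assms by (auto simp: typing is_comonad_def is_coaction_def)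
  have "((comult c \<lhd> arr w) \<bullet> \<sigma>) \<lhd> radj w = ((cfun c \<rhd> \<sigma>) \<bullet> \<sigma>) \<lhd> radj w"
    "((cunit c \<lhd> arr w) \<bullet> \<sigma>) \<lhd> radj w = Id2 M (arr w) \<lhd> radj w"
    using eq by simp_all
  then have eqw: "(comult c \<lhd> (arr w \<odot> radj w)) \<bullet> (\<sigma> \<lhd> radj w) = (cfun c \<rhd> (\<sigma> \<lhd> radj w)) \<bullet> (\<sigma> \<lhd> radj w)"
    "(cunit c \<lhd> (arr w \<odot> radj w)) \<bullet> (\<sigma> \<lhd> radj w) = Id2 M (arr w \<odot> radj w)"
    by simp_all
  have x: "(comult c) \<bullet> (cfun c \<rhd> counit w) = ((cfun c \<odot> cfun c) \<rhd> counit w) \<bullet> (comult c \<lhd> (arr w \<odot> radj w))"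
    "(cunit c) \<bullet> (cfun c \<rhd> counit w) = counit w \<bullet> (cunit c \<lhd> (arr w \<odot> radj w))"
    using exchange[of "counit w" "comult c"] exchange[of "counit w" "cunit c"] by simp_all
  \<comment> \<open>Moving \<open>\<sigma>\<close> past the inserted unit brings that unit next to
    the counit which cancels it in \<open>z\<close>.\<close>
  have y: "(\<sigma> \<lhd> (radj w \<odot> (arr w \<odot> radj w))) \<bullet> (arr w \<rhd> (unit w \<lhd> radj w)) = ((cfun c \<odot> arr w) \<rhd> (unit w \<lhd> radj w)) \<bullet> (\<sigma> \<lhd> radj w)"
    using exchange[of "unit w \<lhd> radj w" \<sigma>] by simp
  have "cfun c \<rhd> (((counit w \<lhd> arr w) \<bullet> (arr w \<rhd> unit w)) \<lhd> radj w) = cfun c \<rhd> (Id2 M (arr w) \<lhd> radj w)"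
    by (simp only: t)
  then have z: "(cfun c \<rhd> (counit w \<lhd> (arr w \<odot> radj w))) \<bullet> ((cfun c \<odot> arr w) \<rhd> (unit w \<lhd> radj w)) = Id2 M (cfun c \<odot> (arr w \<odot> radj w))"
    by (simp del: t(15))
  show ?thesis
    using L_obj_comonad[OF assms(1)] assms(3)
    by (simp add: Comon_arrs_def mor_of_coaction_def typing vcomp_reduce[OF x(1)] vcomp_reduce[OF x(2)]
        eqw vcomp_reduce[OF z] y
        hcomp_left_first[of "(cfun c \<rhd> counit w) \<bullet> (\<sigma> \<lhd> radj w)" "(cfun c \<rhd> counit w) \<bullet> (\<sigma> \<lhd> radj w)"])
qed

subsection \<open>The 2-categories of maps and of comonads\<close>

lemma id_map_is_map:
  assumes "A \<in> Ob M"
  shows "is_map M (id_map M A) A A"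
  using assms by (simp add: is_map_def id_map_def typing)

text \<open>In each triangle of the composite, the counit of \<open>a\<close> meets the unit of
  \<open>b\<close>. Exchanging the two splits the triangle into a triangle of \<open>b\<close> and a
  triangle of \<open>a\<close>.\<close>

lemma comp_map_is_map:
  assumes "is_map M a A A'" "is_map M b A' A''"
  shows "is_map M (comp_map M b a) A A''"
proof -
  note t [simp] = mapD[OF assms(1)] mapD[OF assms(2)]
  have x: "(counit a \<lhd> (radj b \<odot> arr b)) \<bullet> ((arr a \<odot> radj a) \<rhd> unit b) = unit b \<bullet> counit a"
    using exchange[of "unit b" "counit a"] by simp
  have x': "((radj b \<odot> arr b) \<rhd> counit a) \<bullet> (unit b \<lhd> (arr a \<odot> radj a)) = unit b \<bullet> counit a"
    using exchange[of "counit a" "unit b"] by simp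
  have "arr b \<rhd> (((counit a \<lhd> (radj b \<odot> arr b)) \<bullet> ((arr a \<odot> radj a) \<rhd> unit b)) \<lhd> arr a)
    = arr b \<rhd> ((unit b \<bullet> counit a) \<lhd> arr a)"
    "radj a \<rhd> ((((radj b \<odot> arr b) \<rhd> counit a) \<bullet> (unit b \<lhd> (arr a \<odot> radj a))) \<lhd> radj b)
    = radj a \<rhd> ((unit b \<bullet> counit a) \<lhd> radj b)"
    by (simp_all only: x x')
  then have y:
    "(arr b \<rhd> (counit a \<lhd> (radj b \<odot> (arr b \<odot> arr a)))) \<bullet> ((arr b \<odot> (arr a \<odot> radj a)) \<rhd> (unit b \<lhd> arr a))
      = (arr b \<rhd> (unit b \<lhd> arr a)) \<bullet> (arr b \<rhd> (counit a \<lhd> arr a))"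
    "((radj a \<odot> (radj b \<odot> arr b)) \<rhd> (counit a \<lhd> radj b)) \<bullet> (radj a \<rhd> (unit b \<lhd> (arr a \<odot> (radj a \<odot> radj b))))
      = (radj a \<rhd> (unit b \<lhd> radj b)) \<bullet> (radj a \<rhd> (counit a \<lhd> radj b))"
    by simp_all
  have "((counit b \<lhd> arr b) \<bullet> (arr b \<rhd> unit b)) \<lhd> arr a = Id2 M (arr b) \<lhd> arr a"
    "arr b \<rhd> ((counit a \<lhd> arr a) \<bullet> (arr a \<rhd> unit a)) = arr b \<rhd> Id2 M (arr a)"
    "radj a \<rhd> ((radj b \<rhd> counit b) \<bullet> (unit b \<lhd> radj b)) = radj a \<rhd> Id2 M (radj b)"
    "((radj a \<rhd> counit a) \<bullet> (unit a \<lhd> radj a)) \<lhd> radj b = Id2 M (radj a) \<lhd> radj b"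
    by (simp_all only: t)
  then have z:
    "(counit b \<lhd> (arr b \<odot> arr a)) \<bullet> (arr b \<rhd> (unit b \<lhd> arr a)) = Id2 M (arr b \<odot> arr a)"
    "(arr b \<rhd> (counit a \<lhd> arr a)) \<bullet> ((arr b \<odot> arr a) \<rhd> unit a) = Id2 M (arr b \<odot> arr a)"
    "((radj a \<odot> radj b) \<rhd> counit b) \<bullet> (radj a \<rhd> (unit b \<lhd> radj b)) = Id2 M (radj a \<odot> radj b)"
    "(radj a \<rhd> (counit a \<lhd> radj b)) \<bullet> (unit a \<lhd> (radj a \<odot> radj b)) = Id2 M (radj a \<odot> radj b)"
    by (simp_all del: t(15,16,31,32))
  show ?thesis
    by (simp add: is_map_def comp_map_def typing vcomp_reduce[OF y(1)] vcomp_reduce[OF y(2)]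
        vcomp_reduce[OF z(1)] vcomp_reduce[OF z(3)] z)
qed

text \<open>A 1-cell of \<open>Map_cat\<close> contains a whole adjunction, so its associativity law
  demands equal right adjoints, units and counits as well. They agree because \<open>M\<close> is
  strict.\<close>

lemma comp_map_assoc:
  assumes "is_map M a A A'" "is_map M b A' A''" "is_map M c A'' A'''"
  shows "comp_map M (comp_map M c b) a = comp_map M c (comp_map M b a)"
  using mapD[OF assms(1)] mapD[OF assms(2)] mapD[OF assms(3)]
  by (simp add: comp_map_def)

lemma comp_map_id:
  assumes "is_map M a A A'"
  shows "comp_map M (id_map M A') a = a" "comp_map M a (id_map M A) = a"
  using mapD[OF assms] by (auto simp: comp_map_def id_map_def intro: lmap.expand)

lemma comp_map_sel [simp]: "arr (comp_map M b a) = arr b \<odot> arr a"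
  by (simp add: comp_map_def)

lemma id_map_sel [simp]: "arr (id_map M A) = Id1 M A"
  by (simp add: id_map_def)

section \<open>Invertible 2-cells\<close>

lemma inverse2_whisker:
  assumes "inverse2 M \<alpha> \<beta>" "f \<in> Arr M"
  shows "Src M (Dom M \<alpha>) = Trg M f \<Longrightarrow> inverse2 M (\<alpha> \<lhd> f) (\<beta> \<lhd> f)"
    "Trg M (Dom M \<alpha>) = Src M f \<Longrightarrow> inverse2 M (f \<rhd> \<alpha>) (f \<rhd> \<beta>)"
proof -
  have t [simp]: "\<alpha> \<in> Cell M" "\<beta> \<in> Cell M" "Dom M \<beta> = Cod M \<alpha>" "Cod M \<beta> = Dom M \<alpha>"
    and i: "\<beta> \<bullet> \<alpha> = Id2 M (Dom M \<alpha>)" "\<alpha> \<bullet> \<beta> = Id2 M (Cod M \<alpha>)"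
    using assms by (auto simp: inverse2_def typing)
  show "Src M (Dom M \<alpha>) = Trg M f \<Longrightarrow> inverse2 M (\<alpha> \<lhd> f) (\<beta> \<lhd> f)"
    "Trg M (Dom M \<alpha>) = Src M f \<Longrightarrow> inverse2 M (f \<rhd> \<alpha>) (f \<rhd> \<beta>)"
    using assms(2) rwhisker_vcomp[of \<alpha> \<beta> f] rwhisker_vcomp[of \<beta> \<alpha> f] lwhisker_vcomp[of \<alpha> \<beta> f]
      lwhisker_vcomp[of \<beta> \<alpha> f]
    by (simp_all add: inverse2_def typing i)
qed

lemma inverse2_vcomp:
  assumes "inverse2 M \<alpha> \<alpha>'" "inverse2 M \<beta> \<beta>'" "Dom M \<beta> = Cod M \<alpha>"
  shows "inverse2 M (\<beta> \<bullet> \<alpha>) (\<alpha>' \<bullet> \<beta>')"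
proof -
  have t [simp]: "\<alpha> \<in> Cell M" "\<alpha>' \<in> Cell M" "Dom M \<alpha>' = Cod M \<alpha>" "Cod M \<alpha>' = Dom M \<alpha>"
    "\<beta> \<in> Cell M" "\<beta>' \<in> Cell M" "Dom M \<beta>' = Cod M \<beta>" "Cod M \<beta>' = Cod M \<alpha>"
    and i: "\<alpha>' \<bullet> \<alpha> = Id2 M (Dom M \<alpha>)" "\<alpha> \<bullet> \<alpha>' = Id2 M (Cod M \<alpha>)"
    "\<beta>' \<bullet> \<beta> = Id2 M (Cod M \<alpha>)" "\<beta> \<bullet> \<beta>' = Id2 M (Cod M \<beta>)"
    using assms by (auto simp: inverse2_def typing)
  show ?thesis
    using assms(3) by (simp add: inverse2_def typing vcomp_reduce[OF i(2)] vcomp_reduce[OF i(3)] i)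
qed

lemma inverse2_sym: "inverse2 M \<alpha> \<beta> \<Longrightarrow> inverse2 M \<beta> \<alpha>"
  by (auto simp: inverse2_def typing)

lemma inverse2_id: "f \<in> Arr M \<Longrightarrow> inverse2 M (Id2 M f) (Id2 M f)"
  by (simp add: inverse2_def typing)

lemma inverse2_unique:
  assumes "inverse2 M \<alpha> \<beta>" "inverse2 M \<alpha> \<gamma>"
  shows "\<beta> = \<gamma>"
proof -
  have "(\<gamma> \<bullet> \<alpha>) \<bullet> \<beta> = \<gamma> \<bullet> (\<alpha> \<bullet> \<beta>)"
    using assms by (intro vcomp_assoc) (auto simp: inverse2_def typing)
  then show ?thesis
    using assms by (simp add: inverse2_def typing)
qed

lemma inv2_eq: "inverse2 M \<alpha> \<beta> \<Longrightarrow> inv2 M \<alpha> = \<beta>"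
  unfolding inv2_def using inverse2_unique by blast

section \<open>The 2-category of maps into \<open>B\<close>\<close>

lemma Map_arrs_iff:
  "p \<in> Map_arrs M B \<longleftrightarrow> is_map M (msrc p) (Src M (arr (msrc p))) B \<and> is_map M (mtrg p) (Src M (arr (mtrg p))) B \<and>
    is_map M (mmap p) (Src M (arr (msrc p))) (Src M (arr (mtrg p))) \<and>
    \<guillemotleft>miso p : arr (mtrg p) \<odot> arr (mmap p) \<Rightarrow> arr (msrc p)\<guillemotright> \<and> invertible2 M (miso p)"
proof
  assume "p \<in> Map_arrs M B"
  then show "is_map M (msrc p) (Src M (arr (msrc p))) B \<and> is_map M (mtrg p) (Src M (arr (mtrg p))) B \<and>
    is_map M (mmap p) (Src M (arr (msrc p))) (Src M (arr (mtrg p))) \<and>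
    \<guillemotleft>miso p : arr (mtrg p) \<odot> arr (mmap p) \<Rightarrow> arr (msrc p)\<guillemotright> \<and> invertible2 M (miso p)"
    using mapD(2) by (auto simp: Map_arrs_def)
next
  assume "is_map M (msrc p) (Src M (arr (msrc p))) B \<and> is_map M (mtrg p) (Src M (arr (mtrg p))) B \<and>
    is_map M (mmap p) (Src M (arr (msrc p))) (Src M (arr (mtrg p))) \<and>
    \<guillemotleft>miso p : arr (mtrg p) \<odot> arr (mmap p) \<Rightarrow> arr (msrc p)\<guillemotright> \<and> invertible2 M (miso p)"
  then show "p \<in> Map_arrs M B"
    unfolding Map_arrs_def by (cases p) auto
qed

lemma Map_arrsD:
  assumes "p \<in> Map_arrs M B"
  shows "is_map M (msrc p) (Src M (arr (msrc p))) B" "is_map M (mtrg p) (Src M (arr (mtrg p))) B"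
    "is_map M (mmap p) (Src M (arr (msrc p))) (Src M (arr (mtrg p)))"
    "miso p \<in> Cell M" "Dom M (miso p) = arr (mtrg p) \<odot> arr (mmap p)" "Cod M (miso p) = arr (msrc p)"
    "invertible2 M (miso p)"
  using assms by (auto simp: Map_arrs_iff typing)

lemma Map_id1_arrs:
  assumes "is_map M w A B"
  shows "Map_id1 M w \<in> Map_arrs M B"
  using assms id_map_is_map[of A] mapD[OF assms] inverse2_id[of "arr w"]
  by (auto simp: Map_arrs_iff Map_id1_def typing invertible2_def)

lemma Map_cat_sel [simp]:
  "Ob (Map_cat M B) = {w. \<exists>A. is_map M w A B}" "Arr (Map_cat M B) = Map_arrs M B"
  "Cell (Map_cat M B) = Map_cells M B" "Src (Map_cat M B) = msrc" "Trg (Map_cat M B) = mtrg"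
  "Dom (Map_cat M B) = mdom" "Cod (Map_cat M B) = mcod" "Id1 (Map_cat M B) = Map_id1 M"
  "Comp1 (Map_cat M B) = Map_comp1 M"
  "Id2 (Map_cat M B) p = MCell p (Id2 M (arr (mmap p))) p"
  "VComp (Map_cat M B) y x = MCell (mdom x) (mcell y \<bullet> mcell x) (mcod y)"
  "HComp (Map_cat M B) y x =
    MCell (Map_comp1 M (mdom y) (mdom x)) (mcell y \<star> mcell x) (Map_comp1 M (mcod y) (mcod x))"
  by (simp_all add: Map_cat_def)

lemma Map_cells_iff:
  "x \<in> Map_cells M B \<longleftrightarrow> mdom x \<in> Map_arrs M B \<and> mcod x \<in> Map_arrs M B \<and>
    msrc (mcod x) = msrc (mdom x) \<and> mtrg (mcod x) = mtrg (mdom x) \<and>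
    mcell x \<in> Cell M \<and> Dom M (mcell x) = arr (mmap (mdom x)) \<and> Cod M (mcell x) = arr (mmap (mcod x)) \<and>
    miso (mcod x) \<bullet> (arr (mtrg (mdom x)) \<rhd> mcell x) = miso (mdom x)"
  by (cases x) (auto simp: Map_cells_def typing)

lemma Map_cellsD:
  assumes "x \<in> Map_cells M B"
  shows "mdom x \<in> Map_arrs M B" "mcod x \<in> Map_arrs M B"
    "msrc (mcod x) = msrc (mdom x)" "mtrg (mcod x) = mtrg (mdom x)"
    "mcell x \<in> Cell M" "Dom M (mcell x) = arr (mmap (mdom x))" "Cod M (mcell x) = arr (mmap (mcod x))"
    "miso (mcod x) \<bullet> (arr (mtrg (mdom x)) \<rhd> mcell x) = miso (mdom x)"
  using assms by (simp_all add: Map_cells_iff)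

lemma Map_arrs_typing:
  assumes "p \<in> Map_arrs M B"
  shows "arr (msrc p) \<in> Arr M" "Trg M (arr (msrc p)) = B" "arr (mtrg p) \<in> Arr M" "Trg M (arr (mtrg p)) = B"
    "arr (mmap p) \<in> Arr M" "Src M (arr (mmap p)) = Src M (arr (msrc p))"
    "Trg M (arr (mmap p)) = Src M (arr (mtrg p))"
    "miso p \<in> Cell M" "Dom M (miso p) = arr (mtrg p) \<odot> arr (mmap p)" "Cod M (miso p) = arr (msrc p)"
    "Src M (arr (msrc p)) \<in> Ob M" "Src M (arr (mtrg p)) \<in> Ob M" "B \<in> Ob M"
  by (rule mapD(1,3,13,14)[OF Map_arrsD(1)[OF assms]] mapD(1,3,13)[OF Map_arrsD(2)[OF assms]]
      mapD(1-3)[OF Map_arrsD(3)[OF assms]] Map_arrsD(4-6)[OF assms])+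

lemma Map_comp1_arrs:
  assumes "p \<in> Map_arrs M B" "q \<in> Map_arrs M B" "msrc q = mtrg p"
  shows "Map_comp1 M q p \<in> Map_arrs M B"
proof -
  note t [simp] = Map_arrs_typing[OF assms(1)] Map_arrs_typing[OF assms(2)] assms(3)
  obtain pi qi where i: "inverse2 M (miso p) pi" "inverse2 M (miso q) qi"
    using Map_arrsD(7)[OF assms(1)] Map_arrsD(7)[OF assms(2)] unfolding invertible2_def by blast
  have "inverse2 M (miso p \<bullet> (miso q \<lhd> arr (mmap p))) ((qi \<lhd> arr (mmap p)) \<bullet> pi)"
    by (rule inverse2_vcomp[OF inverse2_whisker(1)[OF i(2)] i(1)]) simp_all
  then have "invertible2 M (miso p \<bullet> (miso q \<lhd> arr (mmap p)))"
    unfolding invertible2_def by blast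
  moreover have "is_map M (comp_map M (mmap q) (mmap p)) (Src M (arr (msrc p))) (Src M (arr (mtrg q)))"
    using comp_map_is_map[OF Map_arrsD(3)[OF assms(1)]] Map_arrsD(3)[OF assms(2)] by simp
  ultimately show ?thesis
    using Map_arrsD(1)[OF assms(1)] Map_arrsD(2)[OF assms(2)] by (simp add: Map_arrs_iff Map_comp1_def typing)
qed

lemma Map_id2_cells:
  assumes "p \<in> Map_arrs M B"
  shows "MCell p (Id2 M (arr (mmap p))) p \<in> Map_cells M B"
  using assms Map_arrs_typing[OF assms] by (simp add: Map_cells_iff)

lemma Map_vcomp_cells:
  assumes "x \<in> Map_cells M B" "y \<in> Map_cells M B" "mdom y = mcod x"
  shows "MCell (mdom x) (mcell y \<bullet> mcell x) (mcod y) \<in> Map_cells M B"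
proof -
  note [simp] = Map_cellsD[OF assms(1)] Map_cellsD[OF assms(2)]
    Map_arrs_typing[OF Map_cellsD(1)[OF assms(1)]] Map_arrs_typing[OF Map_cellsD(2)[OF assms(1)]]
    Map_arrs_typing[OF Map_cellsD(2)[OF assms(2)]] assms(3)
  show ?thesis
    using vcomp_reduce[OF Map_cellsD(8)[OF assms(2)], of "arr (mtrg (mdom x)) \<rhd> mcell x"]
    by (simp add: Map_cells_iff)
qed

lemma Map_comp1_sel [simp]:
  "msrc (Map_comp1 M q p) = msrc p" "mtrg (Map_comp1 M q p) = mtrg q"
  "mmap (Map_comp1 M q p) = comp_map M (mmap q) (mmap p)"
  "miso (Map_comp1 M q p) = miso p \<bullet> (miso q \<lhd> arr (mmap p))"
  by (simp_all add: Map_comp1_def)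

lemma Map_id1_sel [simp]:
  "msrc (Map_id1 M w) = w" "mtrg (Map_id1 M w) = w"
  "mmap (Map_id1 M w) = id_map M (Src M (arr w))" "miso (Map_id1 M w) = Id2 M (arr w)"
  by (simp_all add: Map_id1_def)

text \<open>Whisker the triangle of \<open>y\<close> with the codomain of \<open>x\<close>, exchange
  \<open>x\<close> with \<open>miso (mdom y)\<close>, and then apply the triangle of
  \<open>x\<close>.\<close>

lemma Map_hcomp_cells:
  assumes "x \<in> Map_cells M B" "y \<in> Map_cells M B" "msrc (mdom y) = mtrg (mdom x)"
  shows "MCell (Map_comp1 M (mdom y) (mdom x)) (mcell y \<star> mcell x) (Map_comp1 M (mcod y) (mcod x)) \<in> Map_cells M B"
proof -
  note t [simp] = Map_cellsD[OF assms(1)] Map_cellsD[OF assms(2)]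
    Map_arrs_typing[OF Map_cellsD(1)[OF assms(1)]] Map_arrs_typing[OF Map_cellsD(2)[OF assms(1)]]
    Map_arrs_typing[OF Map_cellsD(1)[OF assms(2)]] Map_arrs_typing[OF Map_cellsD(2)[OF assms(2)]] assms(3)
  let ?a = "arr (mmap (mdom x))" and ?b = "arr (mmap (mdom y))"
  let ?a' = "arr (mmap (mcod x))" and ?b' = "arr (mmap (mcod y))"
  let ?w = "arr (mtrg (mdom y))"
  have "(miso (mcod y) \<bullet> (?w \<rhd> mcell y)) \<lhd> ?a' = miso (mdom y) \<lhd> ?a'"
    by (simp only: t)
  then have 1: "(miso (mcod y) \<lhd> ?a') \<bullet> (?w \<rhd> (mcell y \<lhd> ?a')) = miso (mdom y) \<lhd> ?a'"
    by (simp del: t(8,16))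
  have 2: "(miso (mdom y) \<lhd> ?a') \<bullet> ((?w \<odot> ?b) \<rhd> mcell x) = (arr (mtrg (mdom x)) \<rhd> mcell x) \<bullet> (miso (mdom y) \<lhd> ?a)"
    using exchange[of "mcell x" "miso (mdom y)"] by simp
  have "(miso (mcod x) \<bullet> (miso (mcod y) \<lhd> ?a')) \<bullet> (?w \<rhd> (mcell y \<star> mcell x)) =
    miso (mdom x) \<bullet> (miso (mdom y) \<lhd> ?a)"
    by (simp add: hcomp_right_first[of "mcell x" "mcell y"] vcomp_reduce[OF 1] 2 vcomp_reduce[OF t(8)])
  then show ?thesis
    using Map_comp1_arrs[of "mdom x" B "mdom y"] Map_comp1_arrs[of "mcod x" B "mcod y"]
    by (simp add: Map_cells_iff)
qed

lemma Map_comp1_assoc: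
  assumes "p \<in> Map_arrs M B" "q \<in> Map_arrs M B" "r \<in> Map_arrs M B" "msrc q = mtrg p" "msrc r = mtrg q"
  shows "Map_comp1 M (Map_comp1 M r q) p = Map_comp1 M r (Map_comp1 M q p)"
proof -
  note [simp] = Map_arrs_typing[OF assms(1)] Map_arrs_typing[OF assms(2)] Map_arrs_typing[OF assms(3)] assms(4,5)
  show ?thesis
    using comp_map_assoc[OF Map_arrsD(3)[OF assms(1)], of "mmap q" "Src M (arr (mtrg q))" "mmap r"]
      Map_arrsD(3)[OF assms(2)] Map_arrsD(3)[OF assms(3)]
    by (auto intro!: marr.expand)
qed

lemma Map_comp1_id:
  assumes "p \<in> Map_arrs M B"
  shows "Map_comp1 M (Map_id1 M (mtrg p)) p = p" "Map_comp1 M p (Map_id1 M (msrc p)) = p"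
proof -
  note [simp] = Map_arrs_typing[OF assms]
  show "Map_comp1 M (Map_id1 M (mtrg p)) p = p" "Map_comp1 M p (Map_id1 M (msrc p)) = p"
    using comp_map_id[OF Map_arrsD(3)[OF assms]] by (auto intro!: marr.expand)
qed

lemma Map_hom_category: "category (hom_cat (Map_cat M B) w w')"
proof (rule category.intro, goal_cases)
  case (6 g f)
  then show ?case by (simp add: hom_cat_def arr_in_def Map_vcomp_cells)
next
  case (9 h g f)
  then show ?case
    using Map_cellsD[of f B] Map_cellsD[of g B] Map_cellsD[of h B]
    by (simp add: hom_cat_def arr_in_def Map_vcomp_cells)
next
  case (10 f)
  then show ?case
    using Map_cellsD[of f B] by (auto simp: hom_cat_def intro!: mcell.expand)
next
  case (11 f)
  then show ?case
    using Map_cellsD[of f B] by (auto simp: hom_cat_def intro!: mcell.expand)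
qed (auto simp: hom_cat_def arr_in_def Map_cellsD Map_id2_cells)

text \<open>For each law of 2-cells, the ends that the cells carry agree by the laws of 1-cells, and
  the underlying cells agree by the same law in \<open>M\<close>.\<close>

lemma Map_two_category: "two_category (Map_cat M B)"
proof (rule two_category.intro, goal_cases)
  case (1 f)
  then show ?case using Map_arrsD[of f B] by auto
next
  case (2 f)
  then show ?case using Map_arrsD[of f B] by auto
next
  case (3 x)
  then show ?case by (simp add: Map_cellsD)
next
  case (4 A A')
  then show ?case by (rule_tac Map_hom_category)
next
  case (5 A)
  then show ?case by (auto simp: arr_in_def Map_id1_arrs)
next
  case (6 f A A' g A'')
  then show ?case by (auto simp: arr_in_def Map_comp1_arrs)
next
  case (7 f A A' g A'' h A''')
  then show ?case by (auto simp: arr_in_def Map_comp1_assoc)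
next
  case (8 f A A')
  then show ?case using Map_comp1_id[of f B] by (auto simp: arr_in_def)
next
  case (9 f A A')
  then show ?case using Map_comp1_id[of f B] by (auto simp: arr_in_def)
next
  case (10 f A A' g A'' x f' y g')
  then show ?case by (auto simp: typing Map_hcomp_cells)
next
  case (11 f A A' g A'')
  then show ?case using Map_arrs_typing[of f B] Map_arrs_typing[of g B] by (simp add: arr_in_def)
next
  case (12 f A A' g A'' x f' x' f'' y g' y' g'')
  then show ?case
    using Map_cellsD[of x B] Map_cellsD[of y B] Map_cellsD[of x' B] Map_cellsD[of y' B] Map_arrs_typing[of f B] Map_arrs_typing[of g B]
    by (simp add: typing interchange')
next
  case (13 f A A' g A'' h A''' x f' y g' z h')
  then show ?case
    using Map_cellsD[of x B] Map_cellsD[of y B] Map_cellsD[of z B] Map_arrs_typing[of f B] Map_arrs_typing[of g B] Map_arrs_typing[of h B]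
      Map_comp1_assoc[of f B g h] Map_comp1_assoc[of f' B g' h']
    by (simp add: typing)
next
  case (14 f A A' x f')
  then show ?case
    using Map_cellsD[of x B] Map_comp1_id[of f B] Map_comp1_id[of f' B] Map_arrs_typing[of f B]
    by (simp add: typing mcell.expand)
next
  case (15 f A A' x f')
  then show ?case
    using Map_cellsD[of x B] Map_comp1_id[of f B] Map_comp1_id[of f' B] Map_arrs_typing[of f B]
    by (simp add: typing mcell.expand)
qed

section \<open>The locally discrete 2-category of comonads on \<open>B\<close>\<close>

lemma Comon_cat_sel [simp]:
  "Ob (Comon_cat M B) = {c. is_comonad M B c}" "Arr (Comon_cat M B) = Comon_arrs M B"
  "Cell (Comon_cat M B) = Comon_arrs M B" "Src (Comon_cat M B) = cdom" "Trg (Comon_cat M B) = ccod"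
  "Dom (Comon_cat M B) k = k" "Cod (Comon_cat M B) k = k"
  "Id1 (Comon_cat M B) c = ComonadMor c (Id2 M (cfun c)) c"
  "Comp1 (Comon_cat M B) = Comon_comp M"
  "Id2 (Comon_cat M B) k = k" "VComp (Comon_cat M B) l k = k" "HComp (Comon_cat M B) = Comon_comp M"
  by (simp_all add: Comon_cat_def)

lemma comonadD:
  assumes "is_comonad M B c"
  shows "cfun c \<in> Arr M" "Src M (cfun c) = B" "Trg M (cfun c) = B"
    "comult c \<in> Cell M" "Dom M (comult c) = cfun c" "Cod M (comult c) = cfun c \<odot> cfun c"
    "cunit c \<in> Cell M" "Dom M (cunit c) = cfun c" "Cod M (cunit c) = Id1 M B"
  using assms by (auto simp: is_comonad_def typing)

lemma Comon_arrs_iff: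
  "k \<in> Comon_arrs M B \<longleftrightarrow> is_comonad M B (cdom k) \<and> is_comonad M B (ccod k) \<and>
    ccell k \<in> Cell M \<and> Dom M (ccell k) = cfun (cdom k) \<and> Cod M (ccell k) = cfun (ccod k) \<and>
    comult (ccod k) \<bullet> ccell k = (ccell k \<star> ccell k) \<bullet> comult (cdom k) \<and> cunit (ccod k) \<bullet> ccell k = cunit (cdom k)"
  by (cases k) (auto simp: Comon_arrs_def typing)

lemma Comon_id_arrs: "is_comonad M B c \<Longrightarrow> ComonadMor c (Id2 M (cfun c)) c \<in> Comon_arrs M B"
  using comonadD[of B c] by (simp add: Comon_arrs_iff)

lemma Comon_comp_sel [simp]:
  "cdom (Comon_comp M l k) = cdom k" "ccod (Comon_comp M l k) = ccod l"
  "ccell (Comon_comp M l k) = ccell l \<bullet> ccell k"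
  by (simp_all add: Comon_comp_def)

lemma Comon_comp_arrs:
  assumes "k \<in> Comon_arrs M B" "l \<in> Comon_arrs M B" "cdom l = ccod k"
  shows "Comon_comp M l k \<in> Comon_arrs M B"
proof -
  have t [simp]: "ccell k \<in> Cell M" "Dom M (ccell k) = cfun (cdom k)" "Cod M (ccell k) = cfun (ccod k)"
    "ccell l \<in> Cell M" "Dom M (ccell l) = cfun (ccod k)" "Cod M (ccell l) = cfun (ccod l)"
    "is_comonad M B (cdom k)" "is_comonad M B (ccod k)" "is_comonad M B (ccod l)"
    and e: "comult (ccod k) \<bullet> ccell k = (ccell k \<star> ccell k) \<bullet> comult (cdom k)" "cunit (ccod k) \<bullet> ccell k = cunit (cdom k)"
    "comult (ccod l) \<bullet> ccell l = (ccell l \<star> ccell l) \<bullet> comult (ccod k)" "cunit (ccod l) \<bullet> ccell l = cunit (ccod k)"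
    using assms by (simp_all add: Comon_arrs_iff)
  note [simp] = comonadD[OF t(7)] comonadD[OF t(8)] comonadD[OF t(9)]
  show ?thesis
    by (simp add: Comon_arrs_iff vcomp_reduce[OF e(3)] vcomp_reduce[OF e(4)] e interchange')
qed

lemma Comon_comp_assoc:
  assumes "k \<in> Comon_arrs M B" "l \<in> Comon_arrs M B" "m \<in> Comon_arrs M B" "cdom l = ccod k" "cdom m = ccod l"
  shows "Comon_comp M (Comon_comp M m l) k = Comon_comp M m (Comon_comp M l k)"
  using assms by (simp add: Comon_arrs_iff Comon_comp_def)

lemma Comon_comp_id:
  assumes "k \<in> Comon_arrs M B"
  shows "Comon_comp M (ComonadMor (ccod k) (Id2 M (cfun (ccod k))) (ccod k)) k = k"
    "Comon_comp M k (ComonadMor (cdom k) (Id2 M (cfun (cdom k))) (cdom k)) = k"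
  using assms by (cases k; simp add: Comon_arrs_iff Comon_comp_def)+

text \<open>A 2-cell is the 1-cell of which it is the identity. So the hom-categories are discrete,
  horizontal composition is composition of 1-cells, and each law of 2-cells repeats a law of
  1-cells.\<close>

lemma Comon_two_category: "two_category (Comon_cat M B)"
proof (rule two_category.intro, goal_cases)
  case (4 A A')
  show ?case by (rule category.intro) (auto simp: hom_cat_def arr_in_def)
next
  case (8 f A A')
  then show ?case using Comon_comp_id[of f B] by (auto simp: arr_in_def)
next
  case (9 f A A')
  then show ?case using Comon_comp_id[of f B] by (auto simp: arr_in_def)
next
  case (14 f A A' x f')
  then show ?case using Comon_comp_id[of f B] by (auto simp: typing)
next
  case (15 f A A' x f')
  then show ?case using Comon_comp_id[of f B] by (auto simp: typing)
qed (auto simp: typing Comon_arrs_iff[of _ B, THEN iffD1] Comon_id_arrs Comon_comp_arrs Comon_comp_assoc)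

lemma coactionD:
  assumes "is_coaction M B c A v \<rho>"
  shows "v \<in> Arr M" "Src M v = A" "Trg M v = B" "\<rho> \<in> Cell M" "Dom M \<rho> = v" "Cod M \<rho> = cfun c \<odot> v"
  using assms by (auto simp: is_coaction_def typing)

subsection \<open>Transport of coactions, and the 2-functor \<open>L\<close>\<close>

definition transport :: "('a, 'c) comonad \<Rightarrow> ('a, 'c) marr \<Rightarrow> 'c \<Rightarrow> 'c" where
  "transport c p \<rho> = (cfun c \<rhd> miso p) \<bullet> ((\<rho> \<lhd> arr (mmap p)) \<bullet> inv2 M (miso p))"

abbreviation coaction_on :: "'o \<Rightarrow> ('a, 'c) comonad \<Rightarrow> ('a, 'c) lmap \<Rightarrow> 'c \<Rightarrow> bool" where
  "coaction_on B c w \<rho> \<equiv> is_coaction M B c (Src M (arr w)) (arr w) \<rho>"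

lemma miso_inverse:
  assumes "p \<in> Map_arrs M B"
  shows "inverse2 M (miso p) (inv2 M (miso p))"
  using Map_arrsD(7)[OF assms] inv2_eq unfolding invertible2_def by metis

lemma
  assumes "p \<in> Map_arrs M B" "is_comonad M B c" "coaction_on B c (mtrg p) \<rho>"
  shows whisker_coaction: "is_coaction M B c (Src M (arr (msrc p))) (arr (mtrg p) \<odot> arr (mmap p)) (\<rho> \<lhd> arr (mmap p))"
    and transport_coaction: "coaction_on B c (msrc p) (transport c p \<rho>)"
    and transport_mor: "coaction_mor M c (arr (mtrg p) \<odot> arr (mmap p)) (\<rho> \<lhd> arr (mmap p))
      (arr (msrc p)) (transport c p \<rho>) (miso p)"
proof -
  note t = Map_arrs_typing[OF assms(1)]
  show *: "is_coaction M B c (Src M (arr (msrc p))) (arr (mtrg p) \<odot> arr (mmap p)) (\<rho> \<lhd> arr (mmap p))"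
    by (rule coaction_whisker[OF assms(3) _ assms(2)]) (simp add: typing t)
  have m: "\<guillemotleft>miso p : arr (mtrg p) \<odot> arr (mmap p) \<Rightarrow> arr (msrc p)\<guillemotright>"
    by (simp add: typing t)
  show "coaction_on B c (msrc p) (transport c p \<rho>)"
    "coaction_mor M c (arr (mtrg p) \<odot> arr (mmap p)) (\<rho> \<lhd> arr (mmap p))
      (arr (msrc p)) (transport c p \<rho>) (miso p)"
    using coaction_transport[OF * assms(2) m miso_inverse[OF assms(1)]]
    unfolding transport_def by blast+
qed

text \<open>As \<open>miso p\<close> is invertible, the morphism square can be solved for the
  coaction on the source of \<open>p\<close>. Equations for transports are proved through this
  lemma, by checking that the isomorphism of the 1-cell is a morphism into the claimed
  coaction.\<close>

lemma transport_unique: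
  assumes "p \<in> Map_arrs M B" "is_comonad M B c" "coaction_on B c (mtrg p) \<rho>" "coaction_on B c (msrc p) \<sigma>"
    "coaction_mor M c (arr (mtrg p) \<odot> arr (mmap p)) (\<rho> \<lhd> arr (mmap p)) (arr (msrc p)) \<sigma> (miso p)"
  shows "transport c p \<rho> = \<sigma>"
proof -
  note [simp] = Map_arrs_typing[OF assms(1)] comonadD[OF assms(2)] coactionD(1,3-6)[OF assms(3)] coactionD(1,3-6)[OF assms(4)]
  have i: "inverse2 M (miso p) (inv2 M (miso p))"
    by (rule miso_inverse[OF assms(1)])
  have [simp]: "inv2 M (miso p) \<in> Cell M" "Dom M (inv2 M (miso p)) = arr (msrc p)"
    "Cod M (inv2 M (miso p)) = arr (mtrg p) \<odot> arr (mmap p)" "miso p \<bullet> inv2 M (miso p) = Id2 M (arr (msrc p))"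
    using i by (simp_all add: inverse2_def typing)
  have e: "(cfun c \<rhd> miso p) \<bullet> (\<rho> \<lhd> arr (mmap p)) = \<sigma> \<bullet> miso p"
    using assms(5) by (simp add: coaction_mor_def)
  show ?thesis
    by (simp add: transport_def vcomp_reduce[OF e])
qed

lemma coaction_mor_refl:
  assumes "is_coaction M B c A v \<rho>" "is_comonad M B c"
  shows "coaction_mor M c v \<rho> v \<rho> (Id2 M v)"
  using coactionD(1,3-6)[OF assms(1)] comonadD[OF assms(2)] by (simp add: coaction_mor_def typing)

lemma transport_id:
  assumes "is_map M w A B" "is_comonad M B c" "coaction_on B c w \<rho>"
  shows "transport c (Map_id1 M w) \<rho> = \<rho>"
proof (rule transport_unique[OF Map_id1_arrs[OF assms(1)] assms(2)])
  show "coaction_mor M c (arr (mtrg (Map_id1 M w)) \<odot> arr (mmap (Map_id1 M w))) (\<rho> \<lhd> arr (mmap (Map_id1 M w)))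
     (arr (msrc (Map_id1 M w))) \<rho> (miso (Map_id1 M w))"
    using coaction_mor_refl[OF assms(3,2)] coactionD(1,3-6)[OF assms(3)] mapD(2,13)[OF assms(1)] by simp
qed (use assms(3) in simp_all)

text \<open>The isomorphism of the composite is the whiskered \<open>miso q\<close> followed by
  \<open>miso p\<close>. Both are coaction morphisms, hence so is their composite.\<close>

lemma transport_comp:
  assumes "p \<in> Map_arrs M B" "q \<in> Map_arrs M B" "msrc q = mtrg p" "is_comonad M B c" "coaction_on B c (mtrg q) \<rho>"
  shows "transport c (Map_comp1 M q p) \<rho> = transport c p (transport c q \<rho>)"
proof (rule transport_unique[OF Map_comp1_arrs[OF assms(1-3)] assms(4)])
  note t = Map_arrs_typing[OF assms(1)] Map_arrs_typing[OF assms(2)] assms(3)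
    coactionD(1,3-6)[OF assms(5)] comonadD[OF assms(4)]
  have q: "coaction_on B c (mtrg p) (transport c q \<rho>)"
    using transport_coaction[OF assms(2,4,5)] assms(3) by simp
  have a: "\<guillemotleft>arr (mmap p) : Src M (arr (msrc p)) \<rightarrow> Src M (arr (msrc q))\<guillemotright>"
    by (simp add: typing t)
  have *: "coaction_mor M c ((arr (mtrg q) \<odot> arr (mmap q)) \<odot> arr (mmap p)) ((\<rho> \<lhd> arr (mmap q)) \<lhd> arr (mmap p))
      (arr (msrc q) \<odot> arr (mmap p)) (transport c q \<rho> \<lhd> arr (mmap p)) (miso q \<lhd> arr (mmap p))"
    by (rule coaction_mor_whisker[OF transport_mor[OF assms(2,4,5)] a
      whisker_coaction[OF assms(2,4,5)] transport_coaction[OF assms(2,4,5)] assms(4)])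
  have c1: "is_coaction M B c (Src M (arr (msrc p))) ((arr (mtrg q) \<odot> arr (mmap q)) \<odot> arr (mmap p))
      ((\<rho> \<lhd> arr (mmap q)) \<lhd> arr (mmap p))"
    by (rule coaction_whisker[OF whisker_coaction[OF assms(2,4,5)] a assms(4)])
  have "coaction_mor M c ((arr (mtrg q) \<odot> arr (mmap q)) \<odot> arr (mmap p)) ((\<rho> \<lhd> arr (mmap q)) \<lhd> arr (mmap p))
    (arr (msrc p)) (transport c p (transport c q \<rho>)) (miso p \<bullet> (miso q \<lhd> arr (mmap p)))"
    using coaction_mor_comp[OF *[unfolded assms(3)] transport_mor[OF assms(1,4) q] c1 whisker_coaction[OF assms(1,4) q]
      transport_coaction[OF assms(1,4) q] assms(4)] .
  then show "coaction_mor M c (arr (mtrg (Map_comp1 M q p)) \<odot> arr (mmap (Map_comp1 M q p)))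
     (\<rho> \<lhd> arr (mmap (Map_comp1 M q p))) (arr (msrc (Map_comp1 M q p))) (transport c p (transport c q \<rho>))
     (miso (Map_comp1 M q p))"
    by (simp add: t)
  show "coaction_on B c (msrc (Map_comp1 M q p)) (transport c p (transport c q \<rho>))"
    using transport_coaction[OF assms(1,4) q] by simp
qed (use assms(5) in simp)

text \<open>A morphism of \<open>c\<close>-coactions remains a morphism after pushing along
  \<open>k\<close>, so \<open>miso p\<close> also connects the two pushed coactions. This is
  naturality of transport in the comonad.\<close>

lemma transport_push:
  assumes "p \<in> Map_arrs M B" "ComonadMor c k c' \<in> Comon_arrs M B" "coaction_on B c (mtrg p) \<rho>"
  shows "transport c' p (push (arr (mtrg p)) k \<rho>) = push (arr (msrc p)) k (transport c p \<rho>)"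
proof (rule transport_unique[OF assms(1) comonad_morD(2)[OF assms(2)]])
  note c = comonad_morD(1)[OF assms(2)]
  have "\<guillemotleft>arr (mmap p) : Src M (arr (msrc p)) \<rightarrow> Src M (arr (mtrg p))\<guillemotright>"
    by (simp add: typing Map_arrs_typing[OF assms(1)])
  from push_whisker[OF assms(3,2) this]
  show "coaction_mor M c' (arr (mtrg p) \<odot> arr (mmap p)) (push (arr (mtrg p)) k \<rho> \<lhd> arr (mmap p))
     (arr (msrc p)) (push (arr (msrc p)) k (transport c p \<rho>)) (miso p)"
    using push_mor[OF transport_mor[OF assms(1) c assms(3)] whisker_coaction[OF assms(1) c assms(3)]
      transport_coaction[OF assms(1) c assms(3)] assms(2)] by simp
qed (rule push_coaction[OF assms(3,2)] push_coaction[OF transport_coaction[OF assms(1) comonad_morD(1)[OF assms(2)] assms(3)] assms(2)])+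

text \<open>By exchange with \<open>\<rho>\<close>, the cell
  \<open>arr (mtrg (mdom x)) \<rhd> mcell x\<close> is a coaction morphism. Followed by
  \<open>miso (mcod x)\<close> it becomes \<open>miso (mdom x)\<close>, which is the defining
  triangle of \<open>x\<close>.\<close>

lemma transport_cell:
  assumes "x \<in> Map_cells M B" "is_comonad M B c" "coaction_on B c (mtrg (mdom x)) \<rho>"
  shows "transport c (mdom x) \<rho> = transport c (mcod x) \<rho>"
proof (rule transport_unique[OF Map_cellsD(1)[OF assms(1)] assms(2,3)])
  note x = Map_cellsD[OF assms(1)]
  note t = x(3-8) Map_arrs_typing[OF x(1)] Map_arrs_typing[OF x(2)] comonadD[OF assms(2)] coactionD(1,3-6)[OF assms(3)]
  have r: "coaction_on B c (mtrg (mcod x)) \<rho>"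
    using assms(3) by (simp add: t)
  let ?w = "arr (mtrg (mdom x))"
  have "coaction_mor M c (?w \<odot> arr (mmap (mdom x))) (\<rho> \<lhd> arr (mmap (mdom x)))
    (?w \<odot> arr (mmap (mcod x))) (\<rho> \<lhd> arr (mmap (mcod x))) (?w \<rhd> mcell x)"
    using exchange[of "mcell x" \<rho>] by (simp add: coaction_mor_def typing t)
  then have "coaction_mor M c (?w \<odot> arr (mmap (mdom x))) (\<rho> \<lhd> arr (mmap (mdom x)))
    (arr (msrc (mcod x))) (transport c (mcod x) \<rho>) (miso (mcod x) \<bullet> (?w \<rhd> mcell x))"
    using transport_mor[OF x(2) assms(2) r] whisker_coaction[OF x(1) assms(2,3)]
      whisker_coaction[OF x(2) assms(2) r] transport_coaction[OF x(2) assms(2) r]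
    unfolding x(3,4) using coaction_mor_comp assms(2) by blast
  then show "coaction_mor M c (?w \<odot> arr (mmap (mdom x))) (\<rho> \<lhd> arr (mmap (mdom x)))
    (arr (msrc (mdom x))) (transport c (mcod x) \<rho>) (miso (mdom x))"
    by (simp add: x)
  show "coaction_on B c (msrc (mdom x)) (transport c (mcod x) \<rho>)"
    using transport_coaction[OF x(2) assms(2) r] by (simp add: x)
qed

text \<open>Written out, both formulas are the same vertical composite, with the inverse of
  \<open>miso p\<close> applied first and \<open>counit (msrc p)\<close> last. All later facts on
  \<open>L_arr\<close> go through this form.\<close>

lemma L_arr_eq:
  assumes "p \<in> Map_arrs M B"
  shows "L_arr M p = ComonadMor (L_obj M (msrc p))
    (mor_of_coaction (L_obj M (mtrg p)) (msrc p) (transport (L_obj M (mtrg p)) p (arr (mtrg p) \<rhd> unit (mtrg p)))) (L_obj M (mtrg p))"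
proof -
  note p = Map_arrsD[OF assms]
  note [simp] = mapD(1,3-14)[OF p(1)] mapD(1,3-14)[OF p(2)] Map_arrs_typing[OF assms]
  have [simp]: "inv2 M (miso p) \<in> Cell M" "Dom M (inv2 M (miso p)) = arr (msrc p)"
    "Cod M (inv2 M (miso p)) = arr (mtrg p) \<odot> arr (mmap p)"
    using miso_inverse[OF assms] by (simp_all add: inverse2_def typing)
  show ?thesis
    by (simp add: L_arr_def Let_def mor_of_coaction_def transport_def)
qed

lemma
  assumes "p \<in> Map_arrs M B"
  shows L_arr_arrs: "L_arr M p \<in> Comon_arrs M B"
    and coaction_of_L_arr: "coaction_of_mor (msrc p) (ccell (L_arr M p)) =
      transport (L_obj M (mtrg p)) p (arr (mtrg p) \<rhd> unit (mtrg p))"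
    and L_arr_sel: "cdom (L_arr M p) = L_obj M (msrc p)" "ccod (L_arr M p) = L_obj M (mtrg p)"
proof -
  note p = Map_arrsD[OF assms]
  have c: "is_comonad M B (L_obj M (mtrg p))"
    by (rule L_obj_comonad[OF p(2)])
  have t: "coaction_on B (L_obj M (mtrg p)) (msrc p) (transport (L_obj M (mtrg p)) p (arr (mtrg p) \<rhd> unit (mtrg p)))"
    by (rule transport_coaction[OF assms c canonical_coaction[OF p(2)]])
  then have "\<guillemotleft>transport (L_obj M (mtrg p)) p (arr (mtrg p) \<rhd> unit (mtrg p)) : arr (msrc p) \<Rightarrow> cfun (L_obj M (mtrg p)) \<odot> arr (msrc p)\<guillemotright>"
    by (simp add: is_coaction_def)
  from coaction_of_mor_of_coaction[OF p(1) this c]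
  show "coaction_of_mor (msrc p) (ccell (L_arr M p)) =
      transport (L_obj M (mtrg p)) p (arr (mtrg p) \<rhd> unit (mtrg p))"
    by (simp add: L_arr_eq[OF assms])
  show "L_arr M p \<in> Comon_arrs M B"
    unfolding L_arr_eq[OF assms] by (rule mor_of_coaction_mor[OF p(1) t c])
  show "cdom (L_arr M p) = L_obj M (msrc p)" "ccod (L_arr M p) = L_obj M (mtrg p)"
    by (simp_all add: L_arr_eq[OF assms])
qed

text \<open>\<open>mor_of_coaction\<close> recovers a comonad morphism from its coaction. This turns
  the strict equalities required in Comon(B) into equalities of coactions.\<close>

lemma Comon_arrs_eqI:
  assumes "is_map M w A B" "k \<in> Comon_arrs M B" "l \<in> Comon_arrs M B" "cdom k = L_obj M w" "cdom l = L_obj M w"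
    "ccod k = ccod l" "coaction_of_mor w (ccell k) = coaction_of_mor w (ccell l)"
  shows "k = l"
proof -
  have *: "mor_of_coaction (ccod m) w (coaction_of_mor w (ccell m)) = ccell m"
    if "m \<in> Comon_arrs M B" "cdom m = L_obj M w" for m
  proof (rule mor_of_coaction_of_mor[OF assms(1)])
    have "\<guillemotleft>ccell m : cfun (cdom m) \<Rightarrow> cfun (ccod m)\<guillemotright>" "is_comonad M B (ccod m)"
      using that(1) unfolding Comon_arrs_iff typing by blast+
    then show "\<guillemotleft>ccell m : arr w \<odot> radj w \<Rightarrow> cfun (ccod m)\<guillemotright>" "is_comonad M B (ccod m)"
      using that(2) by simp_all
  qed
  have "ccell k = ccell l"
    using *[OF assms(2,4)] *[OF assms(3,5)] assms(6,7) by metis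
  then show ?thesis
    using assms(4-6) by (simp add: comonad_mor.expand)
qed

text \<open>\<open>coaction_of_mor\<close> pushes the canonical coaction, so composing with
  \<open>l\<close> amounts to one more push.\<close>

lemma coaction_of_mor_comp:
  assumes "is_map M w A B" "k \<in> Comon_arrs M B" "l \<in> Comon_arrs M B" "cdom k = L_obj M w" "cdom l = ccod k"
  shows "coaction_of_mor w (ccell l \<bullet> ccell k) = push (arr w) (ccell l) (coaction_of_mor w (ccell k))"
  unfolding coaction_of_mor_def
  using push_comp[OF canonical_coaction[OF assms(1)], of "ccell k" "ccod k" "ccell l" "ccod l"] assms(2-5)
  by (metis comonad_mor.collapse)

text \<open>\<open>ccell g\<close> pushes the transported canonical coaction, and pushing commutes
  with transport. This is naturality in \<open>w\<close> of the bijection between comonad morphisms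
  out of \<open>L(w)\<close> and coactions on \<open>w\<close>.\<close>

lemma coaction_of_mor_L_arr:
  assumes "p \<in> Map_arrs M B" "g \<in> Comon_arrs M B" "cdom g = L_obj M (mtrg p)"
  shows "coaction_of_mor (msrc p) (ccell g \<bullet> ccell (L_arr M p)) =
    transport (ccod g) p (coaction_of_mor (mtrg p) (ccell g))"
proof -
  note p = Map_arrsD[OF assms(1)]
  have g: "ComonadMor (L_obj M (mtrg p)) (ccell g) (ccod g) \<in> Comon_arrs M B"
    using assms(2,3) by (metis comonad_mor.collapse)
  have "coaction_of_mor (msrc p) (ccell g \<bullet> ccell (L_arr M p)) =
    push (arr (msrc p)) (ccell g) (transport (L_obj M (mtrg p)) p (arr (mtrg p) \<rhd> unit (mtrg p)))"
    using coaction_of_mor_comp[OF p(1) L_arr_arrs[OF assms(1)] assms(2)] assms(3)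
    by (simp add: L_arr_sel[OF assms(1)] coaction_of_L_arr[OF assms(1)])
  also have "\<dots> = transport (ccod g) p (coaction_of_mor (mtrg p) (ccell g))"
    unfolding coaction_of_mor_def
    by (rule transport_push[OF assms(1) g canonical_coaction[OF p(2)], symmetric])
  finally show ?thesis .
qed

lemma L_fun_sel [simp]: "F0 (L_fun M) = L_obj M" "F1 (L_fun M) = L_arr M" "F2 (L_fun M) x = L_arr M (mdom x)"
  by (simp_all add: L_fun_def)

lemma L_arr_id:
  assumes "is_map M w A B"
  shows "L_arr M (Map_id1 M w) = ComonadMor (L_obj M w) (Id2 M (arr w \<odot> radj w)) (L_obj M w)"
proof (rule Comon_arrs_eqI[OF assms])
  note i = Map_id1_arrs[OF assms]
  note c = L_obj_comonad[OF assms]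
  have k: "coaction_on B (L_obj M w) w (arr w \<rhd> unit w)"
    using canonical_coaction[OF assms] mapD(2)[OF assms] by simp
  show "coaction_of_mor w (ccell (L_arr M (Map_id1 M w))) =
    coaction_of_mor w (ccell (ComonadMor (L_obj M w) (Id2 M (arr w \<odot> radj w)) (L_obj M w)))"
    using coaction_of_L_arr[OF i] transport_id[OF assms c k] push_id[OF k c]
    by (simp add: coaction_of_mor_def)
  show "L_arr M (Map_id1 M w) \<in> Comon_arrs M B"
    by (rule L_arr_arrs[OF i])
  show "ComonadMor (L_obj M w) (Id2 M (arr w \<odot> radj w)) (L_obj M w) \<in> Comon_arrs M B"
    using Comon_id_arrs[OF c] by simp
  show "cdom (L_arr M (Map_id1 M w)) = L_obj M w"
    "ccod (L_arr M (Map_id1 M w)) = ccod (ComonadMor (L_obj M w) (Id2 M (arr w \<odot> radj w)) (L_obj M w))"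
    using L_arr_sel[OF i] by simp_all
qed simp

text \<open>On coactions, the left side is transport of the canonical coaction along the composite.
  The right side is transport along \<open>q\<close> and then along \<open>p\<close>, by
  \<open>coaction_of_mor_L_arr\<close>.\<close>

lemma L_arr_comp:
  assumes "p \<in> Map_arrs M B" "q \<in> Map_arrs M B" "msrc q = mtrg p"
  shows "L_arr M (Map_comp1 M q p) = Comon_comp M (L_arr M q) (L_arr M p)"
proof (rule Comon_arrs_eqI[OF Map_arrsD(1)[OF assms(1)]])
  note qp = Map_comp1_arrs[OF assms]
  note p = L_arr_arrs[OF assms(1)] L_arr_sel[OF assms(1)]
  note q = L_arr_arrs[OF assms(2)] L_arr_sel[OF assms(2)]
  show "coaction_of_mor (msrc p) (ccell (L_arr M (Map_comp1 M q p))) =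
    coaction_of_mor (msrc p) (ccell (Comon_comp M (L_arr M q) (L_arr M p)))"
    using coaction_of_L_arr[OF qp] coaction_of_mor_L_arr[OF assms(1) q(1)] q assms(3) coaction_of_L_arr[OF assms(2)]
      transport_comp[OF assms L_obj_comonad canonical_coaction, OF Map_arrsD(2)[OF assms(2)] Map_arrsD(2)[OF assms(2)]]
    by simp
  show "L_arr M (Map_comp1 M q p) \<in> Comon_arrs M B"
    by (rule L_arr_arrs[OF qp])
  show "Comon_comp M (L_arr M q) (L_arr M p) \<in> Comon_arrs M B"
    using Comon_comp_arrs[OF p(1) q(1)] p q assms(3) by simp
qed (use L_arr_sel[OF Map_comp1_arrs[OF assms]] L_arr_sel[OF assms(1)] L_arr_sel[OF assms(2)] in simp_all)

text \<open>A discrete target has no 2-cell between different 1-cells, so \<open>L\<close> has to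
  send both ends of \<open>x\<close> to one comonad morphism. It does, since both ends transport the
  canonical coaction alike; hence \<open>L_fun\<close> may read off the domain of a 2-cell.\<close>

lemma L_arr_cell:
  assumes "x \<in> Map_cells M B"
  shows "L_arr M (mdom x) = L_arr M (mcod x)"
proof -
  note x = Map_cellsD[OF assms]
  show ?thesis
    using transport_cell[OF assms L_obj_comonad canonical_coaction, OF Map_arrsD(2)[OF x(1)] Map_arrsD(2)[OF x(1)]]
    by (simp add: L_arr_eq[OF x(1)] L_arr_eq[OF x(2)] x(3,4))
qed

lemma L_two_functor: "two_functor (Map_cat M B) (Comon_cat M B) (L_fun M)"
proof -
  interpret C: two_category "Map_cat M B" by (rule Map_two_category)
  interpret D: two_category "Comon_cat M B" by (rule Comon_two_category)
  show ?thesis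
  proof (unfold_locales, goal_cases)
    case (1 A)
    then show ?case using L_obj_comonad by auto
  next
    case (2 f A A')
    then show ?case using L_arr_arrs[of f B] L_arr_sel[of f B] by (simp add: arr_in_def)
  next
    case (3 x f g)
    then show ?case using L_arr_cell[of x B] L_arr_arrs[of f B] Map_cellsD(1)[of x B] by (simp add: typing)
  next
    case (6 A)
    then show ?case using L_arr_id by auto
  next
    case (7 f A A' g A'')
    then show ?case using L_arr_comp[of f B g] by (simp add: typing)
  next
    case (8 f A A' g A'' x f' y g')
    then show ?case using L_arr_comp[of f B g] by (simp add: typing)
  qed simp_all
qed

subsection \<open>Tannaka-Krein objects\<close>

text \<open>From here on, 2-cells between maps are compared by uniqueness, not componentwise.\<close>

declare Map_cat_sel(10-12) [simp del]

lemma Map_cell_in_iff: "\<guillemotleft>x : p \<Rightarrow>\<^bsub>Map_cat M B\<^esub> q\<guillemotright> \<longleftrightarrow> x \<in> Map_cells M B \<and> mdom x = p \<and> mcod x = q"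
  by (simp add: cell_in_def)

lemma Map_id_in: "p \<in> Map_arrs M B \<Longrightarrow> \<guillemotleft>Id2 (Map_cat M B) p : p \<Rightarrow>\<^bsub>Map_cat M B\<^esub> p\<guillemotright>"
  by (simp add: Map_cell_in_iff Map_cat_sel(10) Map_id2_cells)

lemma Map_vcomp_in:
  assumes "\<guillemotleft>x : p \<Rightarrow>\<^bsub>Map_cat M B\<^esub> q\<guillemotright>" "\<guillemotleft>y : q \<Rightarrow>\<^bsub>Map_cat M B\<^esub> r\<guillemotright>"
  shows "\<guillemotleft>y \<bullet>\<^bsub>Map_cat M B\<^esub> x : p \<Rightarrow>\<^bsub>Map_cat M B\<^esub> r\<guillemotright>"
  using assms by (auto simp: Map_cell_in_iff Map_cat_sel(11) Map_vcomp_cells)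

lemma Map_hcomp_in:
  assumes "\<guillemotleft>x : p \<Rightarrow>\<^bsub>Map_cat M B\<^esub> q\<guillemotright>" "\<guillemotleft>y : p' \<Rightarrow>\<^bsub>Map_cat M B\<^esub> q'\<guillemotright>" "msrc p' = mtrg p"
  shows "\<guillemotleft>y \<star>\<^bsub>Map_cat M B\<^esub> x : Map_comp1 M p' p \<Rightarrow>\<^bsub>Map_cat M B\<^esub> Map_comp1 M q' q\<guillemotright>"
  using assms by (auto simp: Map_cell_in_iff Map_cat_sel(12) Map_hcomp_cells)

lemma Map_cell_in_arrs:
  assumes "\<guillemotleft>x : p \<Rightarrow>\<^bsub>Map_cat M B\<^esub> q\<guillemotright>"
  shows "p \<in> Map_arrs M B" "q \<in> Map_arrs M B" "msrc q = msrc p" "mtrg q = mtrg p"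
  using assms Map_cellsD[of x B] by (auto simp: Map_cell_in_iff)

lemma inverse2_cancel:
  assumes "inverse2 M \<alpha> \<beta>" "\<gamma> \<in> Cell M" "\<delta> \<in> Cell M" "Cod M \<gamma> = Dom M \<alpha>" "Cod M \<delta> = Dom M \<alpha>" "\<alpha> \<bullet> \<gamma> = \<alpha> \<bullet> \<delta>"
  shows "\<gamma> = \<delta>"
proof -
  have t [simp]: "\<alpha> \<in> Cell M" "\<beta> \<in> Cell M" "Dom M \<beta> = Cod M \<alpha>" and i: "\<beta> \<bullet> \<alpha> = Id2 M (Dom M \<alpha>)"
    using assms(1) by (auto simp: inverse2_def typing)
  have "\<beta> \<bullet> (\<alpha> \<bullet> \<gamma>) = \<beta> \<bullet> (\<alpha> \<bullet> \<delta>)"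
    by (simp only: assms(6))
  then show ?thesis
    using assms(2-5) by (simp add: vcomp_reduce[OF i])
qed

lemma Map_id2_sel [simp]: "mdom (Id2 (Map_cat M B) p) = p" "mcod (Id2 (Map_cat M B) p) = p"
  by (simp_all add: Map_cat_sel(10))

text \<open>Cancelling \<open>miso q\<close> in the triangle of a 2-cell determines its whiskering
  with \<open>arr v\<close>, and this whiskering is injective on cells into a map.\<close>

lemma TK_cell_unique:
  assumes "is_TK_object M B c E v \<rho>" "\<guillemotleft>x : p \<Rightarrow>\<^bsub>Map_cat M B\<^esub> q\<guillemotright>" "\<guillemotleft>y : p \<Rightarrow>\<^bsub>Map_cat M B\<^esub> q\<guillemotright>" "mtrg p = v"
  shows "x = y"
proof -
  note pq = Map_cell_in_arrs[OF assms(2)]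
  have E: "Src M (arr v) = E"
    using assms(1) mapD(2) unfolding is_TK_object_def by blast
  have x: "mcell x \<in> Cell M" "Dom M (mcell x) = arr (mmap p)" "Cod M (mcell x) = arr (mmap q)"
    "miso q \<bullet> (arr v \<rhd> mcell x) = miso p" "mdom x = p" "mcod x = q"
    using assms(2) Map_cellsD[of x B] unfolding Map_cell_in_iff assms(4)[symmetric] by auto
  have y: "mcell y \<in> Cell M" "Dom M (mcell y) = arr (mmap p)" "Cod M (mcell y) = arr (mmap q)"
    "miso q \<bullet> (arr v \<rhd> mcell y) = miso p" "mdom y = p" "mcod y = q"
    using assms(3) Map_cellsD[of y B] unfolding Map_cell_in_iff assms(4)[symmetric] by auto
  note t = Map_arrs_typing[OF pq(1)] Map_arrs_typing[OF pq(2)] pq(3,4) assms(4)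
  have "arr v \<rhd> mcell x = arr v \<rhd> mcell y"
    by (rule inverse2_cancel[OF miso_inverse[OF pq(2)]]) (use t x y in simp_all)
  moreover have "inj_on (\<lambda>\<theta>. arr v \<rhd> \<theta>) {\<theta>. \<guillemotleft>\<theta> : arr (mmap p) \<Rightarrow> arr (mmap q)\<guillemotright>}"
  proof (rule bij_betw_imp_inj_on)
    have "is_map M (mmap q) (Src M (arr (msrc p))) E" "\<guillemotleft>arr (mmap p) : Src M (arr (msrc p)) \<rightarrow> E\<guillemotright>"
      using Map_arrsD(3)[OF pq(2)] t E by (simp_all add: typing)
    with assms(1) show "bij_betw (\<lambda>\<theta>. arr v \<rhd> \<theta>) {\<theta>. \<guillemotleft>\<theta> : arr (mmap p) \<Rightarrow> arr (mmap q)\<guillemotright>}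
      {\<alpha>. coaction_mor M c (arr v \<odot> arr (mmap p)) (\<rho> \<lhd> arr (mmap p)) (arr v \<odot> arr (mmap q)) (\<rho> \<lhd> arr (mmap q)) \<alpha>}"
      unfolding is_TK_object_def by blast
  qed
  ultimately have "mcell x = mcell y"
    using x y by (simp add: inj_on_def cell_in_def)
  then show ?thesis
    using x y by (simp add: mcell.expand)
qed

text \<open>The whiskered cell is forced to be \<open>inv2 M (miso q) \<bullet> miso p\<close>. It
  passes through the common transported coaction on the source, so it is a coaction morphism, and
  surjectivity of whiskering with \<open>arr v\<close> lifts it.\<close>

lemma TK_cell_exists:
  assumes "is_TK_object M B c E v \<rho>" "is_comonad M B c" "p \<in> Map_arrs M B" "q \<in> Map_arrs M B"
    "msrc p = msrc q" "mtrg p = v" "mtrg q = v" "transport c p \<rho> = transport c q \<rho>"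
  shows "\<exists>x. \<guillemotleft>x : p \<Rightarrow>\<^bsub>Map_cat M B\<^esub> q\<guillemotright>"
proof -
  have E: "Src M (arr v) = E"
    using assms(1) mapD(2) unfolding is_TK_object_def by blast
  have r: "coaction_on B c v \<rho>"
    using assms(1) unfolding is_TK_object_def E by blast
  note rp = r[folded assms(6)] and rq = r[folded assms(7)]
  note t = Map_arrs_typing[OF assms(3)] Map_arrs_typing[OF assms(4)] assms(5-7)
  have i: "inverse2 M (miso q) (inv2 M (miso q))"
    by (rule miso_inverse[OF assms(4)])
  have m: "coaction_mor M c (arr (msrc q)) (transport c q \<rho>) (arr (mtrg q) \<odot> arr (mmap q)) (\<rho> \<lhd> arr (mmap q)) (inv2 M (miso q))"
    by (rule coaction_mor_inverse[OF transport_mor[OF assms(4,2) rq] i whisker_coaction[OF assms(4,2) rq]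
      transport_coaction[OF assms(4,2) rq] assms(2)])
  have "coaction_mor M c (arr (mtrg p) \<odot> arr (mmap p)) (\<rho> \<lhd> arr (mmap p)) (arr (mtrg q) \<odot> arr (mmap q))
    (\<rho> \<lhd> arr (mmap q)) (inv2 M (miso q) \<bullet> miso p)"
    by (rule coaction_mor_comp[OF transport_mor[OF assms(3,2) rp, unfolded assms(5,8)] m
      whisker_coaction[OF assms(3,2) rp, unfolded assms(5)]
      transport_coaction[OF assms(4,2) rq] whisker_coaction[OF assms(4,2) rq] assms(2)])
  moreover have "is_map M (mmap q) (Src M (arr (msrc p))) E" "\<guillemotleft>arr (mmap p) : Src M (arr (msrc p)) \<rightarrow> E\<guillemotright>"
    using Map_arrsD(3)[OF assms(4)] t E by (simp_all add: typing)
  with assms(1) have "bij_betw (\<lambda>\<theta>. arr v \<rhd> \<theta>) {\<theta>. \<guillemotleft>\<theta> : arr (mmap p) \<Rightarrow> arr (mmap q)\<guillemotright>}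
    {\<alpha>. coaction_mor M c (arr v \<odot> arr (mmap p)) (\<rho> \<lhd> arr (mmap p)) (arr v \<odot> arr (mmap q)) (\<rho> \<lhd> arr (mmap q)) \<alpha>}"
    unfolding is_TK_object_def by blast
  ultimately obtain \<theta> where \<theta>: "\<guillemotleft>\<theta> : arr (mmap p) \<Rightarrow> arr (mmap q)\<guillemotright>" "arr v \<rhd> \<theta> = inv2 M (miso q) \<bullet> miso p"
    unfolding assms(6,7) bij_betw_def by (smt (verit) imageE mem_Collect_eq)
  have [simp]: "miso q \<bullet> inv2 M (miso q) = Id2 M (arr (msrc q))" "inv2 M (miso q) \<in> Cell M"
    "Dom M (inv2 M (miso q)) = arr (msrc q)" "Cod M (inv2 M (miso q)) = arr v \<odot> arr (mmap q)"
    using i t by (simp_all add: inverse2_def typing)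
  have "miso q \<bullet> (arr v \<rhd> \<theta>) = miso p"
    unfolding \<theta>(2) using t vcomp_reduce[of "miso q" "inv2 M (miso q)" "Id2 M (arr (msrc q))" "miso p"] by simp
  then have "\<guillemotleft>MCell p \<theta> q : p \<Rightarrow>\<^bsub>Map_cat M B\<^esub> q\<guillemotright>"
    using \<theta>(1) assms(3-7) by (simp add: Map_cell_in_iff Map_cells_iff cell_in_def[of M])
  then show ?thesis by blast
qed

lemma TK_arr_exists:
  assumes "is_TK_object M B c E v \<rho>" "is_comonad M B c" "is_map M w A B" "coaction_on B c w \<sigma>"
  shows "\<exists>p \<in> Map_arrs M B. msrc p = w \<and> mtrg p = v \<and> transport c p \<rho> = \<sigma>"
proof -
  have A: "Src M (arr w) = A"
    using mapD(2)[OF assms(3)] .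
  have v: "is_map M v E B" "Src M (arr v) = E"
    using assms(1) mapD(2) unfolding is_TK_object_def by blast+
  have r: "coaction_on B c v \<rho>"
    using assms(1) unfolding is_TK_object_def v(2) by blast
  obtain f \<alpha> where f: "is_map M f A E" "coaction_iso M c (arr w) \<sigma> (arr v \<odot> arr f) (\<rho> \<lhd> arr f) \<alpha>"
    using assms(1,3,4) unfolding is_TK_object_def A by blast
  \<comment> \<open>The isomorphism of a 1-cell of \<open>Map_cat\<close> runs from
    \<open>arr v \<odot> arr f\<close> to \<open>arr w\<close>, opposite to
    \<open>\<alpha>\<close>.\<close>
  then obtain \<beta> where b: "coaction_mor M c (arr v \<odot> arr f) (\<rho> \<lhd> arr f) (arr w) \<sigma> \<beta>" "inverse2 M \<alpha> \<beta>"
    unfolding coaction_iso_def by blast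
  let ?p = "MArr w f \<beta> v"
  have p: "?p \<in> Map_arrs M B"
    using assms(3) v f(1) A b inverse2_sym[OF b(2)]
    by (auto simp: Map_arrs_iff coaction_mor_def invertible2_def)
  have "transport c ?p \<rho> = \<sigma>"
    by (rule transport_unique[OF p assms(2)]) (use r assms(4) b(1) in simp_all)
  with p show ?thesis by force
qed

text \<open>A comonad morphism \<open>k\<close> pushes the coaction chosen for \<open>cdom k\<close>
  to a coaction of \<open>ccod k\<close> on the same map. The Tannaka-Krein object of
  \<open>ccod k\<close> realizes that coaction by a 1-cell, whose two components serve as
  \<open>rep_f\<close> and \<open>rep_lam\<close>.\<close>

lemma rep_choice_exists:
  assumes "has_TK_objects M" "B \<in> Ob M"
  shows "\<exists>T. is_rep_choice M B T"
proof -
  \<comment> \<open>The underlying object of a Tannaka-Krein object is the source of its map, so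
    only the pair of map and coaction is chosen.\<close>
  have "\<exists>z. is_TK_object M B c (Src M (arr (fst z))) (fst z) (snd z)" if "is_comonad M B c" for c
  proof -
    have "\<exists>E v \<rho>. is_TK_object M B c E v \<rho>"
      using assms that unfolding has_TK_objects_def by blast
    then obtain E v \<rho> where tk: "is_TK_object M B c E v \<rho>"
      by blast
    then have "Src M (arr v) = E"
      using mapD(2) unfolding is_TK_object_def by blast
    with tk show ?thesis by force
  qed
  then obtain z where z: "is_TK_object M B c (Src M (arr (fst (z c)))) (fst (z c)) (snd (z c))" if "is_comonad M B c" for c
    by metis
  let ?v = "\<lambda>c. fst (z c)" and ?r = "\<lambda>c. snd (z c)"
  have zc: "coaction_on B c (?v c) (?r c)" "is_map M (?v c) (Src M (arr (?v c))) B" if "is_comonad M B c" for c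
    using z[OF that] unfolding is_TK_object_def by blast+
  have "\<exists>p. p \<in> Map_arrs M B \<and> msrc p = ?v (cdom k) \<and> mtrg p = ?v (ccod k) \<and>
    transport (ccod k) p (?r (ccod k)) = push (arr (?v (cdom k))) (ccell k) (?r (cdom k))" if "k \<in> Comon_arrs M B" for k
  proof -
    have k: "ComonadMor (cdom k) (ccell k) (ccod k) \<in> Comon_arrs M B"
      using that by simp
    note c = comonad_morD(1,2)[OF k]
    from TK_arr_exists[OF z[OF c(2)] c(2) zc(2)[OF c(1)] push_coaction[OF zc(1)[OF c(1)] k]]
    show ?thesis by blast
  qed
  then obtain P where P: "P k \<in> Map_arrs M B" "msrc (P k) = ?v (cdom k)" "mtrg (P k) = ?v (ccod k)"
    "transport (ccod k) (P k) (?r (ccod k)) = push (arr (?v (cdom k))) (ccell k) (?r (cdom k))" if "k \<in> Comon_arrs M B" for k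
    by metis
  let ?T = "\<lparr>rep_v = ?v, rep_rho = ?r, rep_f = \<lambda>k. mmap (P k), rep_lam = \<lambda>k. miso (P k)\<rparr>"
  have "is_map M (mmap (P k)) (Src M (arr (?v c))) (Src M (arr (?v c'))) \<and>
    coaction_iso M c' (arr (?v c') \<odot> arr (mmap (P k))) (?r c' \<lhd> arr (mmap (P k)))
              (arr (?v c)) ((\<phi> \<lhd> arr (?v c)) \<bullet> ?r c) (miso (P k))"
    if k: "k \<in> Comon_arrs M B" "k = ComonadMor c \<phi> c'" for c \<phi> c' k
  proof -
    note c = comonad_morD(1,2)[OF k(1)[unfolded k(2)]]
    have p: "P k \<in> Map_arrs M B" "msrc (P k) = ?v c" "mtrg (P k) = ?v c'"
      "transport c' (P k) (?r c') = (\<phi> \<lhd> arr (?v c)) \<bullet> ?r c"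
      using P[OF k(1)] k(2) by (simp_all add: push_def)
    have r: "coaction_on B c' (mtrg (P k)) (?r c')"
      using zc(1)[OF c(2)] p(3) by simp
    have "coaction_mor M c' (arr (msrc (P k))) (transport c' (P k) (?r c')) (arr (mtrg (P k)) \<odot> arr (mmap (P k)))
       (?r c' \<lhd> arr (mmap (P k))) (inv2 M (miso (P k)))"
      by (rule coaction_mor_inverse[OF transport_mor[OF p(1) c(2) r] miso_inverse[OF p(1)] whisker_coaction[OF p(1) c(2) r]
        transport_coaction[OF p(1) c(2) r] c(2)])
    then show ?thesis
      using transport_mor[OF p(1) c(2) r] miso_inverse[OF p(1)] Map_arrsD(3)[OF p(1)]
      unfolding coaction_iso_def p(2-4) by blast
  qed
  then have "is_rep_choice M B ?T"
    unfolding is_rep_choice_def Let_def using z by simp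
  then show ?thesis by blast
qed

text \<open>The same description as for the constraints in \<open>Rep_fun\<close>, so that these,
  the counits of the hom-equivalences and the structure cells of the biadjunction are all values of
  one function. It denotes a 2-cell when \<open>p\<close> and \<open>q\<close> are parallel 1-cells
  into some \<open>rep_v T c\<close> that transport \<open>rep_rho T c\<close> alike.\<close>

definition Rep_cell :: "'o \<Rightarrow> ('a, 'c) marr \<Rightarrow> ('a, 'c) marr \<Rightarrow> ('a, 'c) mcell" where
  "Rep_cell B p q = (THE x. \<guillemotleft>x : p \<Rightarrow>\<^bsub>Map_cat M B\<^esub> q\<guillemotright>)"

text \<open>The object part of \<open>\<Phi> w c\<close>. The universal property provides the 1-cell
  only up to isomorphism, hence \<open>SOME\<close>.\<close>

definition Rep_adjunct :: "'o \<Rightarrow> ('a, 'c) rep_choice \<Rightarrow> ('a, 'c) lmap \<Rightarrow> ('a, 'c) comonad \<Rightarrow> ('a, 'c) comonad_mor \<Rightarrow> ('a, 'c) marr" where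
  "Rep_adjunct B T w c g = (SOME p. p \<in> Map_arrs M B \<and> msrc p = w \<and> mtrg p = rep_v T c \<and>
    transport c p (rep_rho T c) = coaction_of_mor w (ccell g))"

text \<open>The object part of the quasi-inverse of \<open>\<Phi> w c\<close>. It involves no
  further choice, since a coaction determines its comonad morphism.\<close>

definition Rep_transpose :: "('a, 'c) rep_choice \<Rightarrow> ('a, 'c) comonad \<Rightarrow> ('a, 'c) marr \<Rightarrow> ('a, 'c) comonad_mor" where
  "Rep_transpose T c p =
    ComonadMor (L_obj M (msrc p)) (mor_of_coaction c (msrc p) (transport c p (rep_rho T c))) c"

context
  fixes B T
  assumes T: "is_rep_choice M B T"
begin

lemma
  assumes "is_comonad M B c"
  shows rep_TK: "is_TK_object M B c (Src M (arr (rep_v T c))) (rep_v T c) (rep_rho T c)"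
    and rep_map: "is_map M (rep_v T c) (Src M (arr (rep_v T c))) B"
    and rep_coaction: "coaction_on B c (rep_v T c) (rep_rho T c)"
proof -
  show *: "is_TK_object M B c (Src M (arr (rep_v T c))) (rep_v T c) (rep_rho T c)"
    using T assms unfolding is_rep_choice_def by blast
  show "is_map M (rep_v T c) (Src M (arr (rep_v T c))) B"
    "coaction_on B c (rep_v T c) (rep_rho T c)"
    using * unfolding is_TK_object_def by blast+
qed

lemmas rep_cell_unique = TK_cell_unique[OF rep_TK]

lemma Rep_cell_in:
  assumes "is_comonad M B c" "p \<in> Map_arrs M B" "q \<in> Map_arrs M B"
    "msrc p = msrc q" "mtrg p = rep_v T c" "mtrg q = rep_v T c" "transport c p (rep_rho T c) = transport c q (rep_rho T c)"
  shows "\<guillemotleft>Rep_cell B p q : p \<Rightarrow>\<^bsub>Map_cat M B\<^esub> q\<guillemotright>"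
  unfolding Rep_cell_def
  by (rule theI', rule ex_ex1I) (use TK_cell_exists[OF rep_TK] rep_cell_unique assms in blast)+

text \<open>The ends of \<open>x\<close> transport \<open>rep_rho T c\<close> alike, which yields a
  2-cell back; both composites are identities by uniqueness. The explicit inverse serves the
  hom-categories, the second conclusion the constraints.\<close>

lemma rep_cell_invertible:
  assumes "\<guillemotleft>x : p \<Rightarrow>\<^bsub>Map_cat M B\<^esub> q\<guillemotright>" "is_comonad M B c" "mtrg p = rep_v T c"
  shows "\<exists>y. \<guillemotleft>y : q \<Rightarrow>\<^bsub>Map_cat M B\<^esub> p\<guillemotright> \<and> y \<bullet>\<^bsub>Map_cat M B\<^esub> x = Id2 (Map_cat M B) p \<and> x \<bullet>\<^bsub>Map_cat M B\<^esub> y = Id2 (Map_cat M B) q"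
    and "invertible2 (Map_cat M B) x"
proof -
  note pq = Map_cell_in_arrs[OF assms(1)]
  have "transport c q (rep_rho T c) = transport c p (rep_rho T c)"
    using transport_cell[of x B c "rep_rho T c"] assms rep_coaction[OF assms(2)] by (simp add: Map_cell_in_iff)
  then have y: "\<guillemotleft>Rep_cell B q p : q \<Rightarrow>\<^bsub>Map_cat M B\<^esub> p\<guillemotright>" (is "\<guillemotleft>?y : q \<Rightarrow>\<^bsub>Map_cat M B\<^esub> p\<guillemotright>")
    using pq assms by (intro Rep_cell_in) simp_all
  have *: "?y \<bullet>\<^bsub>Map_cat M B\<^esub> x = Id2 (Map_cat M B) p"
    by (rule rep_cell_unique[OF assms(2) Map_vcomp_in[OF assms(1) y] Map_id_in[OF pq(1)] assms(3)])
  have **: "x \<bullet>\<^bsub>Map_cat M B\<^esub> ?y = Id2 (Map_cat M B) q"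
    by (rule rep_cell_unique[OF assms(2) Map_vcomp_in[OF y assms(1)] Map_id_in[OF pq(2)]]) (use assms(3) pq in simp)
  show "\<exists>y. \<guillemotleft>y : q \<Rightarrow>\<^bsub>Map_cat M B\<^esub> p\<guillemotright> \<and> y \<bullet>\<^bsub>Map_cat M B\<^esub> x = Id2 (Map_cat M B) p \<and> x \<bullet>\<^bsub>Map_cat M B\<^esub> y = Id2 (Map_cat M B) q"
    using y * ** by blast
  then show "invertible2 (Map_cat M B) x"
    using assms(1) unfolding invertible2_def inverse2_def by (auto simp: cell_in_def)
qed

lemma Rep_arr_sel [simp]:
  "msrc (Rep_arr T k) = rep_v T (cdom k)" "mtrg (Rep_arr T k) = rep_v T (ccod k)"
  "mmap (Rep_arr T k) = rep_f T k" "miso (Rep_arr T k) = rep_lam T k"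
  by (simp_all add: Rep_arr_def)

lemma
  assumes "k \<in> Comon_arrs M B"
  shows Rep_arr_arrs: "Rep_arr T k \<in> Map_arrs M B"
    and transport_Rep_arr: "transport (ccod k) (Rep_arr T k) (rep_rho T (ccod k)) =
      push (arr (rep_v T (cdom k))) (ccell k) (rep_rho T (cdom k))"
proof -
  have k: "ComonadMor (cdom k) (ccell k) (ccod k) \<in> Comon_arrs M B"
    using assms by simp
  note c = comonad_morD(1,2)[OF k]
  have f: "is_map M (rep_f T k) (Src M (arr (rep_v T (cdom k)))) (Src M (arr (rep_v T (ccod k))))"
    "coaction_iso M (ccod k) (arr (rep_v T (ccod k)) \<odot> arr (rep_f T k)) (rep_rho T (ccod k) \<lhd> arr (rep_f T k))
      (arr (rep_v T (cdom k))) (push (arr (rep_v T (cdom k))) (ccell k) (rep_rho T (cdom k))) (rep_lam T k)"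
    using T k unfolding is_rep_choice_def Let_def push_def by (metis comonad_mor.collapse)+
  show p: "Rep_arr T k \<in> Map_arrs M B"
    using rep_map[OF c(1)] rep_map[OF c(2)] f by (auto simp: Map_arrs_iff coaction_iso_def coaction_mor_def invertible2_def)
  show "transport (ccod k) (Rep_arr T k) (rep_rho T (ccod k)) =
      push (arr (rep_v T (cdom k))) (ccell k) (rep_rho T (cdom k))"
    by (rule transport_unique[OF p c(2)])
      (use rep_coaction[OF c(2)] push_coaction[OF rep_coaction[OF c(1)] k] f(2) in \<open>simp_all add: coaction_iso_def\<close>)
qed

text \<open>\<open>Rep_arr T k\<close> transports \<open>rep_rho\<close> to a push along
  \<open>k\<close>, and pushing commutes with transport along \<open>p\<close>. Postcomposition with
  \<open>Rep_arr T k\<close> is therefore change of comonad on the represented coactions.\<close>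

lemma transport_Rep_comp:
  assumes "k \<in> Comon_arrs M B" "p \<in> Map_arrs M B" "mtrg p = rep_v T (cdom k)"
  shows "transport (ccod k) (Map_comp1 M (Rep_arr T k) p) (rep_rho T (ccod k)) =
    push (arr (msrc p)) (ccell k) (transport (cdom k) p (rep_rho T (cdom k)))"
proof -
  have k: "ComonadMor (cdom k) (ccell k) (ccod k) \<in> Comon_arrs M B"
    using assms(1) by simp
  note c = comonad_morD(1,2)[OF k]
  show ?thesis
    using transport_comp[OF assms(2) Rep_arr_arrs[OF assms(1)] _ c(2), of "rep_rho T (ccod k)"]
      transport_push[OF assms(2) k, of "rep_rho T (cdom k)"] rep_coaction[OF c(1)] rep_coaction[OF c(2)]
    by (simp add: assms(3) transport_Rep_arr[OF assms(1)])
qed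

subsection \<open>The pseudofunctor \<open>Rep\<close> and the biadjunction\<close>

lemma Rep_fun_sel [simp]:
  "F0 (Rep_fun M B T) = rep_v T" "F1 (Rep_fun M B T) = Rep_arr T"
  "F2 (Rep_fun M B T) k = Id2 (Map_cat M B) (Rep_arr T k)"
  "PUnit (Rep_fun M B T) c = Rep_cell B (Map_id1 M (rep_v T c)) (Rep_arr T (Id1 (Comon_cat M B) c))"
  "PComp (Rep_fun M B T) l k = Rep_cell B (Map_comp1 M (Rep_arr T l) (Rep_arr T k)) (Rep_arr T (Comon_comp M l k))"
  by (simp_all add: Rep_fun_def Rep_cell_def)

lemma Rep_unit_in:
  assumes "is_comonad M B c"
  shows "\<guillemotleft>PUnit (Rep_fun M B T) c : Map_id1 M (rep_v T c) \<Rightarrow>\<^bsub>Map_cat M B\<^esub> Rep_arr T (Id1 (Comon_cat M B) c)\<guillemotright>"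
  using Rep_cell_in[OF assms Map_id1_arrs[OF rep_map[OF assms]] Rep_arr_arrs[OF Comon_id_arrs[OF assms]]]
    transport_id[OF rep_map[OF assms] assms rep_coaction[OF assms]]
    transport_Rep_arr[OF Comon_id_arrs[OF assms]] push_id[OF rep_coaction[OF assms] assms]
  by simp

text \<open>Both 1-cells transport \<open>rep_rho T (ccod l)\<close> to the push of
  \<open>rep_rho T (cdom k)\<close> along the composite; the source of the cell does so in two
  stages.\<close>

lemma Rep_comp_in:
  assumes "k \<in> Comon_arrs M B" "l \<in> Comon_arrs M B" "cdom l = ccod k"
  shows "\<guillemotleft>PComp (Rep_fun M B T) l k : Map_comp1 M (Rep_arr T l) (Rep_arr T k) \<Rightarrow>\<^bsub>Map_cat M B\<^esub> Rep_arr T (Comon_comp M l k)\<guillemotright>"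
proof -
  note lk = Comon_comp_arrs[OF assms]
  have c: "is_comonad M B (cdom k)" "is_comonad M B (ccod l)"
    using assms(1,2) by (simp_all add: Comon_arrs_iff)
  have a: "Map_comp1 M (Rep_arr T l) (Rep_arr T k) \<in> Map_arrs M B"
    using assms by (intro Map_comp1_arrs Rep_arr_arrs) simp_all
  have "push (arr (rep_v T (cdom k))) (ccell l \<bullet> ccell k) (rep_rho T (cdom k)) =
    push (arr (rep_v T (cdom k))) (ccell l) (push (arr (rep_v T (cdom k))) (ccell k) (rep_rho T (cdom k)))"
    by (rule push_comp[OF rep_coaction[OF c(1)], where c' = "ccod k" and c'' = "ccod l"])
      (use assms in \<open>simp, metis comonad_mor.collapse\<close>)
  then show ?thesis
    using Rep_cell_in[OF c(2) a Rep_arr_arrs[OF lk]] assms(3) transport_Rep_arr[OF lk]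
      transport_Rep_comp[OF assms(2) Rep_arr_arrs[OF assms(1)]] transport_Rep_arr[OF assms(1)]
    by simp
qed

text \<open>Every law equates two 2-cells into some \<open>rep_v T c\<close>, so it is enough to
  type both sides. What remains to be computed are the strict associativity and unit laws that give
  the sides the same boundary.\<close>

lemma Rep_pseudofunctor: "pseudofunctor (Comon_cat M B) (Map_cat M B) (Rep_fun M B T)"
proof -
  interpret C: two_category "Map_cat M B" by (rule Map_two_category)
  interpret D: two_category "Comon_cat M B" by (rule Comon_two_category)
  have cm: "is_comonad M B (cdom k)" "is_comonad M B (ccod k)" if "k \<in> Comon_arrs M B" for k
    using that by (simp_all add: Comon_arrs_iff)
  show ?thesis
  proof (unfold_locales, goal_cases)
    case (1 A)
    then show ?case using rep_map by auto
  next
    case (2 f A A')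
    then show ?case using Rep_arr_arrs by (simp add: arr_in_def)
  next
    case (3 x f g)
    then show ?case using Map_id_in[OF Rep_arr_arrs[of f]] by (auto simp: cell_in_def)
  next
    case (4 f)
    then show ?case by simp
  next
    case (5 x f g y h)
    \<comment> \<open>A 2-cell of \<open>Comon_cat\<close> is its own domain and codomain, so all
      the 1-cells here coincide.\<close>
    then have x: "x = f" "y = f" "f \<in> Comon_arrs M B"
      by (auto simp: cell_in_def)
    note i = Map_id_in[OF Rep_arr_arrs[OF x(3)]]
    show ?case
      using rep_cell_unique[OF cm(2)[OF x(3)] i Map_vcomp_in[OF i i]] x by simp
  next
    case (6 c)
    then show ?case using Rep_unit_in by simp
  next
    case (7 c)
    then have c: "is_comonad M B c" by simp
    show ?case by (rule rep_cell_invertible(2)[OF Rep_unit_in[OF c] c]) simp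
  next
    case (8 f A A' g A'')
    then show ?case using Rep_comp_in[of f g] by (simp add: arr_in_def)
  next
    case (9 f A A' g A'')
    then have fg: "f \<in> Comon_arrs M B" "g \<in> Comon_arrs M B" "cdom g = ccod f"
      by (simp_all add: arr_in_def)
    show ?case by (rule rep_cell_invertible(2)[OF Rep_comp_in[OF fg] cm(2)[OF fg(2)]]) simp
  next
    case (10 f A A' g A'' x f' y g')
    then have fg: "f \<in> Comon_arrs M B" "g \<in> Comon_arrs M B" "cdom g = ccod f" and xy: "x = f" "f' = f" "y = g" "g' = g"
      by (auto simp: typing)
    note fi = Map_id_in[OF Rep_arr_arrs[OF fg(1)]] and gi = Map_id_in[OF Rep_arr_arrs[OF fg(2)]]
    have h: "\<guillemotleft>Id2 (Map_cat M B) (Rep_arr T g) \<star>\<^bsub>Map_cat M B\<^esub> Id2 (Map_cat M B) (Rep_arr T f) :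
      Map_comp1 M (Rep_arr T g) (Rep_arr T f) \<Rightarrow>\<^bsub>Map_cat M B\<^esub> Map_comp1 M (Rep_arr T g) (Rep_arr T f)\<guillemotright>"
      by (rule Map_hcomp_in[OF fi gi]) (simp add: fg)
    have "PComp (Rep_fun M B T) g f \<bullet>\<^bsub>Map_cat M B\<^esub>
        (Id2 (Map_cat M B) (Rep_arr T g) \<star>\<^bsub>Map_cat M B\<^esub> Id2 (Map_cat M B) (Rep_arr T f)) =
      Id2 (Map_cat M B) (Rep_arr T (Comon_comp M g f)) \<bullet>\<^bsub>Map_cat M B\<^esub> PComp (Rep_fun M B T) g f"
      by (rule rep_cell_unique[OF cm(2)[OF fg(2)] Map_vcomp_in[OF h Rep_comp_in[OF fg]]
        Map_vcomp_in[OF Rep_comp_in[OF fg] Map_id_in[OF Rep_arr_arrs[OF Comon_comp_arrs[OF fg]]]]]) simp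
    then show ?case by (simp add: xy)
  next
    case (11 f A A' g A'' h A''')
    then have fg: "f \<in> Comon_arrs M B" "g \<in> Comon_arrs M B" "cdom g = ccod f"
      and h: "h \<in> Comon_arrs M B" "cdom h = ccod g"
      by (simp_all add: arr_in_def)
    note fi = Map_id_in[OF Rep_arr_arrs[OF fg(1)]] and hi = Map_id_in[OF Rep_arr_arrs[OF h(1)]]
    have 1: "\<guillemotleft>PComp (Rep_fun M B T) h g \<star>\<^bsub>Map_cat M B\<^esub> Id2 (Map_cat M B) (Rep_arr T f) :
      Map_comp1 M (Map_comp1 M (Rep_arr T h) (Rep_arr T g)) (Rep_arr T f) \<Rightarrow>\<^bsub>Map_cat M B\<^esub> Map_comp1 M (Rep_arr T (Comon_comp M h g)) (Rep_arr T f)\<guillemotright>"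
      by (rule Map_hcomp_in[OF fi Rep_comp_in[OF fg(2) h]]) (simp add: fg)
    have 2: "\<guillemotleft>Id2 (Map_cat M B) (Rep_arr T h) \<star>\<^bsub>Map_cat M B\<^esub> PComp (Rep_fun M B T) g f :
      Map_comp1 M (Rep_arr T h) (Map_comp1 M (Rep_arr T g) (Rep_arr T f)) \<Rightarrow>\<^bsub>Map_cat M B\<^esub> Map_comp1 M (Rep_arr T h) (Rep_arr T (Comon_comp M g f))\<guillemotright>"
      by (rule Map_hcomp_in[OF Rep_comp_in[OF fg] hi]) (simp add: h)
    have e: "Map_comp1 M (Map_comp1 M (Rep_arr T h) (Rep_arr T g)) (Rep_arr T f) = Map_comp1 M (Rep_arr T h) (Map_comp1 M (Rep_arr T g) (Rep_arr T f))"
      "Comon_comp M (Comon_comp M h g) f = Comon_comp M h (Comon_comp M g f)"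
      using Map_comp1_assoc[OF Rep_arr_arrs[OF fg(1)] Rep_arr_arrs[OF fg(2)] Rep_arr_arrs[OF h(1)]]
        Comon_comp_assoc[OF fg(1,2) h(1) fg(3) h(2)] fg h by simp_all
    have 3: "\<guillemotleft>PComp (Rep_fun M B T) (Comon_comp M h g) f : Map_comp1 M (Rep_arr T (Comon_comp M h g)) (Rep_arr T f) \<Rightarrow>\<^bsub>Map_cat M B\<^esub> Rep_arr T (Comon_comp M (Comon_comp M h g) f)\<guillemotright>"
      by (rule Rep_comp_in[OF fg(1) Comon_comp_arrs[OF fg(2) h]]) (simp add: fg)
    have 4: "\<guillemotleft>PComp (Rep_fun M B T) h (Comon_comp M g f) : Map_comp1 M (Rep_arr T h) (Rep_arr T (Comon_comp M g f)) \<Rightarrow>\<^bsub>Map_cat M B\<^esub> Rep_arr T (Comon_comp M h (Comon_comp M g f))\<guillemotright>"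
      by (rule Rep_comp_in[OF Comon_comp_arrs[OF fg] h(1)]) (simp add: h)
    have "PComp (Rep_fun M B T) (Comon_comp M h g) f \<bullet>\<^bsub>Map_cat M B\<^esub> (PComp (Rep_fun M B T) h g \<star>\<^bsub>Map_cat M B\<^esub> Id2 (Map_cat M B) (Rep_arr T f))
      = PComp (Rep_fun M B T) h (Comon_comp M g f) \<bullet>\<^bsub>Map_cat M B\<^esub> (Id2 (Map_cat M B) (Rep_arr T h) \<star>\<^bsub>Map_cat M B\<^esub> PComp (Rep_fun M B T) g f)"
      by (rule rep_cell_unique[OF cm(2)[OF h(1)] Map_vcomp_in[OF 1 3, unfolded e] Map_vcomp_in[OF 2 4]]) simp
    then show ?case by simp
  next
    case (12 f A A')
    then have f: "f \<in> Comon_arrs M B" and A: "A' = ccod f"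
      by (simp_all add: arr_in_def)
    note i = Map_id_in[OF Rep_arr_arrs[OF f]]
    note c = cm(2)[OF f]
    have 1: "\<guillemotleft>PUnit (Rep_fun M B T) (ccod f) \<star>\<^bsub>Map_cat M B\<^esub> Id2 (Map_cat M B) (Rep_arr T f) :
      Map_comp1 M (Map_id1 M (rep_v T (ccod f))) (Rep_arr T f) \<Rightarrow>\<^bsub>Map_cat M B\<^esub> Map_comp1 M (Rep_arr T (Id1 (Comon_cat M B) (ccod f))) (Rep_arr T f)\<guillemotright>"
      by (rule Map_hcomp_in[OF i Rep_unit_in[OF c]]) simp
    have 2: "\<guillemotleft>PComp (Rep_fun M B T) (Id1 (Comon_cat M B) (ccod f)) f :
       Map_comp1 M (Rep_arr T (Id1 (Comon_cat M B) (ccod f))) (Rep_arr T f) \<Rightarrow>\<^bsub>Map_cat M B\<^esub> Rep_arr T (Comon_comp M (Id1 (Comon_cat M B) (ccod f)) f)\<guillemotright>"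
      using Rep_comp_in[OF f Comon_id_arrs[OF c]] by simp
    have e: "Map_comp1 M (Map_id1 M (rep_v T (ccod f))) (Rep_arr T f) = Rep_arr T f"
      "Comon_comp M (Id1 (Comon_cat M B) (ccod f)) f = f"
      using Map_comp1_id(1)[OF Rep_arr_arrs[OF f]] Comon_comp_id(1)[OF f] by simp_all
    have "PComp (Rep_fun M B T) (Id1 (Comon_cat M B) (ccod f)) f \<bullet>\<^bsub>Map_cat M B\<^esub> (PUnit (Rep_fun M B T) (ccod f) \<star>\<^bsub>Map_cat M B\<^esub> Id2 (Map_cat M B) (Rep_arr T f))
      = Id2 (Map_cat M B) (Rep_arr T f)"
      by (rule rep_cell_unique[OF c Map_vcomp_in[OF 1 2, unfolded e] i]) simp
    then show ?case unfolding A Rep_fun_sel(2) .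
  next
    case (13 f A A')
    then have f: "f \<in> Comon_arrs M B" and A: "A = cdom f"
      by (simp_all add: arr_in_def)
    note i = Map_id_in[OF Rep_arr_arrs[OF f]]
    note c = cm(1)[OF f]
    have 1: "\<guillemotleft>Id2 (Map_cat M B) (Rep_arr T f) \<star>\<^bsub>Map_cat M B\<^esub> PUnit (Rep_fun M B T) (cdom f) :
      Map_comp1 M (Rep_arr T f) (Map_id1 M (rep_v T (cdom f))) \<Rightarrow>\<^bsub>Map_cat M B\<^esub> Map_comp1 M (Rep_arr T f) (Rep_arr T (Id1 (Comon_cat M B) (cdom f)))\<guillemotright>"
      by (rule Map_hcomp_in[OF Rep_unit_in[OF c] i]) simp
    have 2: "\<guillemotleft>PComp (Rep_fun M B T) f (Id1 (Comon_cat M B) (cdom f)) :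
       Map_comp1 M (Rep_arr T f) (Rep_arr T (Id1 (Comon_cat M B) (cdom f))) \<Rightarrow>\<^bsub>Map_cat M B\<^esub> Rep_arr T (Comon_comp M f (Id1 (Comon_cat M B) (cdom f)))\<guillemotright>"
      using Rep_comp_in[OF Comon_id_arrs[OF c] f] by simp
    have e: "Map_comp1 M (Rep_arr T f) (Map_id1 M (rep_v T (cdom f))) = Rep_arr T f"
      "Comon_comp M f (Id1 (Comon_cat M B) (cdom f)) = f"
      using Map_comp1_id(2)[OF Rep_arr_arrs[OF f]] Comon_comp_id(2)[OF f] by simp_all
    have "PComp (Rep_fun M B T) f (Id1 (Comon_cat M B) (cdom f)) \<bullet>\<^bsub>Map_cat M B\<^esub> (Id2 (Map_cat M B) (Rep_arr T f) \<star>\<^bsub>Map_cat M B\<^esub> PUnit (Rep_fun M B T) (cdom f))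
      = Id2 (Map_cat M B) (Rep_arr T f)"
      by (rule rep_cell_unique[OF cm(2)[OF f] Map_vcomp_in[OF 1 2, unfolded e] i]) simp
    then show ?case unfolding A Rep_fun_sel(2) .
  qed
qed

section \<open>Equivalences of hom-categories\<close>

lemma
  assumes "is_map M w A B" "g \<in> Comon_arrs M B" "cdom g = L_obj M w" "ccod g = c"
  shows Rep_adjunct_arrs: "Rep_adjunct B T w c g \<in> Map_arrs M B"
    and Rep_adjunct_msrc: "msrc (Rep_adjunct B T w c g) = w"
    and Rep_adjunct_mtrg: "mtrg (Rep_adjunct B T w c g) = rep_v T c"
    and transport_Rep_adjunct: "transport c (Rep_adjunct B T w c g) (rep_rho T c) = coaction_of_mor w (ccell g)"
proof -
  have g: "ComonadMor (L_obj M w) (ccell g) c \<in> Comon_arrs M B"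
    using assms(2-4) by (metis comonad_mor.collapse)
  have c: "is_comonad M B c"
    by (rule comonad_morD(2)[OF g])
  have "coaction_on B c w (coaction_of_mor w (ccell g))"
    using coaction_of_mor_coaction[OF assms(1) g] mapD(2)[OF assms(1)] by simp
  from TK_arr_exists[OF rep_TK[OF c] c assms(1) this]
  have "\<exists>p. p \<in> Map_arrs M B \<and> msrc p = w \<and> mtrg p = rep_v T c \<and>
    transport c p (rep_rho T c) = coaction_of_mor w (ccell g)"
    by blast
  from someI_ex[OF this]
  show "Rep_adjunct B T w c g \<in> Map_arrs M B" "msrc (Rep_adjunct B T w c g) = w"
    "mtrg (Rep_adjunct B T w c g) = rep_v T c"
    "transport c (Rep_adjunct B T w c g) (rep_rho T c) = coaction_of_mor w (ccell g)"
    by (simp_all add: Rep_adjunct_def)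
qed

lemma
  assumes "p \<in> Map_arrs M B" "is_comonad M B c" "mtrg p = rep_v T c"
  shows Rep_transpose_arrs: "Rep_transpose T c p \<in> Comon_arrs M B"
    and coaction_of_Rep_transpose: "coaction_of_mor (msrc p) (ccell (Rep_transpose T c p)) = transport c p (rep_rho T c)"
proof -
  have r: "coaction_on B c (mtrg p) (rep_rho T c)"
    using rep_coaction[OF assms(2)] assms(3) by simp
  note t = transport_coaction[OF assms(1,2) r]
  show "Rep_transpose T c p \<in> Comon_arrs M B"
    unfolding Rep_transpose_def by (rule mor_of_coaction_mor[OF Map_arrsD(1)[OF assms(1)] t assms(2)])
  have "\<guillemotleft>transport c p (rep_rho T c) : arr (msrc p) \<Rightarrow> cfun c \<odot> arr (msrc p)\<guillemotright>"
    using t by (simp add: is_coaction_def)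
  from coaction_of_mor_of_coaction[OF Map_arrsD(1)[OF assms(1)] this assms(2)]
  show "coaction_of_mor (msrc p) (ccell (Rep_transpose T c p)) = transport c p (rep_rho T c)"
    by (simp add: Rep_transpose_def)
qed

text \<open>Both sides are morphisms out of \<open>L(w)\<close> with the same coaction. Because they
  are equal on the nose, the unit of the equivalence consists of identities, and only its counit has
  to be constructed.\<close>

lemma Rep_transpose_adjunct:
  assumes "is_map M w A B" "g \<in> Comon_arrs M B" "cdom g = L_obj M w" "ccod g = c"
  shows "Rep_transpose T c (Rep_adjunct B T w c g) = g"
proof -
  note a = Rep_adjunct_arrs[OF assms] Rep_adjunct_msrc[OF assms] Rep_adjunct_mtrg[OF assms]
  have c: "is_comonad M B c"
    using assms(2,4) by (simp add: Comon_arrs_iff)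
  show ?thesis
  proof (rule Comon_arrs_eqI[OF assms(1) Rep_transpose_arrs[OF a(1) c a(3)] assms(2)])
    show "coaction_of_mor w (ccell (Rep_transpose T c (Rep_adjunct B T w c g))) = coaction_of_mor w (ccell g)"
      using coaction_of_Rep_transpose[OF a(1) c a(3)] transport_Rep_adjunct[OF assms] by (simp add: a(2))
  qed (use assms a(2) in \<open>simp_all add: Rep_transpose_def\<close>)
qed

lemma Rep_transpose_cell:
  assumes "\<guillemotleft>x : p \<Rightarrow>\<^bsub>Map_cat M B\<^esub> q\<guillemotright>" "is_comonad M B c" "mtrg p = rep_v T c"
  shows "Rep_transpose T c p = Rep_transpose T c q"
  using transport_cell[of x B c "rep_rho T c"] assms rep_coaction[OF assms(2)] Map_cell_in_arrs[OF assms(1)]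
  by (simp add: Map_cell_in_iff Rep_transpose_def)

text \<open>The chosen 1-cell and \<open>p\<close> transport \<open>rep_rho T c\<close> to the same
  coaction. The resulting 2-cell is the counit of the equivalence at \<open>p\<close>.\<close>

lemma Rep_counit_in:
  assumes "p \<in> Map_arrs M B" "is_comonad M B c" "mtrg p = rep_v T c"
  shows "\<guillemotleft>Rep_cell B (Rep_adjunct B T (msrc p) c (Rep_transpose T c p)) p :
    Rep_adjunct B T (msrc p) c (Rep_transpose T c p) \<Rightarrow>\<^bsub>Map_cat M B\<^esub> p\<guillemotright>"
proof -
  have g: "cdom (Rep_transpose T c p) = L_obj M (msrc p)" "ccod (Rep_transpose T c p) = c"
    by (simp_all add: Rep_transpose_def)
  note m = Map_arrsD(1)[OF assms(1)] Rep_transpose_arrs[OF assms] g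
  show ?thesis
    using Rep_adjunct_msrc[OF m] Rep_adjunct_mtrg[OF m] transport_Rep_adjunct[OF m] coaction_of_Rep_transpose[OF assms]
    by (intro Rep_cell_in[OF assms(2) Rep_adjunct_arrs[OF m] assms(1)]) (simp_all add: assms(3))
qed

lemma Rep_equivalence:
  assumes "is_map M w A B" "is_comonad M B c"
  shows "is_equivalence (hom_cat (Comon_cat M B) (L_obj M w) c) (hom_cat (Map_cat M B) w (rep_v T c))
    \<lparr>onO = Rep_adjunct B T w c, onM = \<lambda>g. Id2 (Map_cat M B) (Rep_adjunct B T w c g)\<rparr>"
    (is "is_equivalence ?D ?C ?F")
proof -
  \<comment> \<open>The target is discrete: a 2-cell goes to the comonad morphism shared by its two
    ends, by \<open>Rep_transpose_cell\<close>.\<close>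
  let ?G = "\<lparr>onO = Rep_transpose T c, onM = \<lambda>x. Rep_transpose T c (mdom x)\<rparr>"
  interpret C: two_category "Map_cat M B" by (rule Map_two_category)
  interpret HC: category ?C by (rule Map_hom_category)
  interpret HD: category ?D
    using L_obj_comonad[OF assms(1)] assms(2) by (intro two_category.hom_category[OF Comon_two_category]) simp_all
  have F: "is_functor ?D ?C ?F"
    using Rep_adjunct_arrs[OF assms(1)] Rep_adjunct_msrc[OF assms(1)] Rep_adjunct_mtrg[OF assms(1)]
      C.vcomp_id(1)[OF C.id2_cell(1)]
    by unfold_locales (auto simp: hom_cat_sel Map_id2_sel Map_id2_cells Map_cat_sel(10))
  have G: "is_functor ?C ?D ?G"
    using Rep_transpose_arrs[OF _ assms(2)] Rep_transpose_cell[OF _ assms(2)]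
    by unfold_locales (auto simp: hom_cat_sel Map_id2_sel Map_cat_sel(11) Map_cell_in_iff Map_cellsD Rep_transpose_def[where c = c])
  \<comment> \<open>The components are identities, because the identity 2-cell of \<open>g\<close>
    is represented by \<open>g\<close> itself.\<close>
  have "natural_iso ?D ?D id_func (comp_func ?G ?F) (\<lambda>g. g)"
    using Rep_transpose_adjunct[OF assms(1)]
    by (intro natural_iso.intro natural_iso_axioms.intro is_functor_id is_functor_comp[OF G F] HD.category_axioms)
      (auto simp: hom_cat_sel Map_id2_sel cat_iso_def id_func_def comp_func_def)
  moreover have "natural_iso ?C ?C (comp_func ?F ?G) id_func (\<lambda>p. Rep_cell B (Rep_adjunct B T w c (Rep_transpose T c p)) p)"
  proof (intro natural_iso.intro natural_iso_axioms.intro is_functor_id is_functor_comp[OF F G] HC.category_axioms, goal_cases)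
    case (1 p)
    then have p: "p \<in> Map_arrs M B" "msrc p = w" "mtrg p = rep_v T c"
      by (simp_all add: hom_cat_sel)
    note r = Rep_counit_in[OF p(1) assms(2) p(3), unfolded p(2)]
    note a = Map_cell_in_arrs[OF r]
    obtain y where "\<guillemotleft>y : p \<Rightarrow>\<^bsub>Map_cat M B\<^esub> Rep_adjunct B T w c (Rep_transpose T c p)\<guillemotright>"
      "y \<bullet>\<^bsub>Map_cat M B\<^esub> Rep_cell B (Rep_adjunct B T w c (Rep_transpose T c p)) p = Id2 (Map_cat M B) (Rep_adjunct B T w c (Rep_transpose T c p))"
      "Rep_cell B (Rep_adjunct B T w c (Rep_transpose T c p)) p \<bullet>\<^bsub>Map_cat M B\<^esub> y = Id2 (Map_cat M B) p"
      using rep_cell_invertible(1)[OF r assms(2)] a(4) p(3) by auto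
    with r a p show ?case by (auto simp: cat_iso_def hom_cat_sel Map_cell_in_iff)
  next
    case (2 p)
    then show ?case
      using Rep_counit_in[of p c] assms(2) by (auto simp: hom_cat_sel comp_func_def Map_cell_in_iff)
  next
    case (3 p)
    then show ?case
      using Rep_counit_in[of p c] assms(2) by (auto simp: hom_cat_sel id_func_def Map_cell_in_iff)
  next
    case (4 x)
    then have x: "\<guillemotleft>x : mdom x \<Rightarrow>\<^bsub>Map_cat M B\<^esub> mcod x\<guillemotright>" and w: "msrc (mdom x) = w" "mtrg (mdom x) = rep_v T c"
      by (simp_all add: hom_cat_sel Map_cell_in_iff)
    note a = Map_cell_in_arrs[OF x] w
    have t: "mtrg (mcod x) = rep_v T c" "msrc (mcod x) = w"
      using a by simp_all
    note r1 = Rep_counit_in[OF a(1) assms(2) w(2), unfolded w(1)]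
      and r2 = Rep_counit_in[OF a(2) assms(2) t(1), unfolded t(2) Rep_transpose_cell[OF x assms(2) w(2), symmetric]]
    \<comment> \<open>The two ends of \<open>x\<close> have the same transpose, so the composite
      functor takes \<open>x\<close> to an identity. Both sides of the naturality square are then
      parallel 2-cells into \<open>rep_v T c\<close>.\<close>
    have "Rep_cell B (Rep_adjunct B T w c (Rep_transpose T c (mdom x))) (mcod x) \<bullet>\<^bsub>Map_cat M B\<^esub>
        Id2 (Map_cat M B) (Rep_adjunct B T w c (Rep_transpose T c (mdom x)))
      = x \<bullet>\<^bsub>Map_cat M B\<^esub> Rep_cell B (Rep_adjunct B T w c (Rep_transpose T c (mdom x))) (mdom x)"
      by (rule rep_cell_unique[OF assms(2) Map_vcomp_in[OF Map_id_in[OF Map_cell_in_arrs(1)[OF r1]] r2] Map_vcomp_in[OF r1 x]])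
        (use Map_cell_in_arrs(4)[OF r1] w in simp)
    then show ?case
      by (simp add: hom_cat_sel comp_func_def id_func_def Rep_transpose_cell[OF x assms(2) w(2)])
  qed
  ultimately show ?thesis
    using F G unfolding is_equivalence_def by blast
qed

text \<open>The constraints of \<open>as_pseudo\<close> are identities, and in
  \<open>Comon_cat\<close> these are 1-cells. So typing the constraints is strict functoriality of
  \<open>L\<close>, and the coherence laws are associativity and unit laws of comonad
  morphisms.\<close>

lemma L_as_pseudo: "pseudofunctor (Map_cat M B) (Comon_cat M B) (as_pseudo (Comon_cat M B) (L_fun M))"
proof -
  interpret L: two_functor "Map_cat M B" "Comon_cat M B" "L_fun M" by (rule L_two_functor)
  have id: "L_arr M (Map_id1 M w) = ComonadMor (L_obj M w) (Id2 M (arr w \<odot> radj w)) (L_obj M w)"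
    "ComonadMor (L_obj M w) (Id2 M (arr w \<odot> radj w)) (L_obj M w) \<in> Comon_arrs M B" if "is_map M w A B" for w A
    using L_arr_id[OF that] Comon_id_arrs[OF L_obj_comonad[OF that]] by simp_all
  have comp: "L_arr M (Map_comp1 M q p) = Comon_comp M (L_arr M q) (L_arr M p)"
    "Comon_comp M (L_arr M q) (L_arr M p) \<in> Comon_arrs M B"
    if "p \<in> Map_arrs M B" "q \<in> Map_arrs M B" "msrc q = mtrg p" for p q
    using L_arr_comp[OF that] L_arr_arrs[OF Map_comp1_arrs[OF that]] by simp_all
  show ?thesis
  proof (unfold_locales, goal_cases)
    case (1 A)
    then show ?case using L.obj[of A] by (simp add: as_pseudo_sel)
  next
    case (2 f A A')
    then show ?case using L.arr[of f A A'] by (simp add: as_pseudo_sel)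
  next
    case (3 x f g)
    then show ?case using L.cell[of x f g] by (simp add: as_pseudo_sel)
  next
    case (4 f)
    then show ?case using L.id2[of f] by (simp add: as_pseudo_sel)
  next
    case (5 x f g y h)
    then show ?case using L.vcomp[of x f g y h] by (simp add: as_pseudo_sel)
  next
    case (6 w)
    then show ?case using id by (auto simp: as_pseudo_sel cell_in_def)
  next
    case (7 w)
    then show ?case using id by (auto simp: as_pseudo_sel invertible2_def inverse2_def cell_in_def)
  next
    case (8 f A A' g A'')
    then show ?case using comp[of f g] by (simp add: as_pseudo_sel typing)
  next
    case (9 f A A' g A'')
    then show ?case using comp[of f g] by (auto simp: as_pseudo_sel invertible2_def inverse2_def typing)
  next
    case (10 f A A' g A'' x f' y g')
    then show ?case by (auto simp: as_pseudo_sel typing)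
  next
    case (11 f A A' g A'' h A''')
    then show ?case using comp[of f g] comp[of g h] Comon_comp_assoc[of "L_arr M f" B "L_arr M g" "L_arr M h"]
      L_arr_arrs[of f B] L_arr_arrs[of g B] L_arr_arrs[of h B] L_arr_sel[of f B] L_arr_sel[of g B] L_arr_sel[of h B]
      by (simp add: as_pseudo_sel typing)
  next
    case (12 f A A')
    then show ?case using Comon_comp_id(1)[of "L_arr M f" B] L_arr_arrs[of f B] L_arr_sel[of f B]
      by (auto simp: as_pseudo_sel arr_in_def)
  next
    case (13 f A A')
    then show ?case using Comon_comp_id(2)[of "L_arr M f" B] L_arr_arrs[of f B] L_arr_sel[of f B]
      by (auto simp: as_pseudo_sel arr_in_def)
  qed
qed

section \<open>Pseudonaturality of the equivalences\<close>

definition Rep_nu :: "('a, 'c) marr \<Rightarrow> ('a, 'c) comonad_mor \<Rightarrow> ('a, 'c) comonad_mor \<Rightarrow> ('a, 'c) mcell" where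
  "Rep_nu h k g = Rep_cell B
    (Map_comp1 M (Map_comp1 M (Rep_arr T k) (Rep_adjunct B T (mtrg h) (cdom k) g)) h)
    (Rep_adjunct B T (msrc h) (ccod k) (Comon_comp M (Comon_comp M k g) (L_arr M h)))"

lemma adjunct_L_arrs:
  assumes "h \<in> Map_arrs M B" "k \<in> Comon_arrs M B" "g \<in> Comon_arrs M B" "cdom g = L_obj M (mtrg h)" "ccod g = cdom k"
  shows "Comon_comp M (Comon_comp M k g) (L_arr M h) \<in> Comon_arrs M B"
  using Comon_comp_arrs[OF L_arr_arrs[OF assms(1)] Comon_comp_arrs[OF assms(3,2)]] L_arr_sel[OF assms(1)] assms(4,5)
  by simp

text \<open>The source of the cell transports \<open>rep_rho T (ccod k)\<close> to the coaction of
  \<open>g\<close> pushed along \<open>k\<close> and then transported along \<open>h\<close>. Under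
  the bijection with comonad morphisms, pushing is postcomposition with \<open>k\<close> and
  transport is precomposition with \<open>L_arr M h\<close>, so this is the coaction that the target
  realizes by choice.\<close>

lemma Rep_nu_in:
  assumes "h \<in> Map_arrs M B" "k \<in> Comon_arrs M B" "g \<in> Comon_arrs M B" "cdom g = L_obj M (mtrg h)" "ccod g = cdom k"
  shows "\<guillemotleft>Rep_nu h k g : Map_comp1 M (Map_comp1 M (Rep_arr T k) (Rep_adjunct B T (mtrg h) (cdom k) g)) h \<Rightarrow>\<^bsub>Map_cat M B\<^esub>
    Rep_adjunct B T (msrc h) (ccod k) (Comon_comp M (Comon_comp M k g) (L_arr M h))\<guillemotright>"
proof -
  note hs = Map_arrsD(1)[OF assms(1)] and ht = Map_arrsD(2)[OF assms(1)]
  note g = ht assms(3-5)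
  have kg: "Comon_comp M k g \<in> Comon_arrs M B"
    using Comon_comp_arrs[OF assms(3,2)] assms(5) by simp
  have c: "is_comonad M B (ccod k)"
    using assms(2) by (simp add: Comon_arrs_iff)
  have kgl: "Comon_comp M (Comon_comp M k g) (L_arr M h) \<in> Comon_arrs M B"
    "cdom (Comon_comp M (Comon_comp M k g) (L_arr M h)) = L_obj M (msrc h)"
    "ccod (Comon_comp M (Comon_comp M k g) (L_arr M h)) = ccod k"
    using adjunct_L_arrs[OF assms] L_arr_sel[OF assms(1)] by simp_all
  note a = Rep_adjunct_arrs[OF g] and s = Rep_adjunct_msrc[OF g] and t = Rep_adjunct_mtrg[OF g]
  have ka: "Map_comp1 M (Rep_arr T k) (Rep_adjunct B T (mtrg h) (cdom k) g) \<in> Map_arrs M B"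
    by (rule Map_comp1_arrs[OF a Rep_arr_arrs[OF assms(2)]]) (simp add: t)
  have "transport (ccod k) (Map_comp1 M (Map_comp1 M (Rep_arr T k) (Rep_adjunct B T (mtrg h) (cdom k) g)) h) (rep_rho T (ccod k))
    = transport (ccod k) h (push (arr (mtrg h)) (ccell k) (coaction_of_mor (mtrg h) (ccell g)))"
    using transport_comp[OF assms(1) ka _ c, of "rep_rho T (ccod k)"] rep_coaction[OF c]
      transport_Rep_comp[OF assms(2) a t] transport_Rep_adjunct[OF g]
    by (simp add: s)
  also have "\<dots> = transport (ccod k) h (coaction_of_mor (mtrg h) (ccell k \<bullet> ccell g))"
    using coaction_of_mor_comp[OF ht assms(3,2,4)] assms(5) by simp
  also have "\<dots> = transport (ccod k) (Rep_adjunct B T (msrc h) (ccod k) (Comon_comp M (Comon_comp M k g) (L_arr M h))) (rep_rho T (ccod k))"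
    using coaction_of_mor_L_arr[OF assms(1) kg] transport_Rep_adjunct[OF hs kgl] assms(4) by simp
  finally have e: "transport (ccod k) (Map_comp1 M (Map_comp1 M (Rep_arr T k) (Rep_adjunct B T (mtrg h) (cdom k) g)) h) (rep_rho T (ccod k))
    = transport (ccod k) (Rep_adjunct B T (msrc h) (ccod k) (Comon_comp M (Comon_comp M k g) (L_arr M h))) (rep_rho T (ccod k))" .
  have m: "Map_comp1 M (Map_comp1 M (Rep_arr T k) (Rep_adjunct B T (mtrg h) (cdom k) g)) h \<in> Map_arrs M B"
    by (rule Map_comp1_arrs[OF assms(1) ka]) (simp add: s)
  show ?thesis
    unfolding Rep_nu_def
    by (rule Rep_cell_in[OF c m Rep_adjunct_arrs[OF hs kgl] _ _ _ e])
      (simp_all add: Rep_adjunct_msrc[OF hs kgl] Rep_adjunct_mtrg[OF hs kgl])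
qed

lemma Rep_hom_biadjunction:
  "hom_biadjunction (Map_cat M B) (Comon_cat M B) (as_pseudo (Comon_cat M B) (L_fun M)) (Rep_fun M B T)
    (\<lambda>w c. \<lparr>onO = Rep_adjunct B T w c, onM = \<lambda>g. Id2 (Map_cat M B) (Rep_adjunct B T w c g)\<rparr>) Rep_nu"
proof (intro hom_biadjunction.intro hom_biadjunction_axioms.intro L_as_pseudo Rep_pseudofunctor, goal_cases)
  case (1 w c)
  then show ?case using Rep_equivalence by (auto simp: as_pseudo_sel)
next
  case (2 h w' w k c c' g)
  then show ?case using Rep_nu_in[of h k g] by (simp add: as_pseudo_sel arr_in_def)
next
  case (3 h w' w k c c' g)
  then have h: "h \<in> Map_arrs M B" "k \<in> Comon_arrs M B" "g \<in> Comon_arrs M B" "cdom g = L_obj M (mtrg h)" "ccod g = cdom k"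
    by (simp_all add: as_pseudo_sel arr_in_def)
  have "is_comonad M B (ccod k)"
    using h(2) by (simp add: Comon_arrs_iff)
  then show ?case
    by (rule rep_cell_invertible(2)[OF Rep_nu_in[OF h]]) simp
next
  case (4 h w' w k c c' g x h2 \<kappa> k2 \<theta> g2)
  then have h: "h \<in> Map_arrs M B" "k \<in> Comon_arrs M B" "g \<in> Comon_arrs M B" "cdom g = L_obj M (mtrg h)" "ccod g = cdom k"
    and e: "\<kappa> = k" "k2 = k" "\<theta> = g" "g2 = g" "w = mtrg h" "w' = msrc h" "c = cdom k" "c' = ccod k"
    and x: "\<guillemotleft>x : h \<Rightarrow>\<^bsub>Map_cat M B\<^esub> h2\<guillemotright>"
    by (auto simp: as_pseudo_sel arr_in_def Map_cell_in_iff cell_in_def[of "Comon_cat M B"])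
  note hs = Map_arrsD(1)[OF h(1)] and g = Map_arrsD(2)[OF h(1)] h(3-5)
  have h2: "h2 \<in> Map_arrs M B" "msrc h2 = msrc h" "mtrg h2 = mtrg h"
    using Map_cell_in_arrs[OF x] by simp_all
  \<comment> \<open>\<open>\<Phi>\<close> produces only identity 2-cells, so naturality in
    \<open>h\<close> requires that the structure cells at \<open>h\<close> and \<open>h2\<close> end
    at the same 1-cell.\<close>
  have Lh: "L_arr M h2 = L_arr M h"
    using L_arr_cell[of x B] x by (simp add: Map_cell_in_iff)
  have c: "is_comonad M B (ccod k)"
    using h(2) by (simp add: Comon_arrs_iff)
  have kgl: "Comon_comp M (Comon_comp M k g) (L_arr M h) \<in> Comon_arrs M B"
    "cdom (Comon_comp M (Comon_comp M k g) (L_arr M h)) = L_obj M (msrc h)"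
    "ccod (Comon_comp M (Comon_comp M k g) (L_arr M h)) = ccod k"
    using adjunct_L_arrs[OF h] L_arr_sel[OF h(1)] by simp_all
  let ?a = "Rep_adjunct B T (mtrg h) (cdom k) g"
  have 1: "\<guillemotleft>Id2 (Map_cat M B) (Rep_arr T k) \<star>\<^bsub>Map_cat M B\<^esub> Id2 (Map_cat M B) ?a :
    Map_comp1 M (Rep_arr T k) ?a \<Rightarrow>\<^bsub>Map_cat M B\<^esub> Map_comp1 M (Rep_arr T k) ?a\<guillemotright>"
    by (rule Map_hcomp_in[OF Map_id_in[OF Rep_adjunct_arrs[OF g]] Map_id_in[OF Rep_arr_arrs[OF h(2)]]])
      (simp add: Rep_adjunct_mtrg[OF g])
  have 2: "\<guillemotleft>(Id2 (Map_cat M B) (Rep_arr T k) \<star>\<^bsub>Map_cat M B\<^esub> Id2 (Map_cat M B) ?a) \<star>\<^bsub>Map_cat M B\<^esub> x :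
    Map_comp1 M (Map_comp1 M (Rep_arr T k) ?a) h \<Rightarrow>\<^bsub>Map_cat M B\<^esub> Map_comp1 M (Map_comp1 M (Rep_arr T k) ?a) h2\<guillemotright>"
    by (rule Map_hcomp_in[OF x 1]) (simp add: Rep_adjunct_msrc[OF g])
  have 3: "\<guillemotleft>Rep_nu h2 k g : Map_comp1 M (Map_comp1 M (Rep_arr T k) ?a) h2 \<Rightarrow>\<^bsub>Map_cat M B\<^esub>
    Rep_adjunct B T (msrc h) (ccod k) (Comon_comp M (Comon_comp M k g) (L_arr M h))\<guillemotright>"
    using Rep_nu_in[OF h2(1) h(2,3)] h(4,5) h2 by (simp add: Lh)
  have "Rep_nu h2 k g \<bullet>\<^bsub>Map_cat M B\<^esub> ((Id2 (Map_cat M B) (Rep_arr T k) \<star>\<^bsub>Map_cat M B\<^esub> Id2 (Map_cat M B) ?a) \<star>\<^bsub>Map_cat M B\<^esub> x)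
    = Id2 (Map_cat M B) (Rep_adjunct B T (msrc h) (ccod k) (Comon_comp M (Comon_comp M k g) (L_arr M h))) \<bullet>\<^bsub>Map_cat M B\<^esub> Rep_nu h k g"
    by (rule rep_cell_unique[OF c Map_vcomp_in[OF 2 3] Map_vcomp_in[OF Rep_nu_in[OF h] Map_id_in[OF Rep_adjunct_arrs[OF hs kgl]]]]) simp
  moreover have "mdom x = h" using x by (simp add: Map_cell_in_iff)
  ultimately show ?case by (simp add: e as_pseudo_sel)
next
  case (5 w c g)
  then obtain A where w: "is_map M w A B" and c: "is_comonad M B c"
    and g': "g \<in> Comon_arrs M B" "cdom g = L_obj M w" "ccod g = c"
    by (auto simp: as_pseudo_sel arr_in_def)
  note g = w g'
  note cw = L_obj_comonad[OF w]
  note a = Rep_adjunct_arrs[OF g] and s = Rep_adjunct_msrc[OF g] and t = Rep_adjunct_mtrg[OF g]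
  let ?a = "Rep_adjunct B T w c g" and ?i = "ComonadMor c (Id2 M (cfun c)) c"
  \<comment> \<open>\<open>Rep_adjunct\<close> is a function of the comonad morphism, so equal
    morphisms have the same chosen 1-cell. The strict unit laws thus make the structure cell end at
    \<open>?a\<close> itself.\<close>
  have e: "Comon_comp M (Comon_comp M ?i g) (L_arr M (Map_id1 M w)) = g"
    "Comon_comp M g (ComonadMor (L_obj M w) (Id2 M (arr w \<odot> radj w)) (L_obj M w)) = g"
    using Comon_comp_id[OF g'(1)] g' by (simp_all add: L_arr_id[OF w])
  have ia: "Map_comp1 M (Map_id1 M (rep_v T c)) ?a = ?a"
    using Map_comp1_id(1)[OF a] t by simp
  have ra: "Map_comp1 M (Rep_arr T ?i) ?a \<in> Map_arrs M B"
    by (rule Map_comp1_arrs[OF a Rep_arr_arrs[OF Comon_id_arrs[OF c]]]) (simp add: t)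
  have 1: "\<guillemotleft>PUnit (Rep_fun M B T) c \<star>\<^bsub>Map_cat M B\<^esub> Id2 (Map_cat M B) ?a : ?a \<Rightarrow>\<^bsub>Map_cat M B\<^esub> Map_comp1 M (Rep_arr T ?i) ?a\<guillemotright>"
    using Map_hcomp_in[OF Map_id_in[OF a] Rep_unit_in[OF c]] t by (simp add: ia)
  have "\<guillemotleft>Rep_nu (Map_id1 M w) ?i g : Map_comp1 M (Map_comp1 M (Rep_arr T ?i) ?a) (Map_id1 M w) \<Rightarrow>\<^bsub>Map_cat M B\<^esub> ?a\<guillemotright>"
    using Rep_nu_in[OF Map_id1_arrs[OF w] Comon_id_arrs[OF c] g'(1)] g' by (simp add: e)
  then have 2: "\<guillemotleft>Rep_nu (Map_id1 M w) ?i g : Map_comp1 M (Rep_arr T ?i) ?a \<Rightarrow>\<^bsub>Map_cat M B\<^esub> ?a\<guillemotright>"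
    using Map_comp1_id(2)[OF ra] s by simp
  have "Rep_nu (Map_id1 M w) ?i g \<bullet>\<^bsub>Map_cat M B\<^esub> (PUnit (Rep_fun M B T) c \<star>\<^bsub>Map_cat M B\<^esub> Id2 (Map_cat M B) ?a) = Id2 (Map_cat M B) ?a"
    by (rule rep_cell_unique[OF c Map_vcomp_in[OF 1 2] Map_id_in[OF a] t])
  then show ?case by (simp add: as_pseudo_sel e)
next
  case (6 h w' w h' w'' k c c' k' c'' g)
  then have h: "h \<in> Map_arrs M B" "k \<in> Comon_arrs M B" "g \<in> Comon_arrs M B" "cdom g = L_obj M (mtrg h)" "ccod g = cdom k"
    and h': "h' \<in> Map_arrs M B" "mtrg h' = msrc h" and k': "k' \<in> Comon_arrs M B" "cdom k' = ccod k"
    and E: "w = mtrg h" "w' = msrc h" "c = cdom k" "c' = ccod k" "c'' = ccod k'" "w'' = msrc h'"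
    by (simp_all add: as_pseudo_sel arr_in_def)
  note g = Map_arrsD(2)[OF h(1)] h(3-5)
  have c: "is_comonad M B (ccod k')"
    using k'(1) by (simp add: Comon_arrs_iff)
  let ?a = "Rep_adjunct B T (mtrg h) (cdom k) g"
  note a = Rep_adjunct_arrs[OF g] and s = Rep_adjunct_msrc[OF g] and t = Rep_adjunct_mtrg[OF g]
  note rk = Rep_arr_arrs[OF h(2)] and rk' = Rep_arr_arrs[OF k'(1)]
  note kk = Comon_comp_arrs[OF h(2) k'(1,2)]
  have hh: "Map_comp1 M h h' \<in> Map_arrs M B"
    using Map_comp1_arrs[OF h'(1) h(1)] h'(2) by simp
  have ah: "Map_comp1 M ?a h \<in> Map_arrs M B" "Map_comp1 M (Map_comp1 M ?a h) h' \<in> Map_arrs M B"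
    using Map_comp1_arrs[OF h(1) a] Map_comp1_arrs[OF h'(1) Map_comp1_arrs[OF h(1) a]] s h'(2) by simp_all
  have ka: "Map_comp1 M (Rep_arr T k) ?a \<in> Map_arrs M B"
    by (rule Map_comp1_arrs[OF a rk]) (simp add: t)
  let ?m = "Comon_comp M (Comon_comp M k g) (L_arr M h)"
  have m: "?m \<in> Comon_arrs M B" "cdom ?m = L_obj M (msrc h)" "ccod ?m = ccod k"
    using adjunct_L_arrs[OF h] L_arr_sel[OF h(1)] by simp_all
  let ?b = "Rep_adjunct B T (msrc h) (ccod k) ?m"
  note b = Rep_adjunct_arrs[OF Map_arrsD(1)[OF h(1)] m] Rep_adjunct_msrc[OF Map_arrsD(1)[OF h(1)] m]
    Rep_adjunct_mtrg[OF Map_arrsD(1)[OF h(1)] m]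
  let ?n = "Comon_comp M (Comon_comp M k' ?m) (L_arr M h')"
  let ?d = "Rep_adjunct B T (msrc h') (ccod k') ?n"
  note L = L_arr_arrs[OF h(1)] L_arr_sel[OF h(1)] L_arr_arrs[OF h'(1)] L_arr_sel[OF h'(1)]
  have kg: "Comon_comp M k g \<in> Comon_arrs M B"
    using Comon_comp_arrs[OF h(3,2)] h(5) by simp
  have kkg: "Comon_comp M k' (Comon_comp M k g) \<in> Comon_arrs M B"
    using Comon_comp_arrs[OF kg k'(1)] k'(2) by simp
  have e0: "Comon_comp M (Comon_comp M k' k) g = Comon_comp M k' (Comon_comp M k g)"
    using Comon_comp_assoc[OF h(3,2) k'(1)] h(5) k'(2) by simp
  \<comment> \<open>Together with \<open>e2\<close> this gives both sides of the composition law the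
    same chosen target \<open>?d\<close>.\<close>
  have e1: "Comon_comp M (Comon_comp M (Comon_comp M k' k) g) (Comon_comp M (L_arr M h) (L_arr M h')) = ?n"
    using Comon_comp_assoc[OF L(1) kg k'(1)] Comon_comp_assoc[OF L(4,1) kkg] L h k' h' by (simp add: e0)
  have e2: "L_arr M (Map_comp1 M h h') = Comon_comp M (L_arr M h) (L_arr M h')"
    using L_arr_comp[OF h'(1) h(1)] h'(2) by simp
  have d: "?d \<in> Map_arrs M B" "mtrg ?d = rep_v T (ccod k')"
    using Rep_adjunct_arrs[OF Map_arrsD(1)[OF h'(1)], of ?n "ccod k'"] Rep_adjunct_mtrg[OF Map_arrsD(1)[OF h'(1)], of ?n "ccod k'"]
      adjunct_L_arrs[OF h'(1) k'(1) m(1)] m L h' k' by simp_all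
  \<comment> \<open>The common source of both sides, in the bracketing in which the right side has
    it; \<open>p1\<close> brings the left side to this form.\<close>
  let ?p = "Map_comp1 M (Rep_arr T k') (Map_comp1 M (Map_comp1 M (Map_comp1 M (Rep_arr T k) ?a) h) h')"
  have p1: "Map_comp1 M (Map_comp1 M (Rep_arr T k') (Rep_arr T k)) (Map_comp1 M (Map_comp1 M ?a h) h') = ?p"
    using Map_comp1_assoc[OF ah(2) rk rk'] Map_comp1_assoc[OF h'(1) ah(1) rk] Map_comp1_assoc[OF h(1) a rk] s t h'(2) k'(2)
    by simp
  have p2: "Map_comp1 M (Rep_arr T (Comon_comp M k' k)) (Map_comp1 M (Map_comp1 M ?a h) h') =
    Map_comp1 M (Map_comp1 M (Rep_arr T (Comon_comp M k' k)) ?a) (Map_comp1 M h h')"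
    using Map_comp1_assoc[OF hh a Rep_arr_arrs[OF kk]] Map_comp1_assoc[OF h'(1) h(1) a] s t h'(2) by simp
  have 1: "\<guillemotleft>PComp (Rep_fun M B T) k' k \<star>\<^bsub>Map_cat M B\<^esub> Id2 (Map_cat M B) (Map_comp1 M (Map_comp1 M ?a h) h') :
    ?p \<Rightarrow>\<^bsub>Map_cat M B\<^esub> Map_comp1 M (Map_comp1 M (Rep_arr T (Comon_comp M k' k)) ?a) (Map_comp1 M h h')\<guillemotright>"
    using Map_hcomp_in[OF Map_id_in[OF ah(2)] Rep_comp_in[OF h(2) k'(1,2)]] t by (simp add: p1 p2)
  have 2: "\<guillemotleft>Rep_nu (Map_comp1 M h h') (Comon_comp M k' k) g :
    Map_comp1 M (Map_comp1 M (Rep_arr T (Comon_comp M k' k)) ?a) (Map_comp1 M h h') \<Rightarrow>\<^bsub>Map_cat M B\<^esub> ?d\<guillemotright>"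
    using Rep_nu_in[OF hh kk h(3)] h(4,5) by (simp add: e2 e1)
  note n1 = Rep_nu_in[OF h]
  have n2: "\<guillemotleft>Rep_nu h k g \<star>\<^bsub>Map_cat M B\<^esub> Id2 (Map_cat M B) h' :
    Map_comp1 M (Map_comp1 M (Map_comp1 M (Rep_arr T k) ?a) h) h' \<Rightarrow>\<^bsub>Map_cat M B\<^esub> Map_comp1 M ?b h'\<guillemotright>"
    by (rule Map_hcomp_in[OF Map_id_in[OF h'(1)] n1]) (simp add: h'(2))
  have "\<guillemotleft>Id2 (Map_cat M B) (Rep_arr T k') \<star>\<^bsub>Map_cat M B\<^esub> (Rep_nu h k g \<star>\<^bsub>Map_cat M B\<^esub> Id2 (Map_cat M B) h') :
    ?p \<Rightarrow>\<^bsub>Map_cat M B\<^esub> Map_comp1 M (Rep_arr T k') (Map_comp1 M ?b h')\<guillemotright>"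
    by (rule Map_hcomp_in[OF n2 Map_id_in[OF rk']]) (simp add: k'(2))
  then have 3: "\<guillemotleft>Id2 (Map_cat M B) (Rep_arr T k') \<star>\<^bsub>Map_cat M B\<^esub> (Rep_nu h k g \<star>\<^bsub>Map_cat M B\<^esub> Id2 (Map_cat M B) h') :
    ?p \<Rightarrow>\<^bsub>Map_cat M B\<^esub> Map_comp1 M (Map_comp1 M (Rep_arr T k') ?b) h'\<guillemotright>"
    using Map_comp1_assoc[OF h'(1) b(1) rk'] b h'(2) k'(2) by simp
  have 4: "\<guillemotleft>Rep_nu h' k' ?m : Map_comp1 M (Map_comp1 M (Rep_arr T k') ?b) h' \<Rightarrow>\<^bsub>Map_cat M B\<^esub> ?d\<guillemotright>"
    using Rep_nu_in[OF h'(1) k'(1) m(1)] m h'(2) k'(2) by simp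
  have "Rep_nu (Map_comp1 M h h') (Comon_comp M k' k) g \<bullet>\<^bsub>Map_cat M B\<^esub>
      (PComp (Rep_fun M B T) k' k \<star>\<^bsub>Map_cat M B\<^esub> Id2 (Map_cat M B) (Map_comp1 M (Map_comp1 M ?a h) h'))
    = Id2 (Map_cat M B) ?d \<bullet>\<^bsub>Map_cat M B\<^esub> Rep_nu h' k' ?m \<bullet>\<^bsub>Map_cat M B\<^esub>
      (Id2 (Map_cat M B) (Rep_arr T k') \<star>\<^bsub>Map_cat M B\<^esub> (Rep_nu h k g \<star>\<^bsub>Map_cat M B\<^esub> Id2 (Map_cat M B) h'))"
    by (rule rep_cell_unique[OF c Map_vcomp_in[OF 1 2] Map_vcomp_in[OF 3 Map_vcomp_in[OF 4 Map_id_in[OF d(1)]]]]) simp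
  then show ?case by (simp add: as_pseudo_sel E e1)
qed

end

end

theorem theorem4p1p1:
  fixes M :: "('o, 'a, 'c) two_cat" and B :: 'o
  assumes "two_category M" and "B \<in> Ob M"
  shows "two_functor (Map_cat M B) (Comon_cat M B) (L_fun M) \<and>
    (has_TK_objects M \<longrightarrow>
      (\<exists>T. is_rep_choice M B T) \<and>
      (\<forall>T. is_rep_choice M B T \<longrightarrow>
         pseudofunctor (Comon_cat M B) (Map_cat M B) (Rep_fun M B T) \<and>
         left_biadjoint (Map_cat M B) (Comon_cat M B)
           (as_pseudo (Comon_cat M B) (L_fun M)) (Rep_fun M B T)))"
proof -
  interpret two_category M by (rule assms(1))
  show ?thesis
    using L_two_functor rep_choice_exists[OF _ assms(2)] Rep_pseudofunctor Rep_hom_biadjunction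
    unfolding left_biadjoint_def by blast
qed

end
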